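(* Let $\lambda\in\mathbb R$ be a constant, and for $t\ge0$ let $\Omega(t)$ be antisymmetric, $\Gamma(t)$ symmetric with $\operatorname{tr}\Gamma(t)=0$, both continuous and bounded, and let $D_r(t)$ be a symmetric positive definite $3\times3$ matrix, continuously differentiable in $t$, such that $D_r(t)$, $dD_r/dt$ and $D_r(t)^{-1}$ are bounded on $[0,\infty)$ (i.e. the eigenvalues of $D_r(t)$ are bounded above and bounded below by a positive constant). Let $B_0$ be symmetric positive definite with $\det B_0=1$ and $A_0=A(B_0)$. Consider the Fast Exact Closure system with anisotropic diffusion $$\frac{dA}{dt}=\tfrac12\,\mathbb C(B):\big[B\cdot(\Omega+\lambda\Gamma)+(-\Omega+\lambda\Gamma)\cdot B\big]+2D_r+3(\operatorname{tr}D_r)A-5\,\mathbb C(B):(B\cdot D_r+D_r\cdot B),$$ $$\frac{dB}{dt}=-\tfrac12\big(B\cdot(\Omega+\lambda\Gamma)+(-\Omega+\lambda\Gamma)\cdot B\big)-\mathbb D(B):\big(2D_r+3(\operatorname{tr}D_r)A\big)+5(B\cdot D_r+D_r\cdot B),$$ with $A(0)=A_0$, $B(0)=B_0$. Then this system has a solution for all $t\ge0$ which stays physical: for every $t\ge0$, $B(t)$ is symmetric positive definite and finite (no eigenvalue becomes $0$ or infinite in finite time), $\det B(t)=1$, and $A(t)=A(B(t))$ is positive definite with trace $1$.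
   Context: All matrices are real $3\times3$. For a symmetric positive definite matrix $B$ define $$A(B)=\tfrac12\int_0^\infty \frac{(B+sI)^{-1}\,ds}{\sqrt{\det(B+sI)}},\qquad \mathbb C(B)=\tfrac34\int_0^\infty\frac{\mathcal S\big((B+sI)^{-1}\otimes(B+sI)^{-1}\big)\,ds}{\sqrt{\det(B+sI)}},$$ where for a rank-4 tensor $\mathbb T$, $\mathcal S(\mathbb T)_{ijkl}$ is the average of $\mathbb T_{mnpq}$ over all permutations $(m,n,p,q)$ of $(i,j,k,l)$. For a rank-4 tensor $\mathbb T$ and a matrix $M$, $(\mathbb T:M)_{ij}=\sum_{k,l}\mathbb T_{ijkl}M_{kl}$. The linear map $M\mapsto \mathbb C(B):M$ on symmetric matrices is invertible; $\mathbb D(B)$ denotes the rank-4 tensor with $\mathbb D_{ijkl}=\mathbb D_{jikl}=\mathbb D_{ijlk}$ representing its inverse, i.e. $\mathbb C(B):\mathbb D(B):M=\mathbb D(B):\mathbb C(B):M=M$ for every symmetric $M$. Here $t$ is time along a material (Lagrangian) trajectory. *)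

theory Defs
  imports "HOL-Analysis.Analysis"
begin

type_synonym mat3 = "real^3^3"
type_synonym tensor4 = "3 \<Rightarrow> 3 \<Rightarrow> 3 \<Rightarrow> 3 \<Rightarrow> real"

definition sym_mat :: "mat3 \<Rightarrow> bool" where
  "sym_mat M \<longleftrightarrow> transpose M = M"

definition posdef :: "mat3 \<Rightarrow> bool" where
  "posdef M \<longleftrightarrow> sym_mat M \<and> (\<forall>x::real^3. x \<noteq> 0 \<longrightarrow> x \<bullet> (M *v x) > 0)"

definition tprod :: "mat3 \<Rightarrow> mat3 \<Rightarrow> tensor4" where
  "tprod X Y = (\<lambda>i j k l. X $ i $ j * Y $ k $ l)"

definition symmetrize :: "tensor4 \<Rightarrow> tensor4" where
  "symmetrize T = (\<lambda>i j k l. let x = (\<lambda>n::nat. [i, j, k, l] ! n) in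
     (1 / fact 4) * (\<Sum>p | p permutes {0..<4::nat}. T (x (p 0)) (x (p 1)) (x (p 2)) (x (p 3))))"

definition ddot :: "tensor4 \<Rightarrow> mat3 \<Rightarrow> mat3" (infixr "\<ddagger>" 70) where
  "T \<ddagger> M = (\<chi> i j. \<Sum>k\<in>UNIV. \<Sum>l\<in>UNIV. T i j k l * M $ k $ l)"

definition Aop :: "mat3 \<Rightarrow> mat3" where
  "Aop B = (\<chi> i j. (1/2) * integral {0..}
      (\<lambda>s::real. matrix_inv (B + s *\<^sub>R mat 1) $ i $ j / sqrt (det (B + s *\<^sub>R mat 1))))"

definition Cop :: "mat3 \<Rightarrow> tensor4" where
  "Cop B = (\<lambda>i j k l. (3/4) * integral {0..}
      (\<lambda>s::real. symmetrize (tprod (matrix_inv (B + s *\<^sub>R mat 1)) (matrix_inv (B + s *\<^sub>R mat 1))) i j k l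
                 / sqrt (det (B + s *\<^sub>R mat 1))))"

definition Dop :: "mat3 \<Rightarrow> tensor4" where
  "Dop B = (SOME T. (\<forall>i j k l. T i j k l = T j i k l \<and> T i j k l = T i j l k) \<and>
      (\<forall>M. sym_mat M \<longrightarrow> Cop B \<ddagger> (T \<ddagger> M) = M \<and> T \<ddagger> (Cop B \<ddagger> M) = M))"

definition fec_rhsA :: "real \<Rightarrow> mat3 \<Rightarrow> mat3 \<Rightarrow> mat3 \<Rightarrow> mat3 \<Rightarrow> mat3 \<Rightarrow> mat3" where
  "fec_rhsA lam Om Ga Dr A B =
     (1/2) *\<^sub>R (Cop B \<ddagger> (B ** (Om + lam *\<^sub>R Ga) + (- Om + lam *\<^sub>R Ga) ** B))
     + 2 *\<^sub>R Dr + (3 * trace Dr) *\<^sub>R A - 5 *\<^sub>R (Cop B \<ddagger> (B ** Dr + Dr ** B))"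

definition fec_rhsB :: "real \<Rightarrow> mat3 \<Rightarrow> mat3 \<Rightarrow> mat3 \<Rightarrow> mat3 \<Rightarrow> mat3 \<Rightarrow> mat3" where
  "fec_rhsB lam Om Ga Dr A B =
     - (1/2) *\<^sub>R (B ** (Om + lam *\<^sub>R Ga) + (- Om + lam *\<^sub>R Ga) ** B)
     - Dop B \<ddagger> (2 *\<^sub>R Dr + (3 * trace Dr) *\<^sub>R A)
     + 5 *\<^sub>R (B ** Dr + Dr ** B)"

end

theory Submission
  imports Defs "HOL-Complex_Analysis.Great_Picard"
begin

text \<open>
  Write \<open>R\<close> for the inverse of \<open>B + s I\<close> and \<open>W\<close> for the inverse square root of its determinant.
  On symmetric \<open>M\<close>, \<open>C(B) : M\<close> is the integral of \<open>(tr(R M) R + 2 R M R) W / 4\<close>, which is minus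
  the derivative of \<open>A(B)\<close> in direction \<open>M\<close>. So it suffices to solve the equation for \<open>B\<close> with
  \<open>A = A(B)\<close>; the equation for \<open>A\<close> then follows from \<open>C(B) : D(B) = id\<close>.

  A priori bounds: \<open>tr A(B)\<close> is the inverse square root of \<open>det B\<close>, and \<open>tr A\<close> satisfies
  \<open>(tr A)' = 2 tr(Dr) (1 - tr A)\<close>, so \<open>det B = 1\<close> is preserved. Let \<open>q\<close> be an eigenvector of \<open>B\<close>, hence
  of \<open>A\<close> with eigenvalue \<open>a\<close>. Since \<open>R B \<le> I\<close>, one gets
  \<open>|q \<cdot> (C : (B Y + Y\<^sup>T B)) q| \<le> 5 |Y| a\<close>, so \<open>det A\<close> decays at most exponentially. As \<open>tr A = 1\<close>, this
  bounds \<open>a\<close> below, and \<open>a \<le> 1 / sqrt b\<close> bounds the eigenvalues \<open>b \<ge> 1\<close> of \<open>B\<close> above; together with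
  \<open>det B = 1\<close> all eigenvalues of \<open>B\<close> stay in a compact subset of \<open>(0, \<infinity>)\<close>.

  The field for \<open>B\<close> is multiplied by a scalar cut-off, which makes it bounded and continuous on the
  whole space, so Peano's theorem applies. Because the cut-off is a scalar factor in \<open>[0, 1]\<close>, the same
  bounds hold for the truncated solution and show that the cut-off never becomes active.
\<close>

section \<open>Peano's existence theorem for bounded fields\<close>

text \<open>The obstacle is \<open>Dop\<close>: it has no formula, being the inverse of an integral
  operator on symmetric matrices, and it is under control only where \<open>B\<close> is positive
  definite. Coercivity of \<open>Cop\<close> yields its continuity, which is exactly what Peano's
  theorem asks for; the solution on the half line is then assembled by choosing extensions.

  The formulas for \<open>Aop\<close> and for its derivative hold in the positive definite cone, so
  the truncation must keep the trajectory there before any estimate is available. Hence two nested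
  sets: a compact \<open>S\<close>, where the estimates finally place the solution, and its closed
  neighbourhood \<open>K\<close>, on which coercivity survives with half the constant and outside
  which the truncated field vanishes. A scalar cut-off commutes with contraction by
  \<open>Cop\<close>, so the equation for \<open>A\<close> acquires the same factor.

  All constants on an interval derive from one lower bound \<open>d\<close> for the determinant of
  \<open>A\<close>. It shrinks as the interval grows, so the half line is covered by unit intervals,
  each started from an admissible value.\<close>

lemma delayed_integral_equation:
  fixes F :: "real \<Rightarrow> 'a::euclidean_space \<Rightarrow> 'a"
  assumes cont: "continuous_on ({a..b} \<times> UNIV) (\<lambda>(t, x). F t x)" and ab: "a \<le> b" and h: "h > 0"
  obtains x where "continuous_on {..b} x"
    "\<And>t. t \<le> b \<Longrightarrow> x t = x0 + integral {a..t} (\<lambda>s. F s (x (s - h)))"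
proof -
  define \<Phi> where "\<Phi> = (\<lambda>y t. x0 + integral {a..t} (\<lambda>s. F s (y (s - h))))"
  define y where "y = (\<lambda>k. (\<Phi> ^^ k) (\<lambda>_. x0))"
  have y_Suc: "y (Suc k) = \<Phi> (y k)" for k
    by (simp add: y_def)
  have contF: "continuous_on {a..b} (\<lambda>s. F s (z (s - h)))" if "continuous_on {..b} z" for z
  proof -
    have "continuous_on {a..b} (\<lambda>s. z (s - h))"
      by (rule continuous_on_compose2[OF that]) (use h in \<open>auto intro!: continuous_intros\<close>)
    then have "continuous_on {a..b} (\<lambda>s. (\<lambda>(t, x). F t x) (s, z (s - h)))"
      by (intro continuous_on_compose2[OF cont] continuous_intros) auto
    then show ?thesis by simp
  qed
  have cont_\<Phi>: "continuous_on {..b} (\<Phi> z)" if "continuous_on {..b} z" for z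
  proof -
    have "continuous_on {a..b} (\<Phi> z)"
      unfolding \<Phi>_def
      by (intro continuous_intros indefinite_integral_continuous_1 integrable_continuous_interval contF that)
    \<comment> \<open>For \<open>t < a\<close> the interval \<open>{a..t}\<close> is empty and the
      integral is 0, so \<open>\<Phi> z\<close> equals \<open>x0\<close> there: the constant
      prehistory that the delay refers to is built in.\<close>
    moreover have "continuous_on {..a} (\<Phi> z)"
    proof (rule continuous_on_eq)
      show "continuous_on {..a} (\<lambda>_. x0)" by simp
      fix t assume "t \<in> {..a}"
      then show "x0 = \<Phi> z t" by (cases "t = a") (auto simp: \<Phi>_def)
    qed
    ultimately have "continuous_on ({..a} \<union> {a..b}) (\<Phi> z)"
      by (intro continuous_on_closed_Un) auto
    moreover have "{..a} \<union> {a..b} = {..b}" using ab by auto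
    ultimately show ?thesis by simp
  qed
  have cont_y: "continuous_on {..b} (y k)" for k
  proof (induction k)
    case 0 then show ?case by (simp add: y_def)
  next
    case (Suc k) then show ?case unfolding y_Suc by (rule cont_\<Phi>)
  qed
  \<comment> \<open>The value of \<open>\<Phi> z\<close> at \<open>t\<close> depends on
    \<open>z\<close> only up to \<open>t - h\<close>, so each iteration settles the iterates on a
    further stretch of length \<open>h\<close>, and finitely many iterations reach
    \<open>b\<close>.\<close>
  have stab: "y (Suc k) t = y k t" if "t \<le> a + real k * h" for k t
    using that
  proof (induction k arbitrary: t)
    case 0 then show ?case by (cases "t = a") (auto simp: y_def \<Phi>_def)
  next
    case (Suc k)
    have "integral {a..t} (\<lambda>s. F s (y (Suc k) (s - h))) = integral {a..t} (\<lambda>s. F s (y k (s - h)))"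
      using Suc.prems by (intro integral_cong) (subst Suc.IH, auto simp: algebra_simps)
    then show ?case unfolding y_Suc[of "Suc k"] y_Suc[of k] by (subst \<Phi>_def, subst (2) \<Phi>_def) (simp add: y_Suc)
  qed
  obtain N where N: "b \<le> a + real N * h"
    using reals_Archimedean3[OF h, rule_format, of "b - a"] by (auto simp: algebra_simps dest: less_imp_le)
  show thesis
  proof (rule that[OF cont_y[of N]])
    fix t assume "t \<le> b"
    then have "y N t = y (Suc N) t" using stab[of t N] N by simp
    then show "y N t = x0 + integral {a..t} (\<lambda>s. F s (y N (s - h)))"
      by (simp add: y_Suc \<Phi>_def)
  qed
qed

lemma has_vector_derivative_imp_continuous_on:
  assumes "\<And>t. t \<in> S \<Longrightarrow> (f has_vector_derivative f' t) (at t within S)"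
  shows "continuous_on S f"
  unfolding continuous_on_eq_continuous_within using assms has_vector_derivative_continuous by blast

text \<open>Tonelli's scheme: the delayed equations are solvable for every delay, and the bound
  \<open>M\<close> on the field makes all their solutions \<open>M\<close>-Lipschitz. Arzela-Ascoli
  gives a uniformly convergent subsequence. The delay changes the argument of the field by at most
  \<open>M * h n\<close>, and dominated convergence passes to the limit in the integral
  equation.\<close>

theorem peano_bounded:
  fixes F :: "real \<Rightarrow> 'a::euclidean_space \<Rightarrow> 'a"
  assumes cont: "continuous_on ({a..b} \<times> UNIV) (\<lambda>(t, x). F t x)" and ab: "a \<le> b"
    and bound: "\<And>t x. t \<in> {a..b} \<Longrightarrow> norm (F t x) \<le> M"
  obtains x where "x a = x0"
    "\<And>t. t \<in> {a..b} \<Longrightarrow> (x has_vector_derivative F t (x t)) (at t within {a..b})"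
proof -
  have M0: "M \<ge> 0"
    using bound[of a 0] ab order_trans[OF norm_ge_zero] by auto
  define h where "h = (\<lambda>n. 1 / real (Suc n))"
  have h0: "h n > 0" for n by (simp add: h_def)
  have "\<exists>x. continuous_on {..b} x \<and>
    (\<forall>t\<le>b. x t = x0 + integral {a..t} (\<lambda>s. F s (x (s - h n))))" for n
    by (rule delayed_integral_equation[OF cont ab h0[of n], of x0]) blast
  then obtain x where cx: "\<And>n. continuous_on {..b} (x n)"
    and x: "\<And>n t. t \<le> b \<Longrightarrow> x n t = x0 + integral {a..t} (\<lambda>s. F s (x n (s - h n)))"
    by metis
  have contF: "continuous_on {a..b} (\<lambda>s. F s (z s))" if "continuous_on {a..b} z" for z
  proof -
    have "continuous_on {a..b} (\<lambda>s. (\<lambda>(t, x). F t x) (s, z s))"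
      by (intro continuous_on_compose2[OF cont] continuous_intros that) auto
    then show ?thesis by simp
  qed
  have cFn: "continuous_on {a..b} (\<lambda>s. F s (x n (s - h n)))" for n
    by (intro contF continuous_on_compose2[OF cx[of n]])
      (use h0[of n] in \<open>auto intro!: continuous_intros\<close>)
  have lip0: "norm (x n t - x n s) \<le> M * (t - s)" if "a \<le> s" "s \<le> t" "t \<le> b" for n s t
  proof -
    let ?f = "\<lambda>s. F s (x n (s - h n))"
    have int: "?f integrable_on {u..v}" if "a \<le> u" "v \<le> b" for u v
      using that by (intro integrable_continuous_interval continuous_on_subset[OF cFn]) auto
    have "integral {a..s} ?f + integral {s..t} ?f = integral {a..t} ?f"
      using that int[of a t] by (intro Henstock_Kurzweil_Integration.integral_combine) auto
    then have "x n t - x n s = integral {s..t} ?f"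
      using that x[of t n] x[of s n] by (simp add: algebra_simps)
    also have "norm \<dots> \<le> M * (t - s)"
      using that by (intro integral_bound continuous_on_subset[OF cFn] bound) auto
    finally show ?thesis .
  qed
  have lip1: "norm (x n t - x n s) \<le> M * \<bar>t - s\<bar>" if "s \<in> {a..b}" "t \<in> {a..b}" for n s t
    using lip0[of s t n] lip0[of t s n] that by (cases "s \<le> t") (auto simp: norm_minus_commute)
  have x_a: "x n t = x0" if "t \<le> a" for n t
    using that ab x[of t n] by (cases "t = a") auto
  have lip2: "norm (x n (s - h n) - x n s) \<le> M * h n" if "s \<in> {a..b}" for n s
  proof (cases "s - h n \<ge> a")
    case True then show ?thesis using lip1[of s "s - h n" n] that h0[of n] by auto
  next
    case False
    then have "x n (s - h n) = x n a" by (simp add: x_a)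
    then have "norm (x n (s - h n) - x n s) \<le> M * \<bar>a - s\<bar>" using lip1[of s a n] that ab by auto
    also have "\<dots> \<le> M * h n" using False that M0 by (intro mult_left_mono) auto
    finally show ?thesis .
  qed
  obtain g k where cg: "continuous_on {a..b} g" and k: "strict_mono (k :: nat \<Rightarrow> nat)"
    and lim: "\<And>e. 0 < e \<Longrightarrow> \<exists>N. \<forall>n t. n \<ge> N \<and> t \<in> {a..b} \<longrightarrow> norm (x (k n) t - g t) < e"
  proof (rule Arzela_Ascoli[of "{a..b}" x "norm x0 + M * (b - a)"])
    fix n t assume t: "t \<in> {a..b}"
    have "norm (x n t) \<le> norm (x n a) + norm (x n t - x n a)" by norm
    also have "\<dots> \<le> norm x0 + M * (t - a)"
      using lip0[of a t n] t by (simp add: x_a)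
    also have "\<dots> \<le> norm x0 + M * (b - a)"
      using t M0 by (intro add_left_mono mult_left_mono) auto
    finally show "norm (x n t) \<le> norm x0 + M * (b - a)" .
  next
    fix t and e :: real assume t: "t \<in> {a..b}" and e: "0 < e"
    show "\<exists>d. 0 < d \<and> (\<forall>n y. y \<in> {a..b} \<and> norm (t - y) < d \<longrightarrow> norm (x n t - x n y) < e)"
    \<comment> \<open>Adding 1 covers \<open>M = 0\<close> and makes the final inequality
      strict.\<close>
    proof (intro exI[of _ "e / (M + 1)"] conjI allI impI)
      show "0 < e / (M + 1)" using e M0 by simp
      fix n y assume y: "y \<in> {a..b} \<and> norm (t - y) < e / (M + 1)"
      have "norm (x n t - x n y) \<le> M * \<bar>t - y\<bar>" using lip1 t y by blast
      also have "\<dots> \<le> M * (e / (M + 1))" using y M0 by (intro mult_left_mono) auto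
      also have "\<dots> < e" using e M0 by (simp add: field_simps)
      finally show "norm (x n t - x n y) < e" .
    qed
  qed auto
  have lim_x: "(\<lambda>n. x (k n) t) \<longlonglongrightarrow> g t" if "t \<in> {a..b}" for t
    unfolding LIMSEQ_iff using lim that by blast
  have "h \<longlonglongrightarrow> 0" unfolding h_def by (rule LIMSEQ_Suc) (rule lim_1_over_n)
  then have h_lim: "(\<lambda>n. M * h (k n)) \<longlonglongrightarrow> 0"
    using tendsto_mult_right_zero LIMSEQ_subseq_LIMSEQ[OF _ k] by (fastforce simp: o_def)
  have lim_xh: "(\<lambda>n. x (k n) (t - h (k n))) \<longlonglongrightarrow> g t" if t: "t \<in> {a..b}" for t
  proof -
    have "(\<lambda>n. x (k n) (t - h (k n)) - x (k n) t) \<longlonglongrightarrow> 0"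
      by (rule Lim_null_comparison[OF _ h_lim]) (use lip2 t in auto)
    from tendsto_add[OF this lim_x[OF t]] show ?thesis by simp
  qed
  have lim_F: "(\<lambda>n. F t (x (k n) (t - h (k n)))) \<longlonglongrightarrow> F t (g t)" if t: "t \<in> {a..b}" for t
  proof -
    have "continuous_on UNIV (\<lambda>z. (\<lambda>(t, x). F t x) (t, z))"
      by (intro continuous_on_compose2[OF cont] continuous_intros) (use t in auto)
    then have "isCont (F t) (g t)" by (simp add: continuous_on_eq_continuous_at)
    then show ?thesis by (rule isCont_tendsto_compose) (rule lim_xh[OF t])
  qed
  have g: "g t = x0 + integral {a..t} (\<lambda>s. F s (g s))" if t: "t \<in> {a..b}" for t
  proof -
    have "(\<lambda>n. integral {a..t} (\<lambda>s. F s (x (k n) (s - h (k n))))) \<longlonglongrightarrow> integral {a..t} (\<lambda>s. F s (g s))"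
      by (rule dominated_convergence(2)[where h = "\<lambda>_. M"])
        (use t bound lim_F in \<open>auto intro!: integrable_continuous_interval continuous_on_subset[OF cFn]\<close>)
    then have "(\<lambda>n. x0 + integral {a..t} (\<lambda>s. F s (x (k n) (s - h (k n))))) \<longlonglongrightarrow> x0 + integral {a..t} (\<lambda>s. F s (g s))"
      by (intro tendsto_intros)
    moreover have "(\<lambda>n. x (k n) t) = (\<lambda>n. x0 + integral {a..t} (\<lambda>s. F s (x (k n) (s - h (k n)))))"
      using t x by auto
    ultimately show ?thesis using LIMSEQ_unique lim_x[OF t] by auto
  qed
  show thesis
  proof (rule that[of g])
    show "g a = x0" using g[of a] ab by simp
    fix t assume t: "t \<in> {a..b}"
    have "((\<lambda>u. x0 + integral {a..u} (\<lambda>s. F s (g s))) has_vector_derivative 0 + F t (g t)) (at t within {a..b})"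
      by (intro has_vector_derivative_add has_vector_derivative_const integral_has_vector_derivative contF cg t)
    then have "((\<lambda>u. x0 + integral {a..u} (\<lambda>s. F s (g s))) has_vector_derivative F t (g t)) (at t within {a..b})"
      by simp
    from has_vector_derivative_transform[OF t g this]
    show "(g has_vector_derivative F t (g t)) (at t within {a..b})" .
  qed
qed

section \<open>Orthonormal eigenframes of symmetric matrices\<close>

lemma symmetric_matrix_inner:
  fixes B :: "real^'n^'n"
  assumes "transpose B = B"
  shows "x \<bullet> (B *v y) = (B *v x) \<bullet> y"
  by (metis assms dot_lmul_matrix transpose_matrix_vector)

text \<open>A maximiser \<open>q\<close> of the quadratic form on the unit sphere of
  \<open>W\<close> is an eigenvector: its residual \<open>N\<close> lies in \<open>W\<close> by
  invariance, and moving from \<open>q\<close> along \<open>N\<close> changes a nonnegative quantity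
  that is 0 at \<open>q\<close> by \<open>2 * e * (N \<bullet> N)\<close> to first order, so
  \<open>N\<close> must vanish.\<close>

lemma eigenvector_in_invariant_subspace:
  fixes B :: "real^'n^'n"
  assumes sym: "transpose B = B" and W: "subspace W" and inv: "\<And>x. x \<in> W \<Longrightarrow> B *v x \<in> W"
    and w: "w \<in> W" "w \<noteq> 0"
  obtains q l where "q \<in> W" "norm q = 1" "B *v q = l *\<^sub>R q"
proof -
  let ?S = "W \<inter> sphere 0 1"
  have "compact ?S"
    by (intro closed_Int_compact closed_subspace W) auto
  moreover have "(1 / norm w) *\<^sub>R w \<in> ?S"
    using w W by (auto intro: subspace_mul)
  moreover have "continuous_on ?S (\<lambda>x. x \<bullet> (B *v x))"
    by (intro continuous_intros linear_continuous_on matrix_vector_mul_bounded_linear)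
  ultimately obtain q where q: "q \<in> ?S" and max: "\<And>y. y \<in> ?S \<Longrightarrow> y \<bullet> (B *v y) \<le> q \<bullet> (B *v q)"
    using continuous_attains_sup[of ?S] by blast
  define l where "l = q \<bullet> (B *v q)"
  define N where "N = l *\<^sub>R q - B *v q"
  have qq: "q \<bullet> q = 1" using q by (simp add: norm_eq_1)
  have max': "y \<bullet> (B *v y) \<le> l * (y \<bullet> y)" if "y \<in> W" for y
  proof (cases "y = 0")
    case False
    have "(1 / norm y) *\<^sub>R y \<in> ?S" using that False W by (auto intro: subspace_mul)
    from max[OF this] have "(y \<bullet> (B *v y)) / (norm y)\<^sup>2 \<le> l"
      by (simp add: l_def matrix_vector_mult_scaleR power2_eq_square)
    then show ?thesis using False by (simp add: field_simps dot_square_norm)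
  qed simp
  have NW: "N \<in> W" using q W inv unfolding N_def by (auto intro: subspace_diff subspace_mul)
  have ineq: "0 \<le> 2 * e * (N \<bullet> N) + e\<^sup>2 * (l * (N \<bullet> N) - N \<bullet> (B *v N))" for e
  proof -
    have "q + e *\<^sub>R N \<in> W" using q NW W by (auto intro: subspace_add subspace_mul)
    from max'[OF this]
    have "0 \<le> l * ((q + e *\<^sub>R N) \<bullet> (q + e *\<^sub>R N)) - (q + e *\<^sub>R N) \<bullet> (B *v (q + e *\<^sub>R N))" by simp
    also have "\<dots> = (l * (q \<bullet> q) - q \<bullet> (B *v q)) + 2 * e * (N \<bullet> (l *\<^sub>R q - B *v q))
        + e\<^sup>2 * (l * (N \<bullet> N) - N \<bullet> (B *v N))"
      using symmetric_matrix_inner[OF sym, of q N]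
      by (simp add: inner_add_left inner_add_right inner_diff_right matrix_vector_right_distrib
          matrix_vector_mult_scaleR inner_commute algebra_simps power2_eq_square)
    also have "\<dots> = 2 * e * (N \<bullet> N) + e\<^sup>2 * (l * (N \<bullet> N) - N \<bullet> (B *v N))"
      using qq by (simp flip: N_def l_def)
    finally show ?thesis .
  qed
  have "N \<bullet> N = 0"
  proof (rule ccontr)
    assume "N \<bullet> N \<noteq> 0"
    then have n: "N \<bullet> N > 0" using inner_ge_zero[of N] by linarith
    \<comment> \<open>\<open>c\<close> is positive and dominates the quadratic coefficient, so at
      the negative step \<open>?e\<close> the linear term outweighs the quadratic one.\<close>
    define c where "c = \<bar>l * (N \<bullet> N) - N \<bullet> (B *v N)\<bar> + 1"
    have c: "c > 0" by (simp add: c_def)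
    let ?e = "- (N \<bullet> N) / c"
    have "0 \<le> 2 * ?e * (N \<bullet> N) + ?e\<^sup>2 * (l * (N \<bullet> N) - N \<bullet> (B *v N))" by (rule ineq)
    also have "\<dots> \<le> 2 * ?e * (N \<bullet> N) + ?e\<^sup>2 * c"
      by (intro add_left_mono mult_left_mono) (auto simp: c_def)
    also have "\<dots> = - ((N \<bullet> N)\<^sup>2 / c)"
      using c by (simp add: field_simps power2_eq_square)
    also have "\<dots> < 0" using c n by simp
    finally show False by simp
  qed
  then have "B *v q = l *\<^sub>R q" by (simp add: N_def)
  with q show thesis by (intro that[of q l]) auto
qed

text \<open>The frame is indexed by the index type itself, so its vectors are the rows of an
  orthogonal matrix, and traces and determinants become sums and products over \<open>UNIV\<close>.
  No continuity of the frame in \<open>B\<close> is involved: every estimate picks a frame of one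
  fixed matrix.\<close>

definition eigenframe :: "real^'n^'n \<Rightarrow> ('n \<Rightarrow> real^'n) \<Rightarrow> ('n \<Rightarrow> real) \<Rightarrow> bool" where
  "eigenframe B q b \<longleftrightarrow>
     (\<forall>i j. q i \<bullet> q j = (if i = j then 1 else 0)) \<and> (\<forall>i. B *v q i = b i *\<^sub>R q i)"

text \<open>Induction on the set of indices already served: the orthogonal complement of the vectors
  found so far is invariant because \<open>B\<close> is symmetric, and it is nonzero because fewer
  vectors than the dimension have been used.\<close>

theorem symmetric_eigenframe:
  fixes B :: "real^'n^'n"
  assumes sym: "transpose B = B"
  obtains q b where "eigenframe B q b"
proof -
  have "\<exists>q b. (\<forall>i\<in>I. \<forall>j\<in>I. q i \<bullet> q j = (if i = j then 1 else 0)) \<and> (\<forall>i\<in>I. B *v q i = b i *\<^sub>R q i)"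
    for I :: "'n set"
    using finite[of I]
  proof (induction I rule: finite_induct)
    case (insert k I)
    then obtain q b where q: "\<And>i j. i \<in> I \<Longrightarrow> j \<in> I \<Longrightarrow> q i \<bullet> q j = (if i = j then 1 else (0::real))"
      and b: "\<And>i. i \<in> I \<Longrightarrow> B *v q i = b i *\<^sub>R q i" by blast
    let ?W = "{x. \<forall>i\<in>I. q i \<bullet> x = 0}"
    have sW: "subspace ?W" by (auto simp: subspace_def inner_add_right)
    have iW: "B *v x \<in> ?W" if "x \<in> ?W" for x
      using that b by (auto simp: symmetric_matrix_inner[OF sym])
    have "dim (q ` I) < DIM(real^'n)"
    proof -
      have "dim (q ` I) \<le> card (q ` I)" by (rule dim_le_card') simp
      also have "\<dots> \<le> card I" by (rule card_image_le) simp
      also have "\<dots> < card (insert k I)" using insert by simp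
      also have "\<dots> \<le> CARD('n)" by (rule card_mono) auto
      finally show ?thesis by simp
    qed
    then obtain w where w: "w \<noteq> 0" "\<And>y. y \<in> span (q ` I) \<Longrightarrow> orthogonal w y"
      using orthogonal_to_subspace_exists by blast
    have "q i \<bullet> w = 0" if "i \<in> I" for i
      using w(2)[of "q i"] that by (simp add: orthogonal_def inner_commute span_base)
    then have "w \<in> ?W" by blast
    from eigenvector_in_invariant_subspace[OF sym sW iW this w(1)]
    obtain v l where v: "v \<in> ?W" "norm v = 1" "B *v v = l *\<^sub>R v" .
    show ?case
      using q b v insert.hyps
      by (intro exI[of _ "q(k := v)"] exI[of _ "b(k := l)"]) (auto simp: inner_commute norm_eq_1)
  qed simp
  from this[of UNIV] show thesis using that by (auto simp: eigenframe_def)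
qed

section \<open>Inverses, traces and determinants in an eigenframe\<close>

lemma matrix_inv_works:
  fixes A :: "real^'n^'n"
  assumes "invertible A"
  shows "A ** matrix_inv A = mat 1" "matrix_inv A ** A = mat 1"
  using someI_ex[OF assms[unfolded invertible_def]] unfolding matrix_inv_def by auto

lemma matrix_inv_unique:
  fixes A :: "real^'n^'n"
  assumes "A ** R = mat 1"
  shows "matrix_inv A = R"
proof -
  have "R ** A = mat 1" using assms matrix_left_right_inverse by blast
  then have "invertible A" using assms unfolding invertible_def by blast
  then have "matrix_inv A = matrix_inv A ** (A ** R)" by (simp add: assms)
  also have "\<dots> = R" by (simp add: matrix_mul_assoc matrix_inv_works \<open>invertible A\<close>)
  finally show ?thesis .
qed

context
  fixes B :: "real^'n^'n" and q b
  assumes frame: "eigenframe B q b"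
begin

lemma eigenframe_inner: "q i \<bullet> q j = (if i = j then 1 else 0)"
  using frame by (simp add: eigenframe_def)

lemma eigenframe_eigen: "B *v q i = b i *\<^sub>R q i"
  using frame by (simp add: eigenframe_def)

lemma eigenframe_norm: "norm (q i) = 1"
  by (simp add: norm_eq_1 eigenframe_inner)

lemma eigenframe_orthogonal: "orthogonal_matrix (\<chi> i. q i)"
proof -
  have "(\<chi> i. q i) ** transpose (\<chi> i. q i) = mat 1"
    by (simp add: matrix_mult_transpose_dot_row row_def eigenframe_inner vec_eq_iff mat_def)
  then show ?thesis by (simp add: orthogonal_matrix_def matrix_left_right_inverse)
qed

lemma eigenframe_conjugate:
  "((\<chi> i. q i) ** M ** transpose (\<chi> i. q i)) $ i $ j = q i \<bullet> (M *v q j)"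
proof -
  have "((\<chi> i. q i) ** M ** transpose (\<chi> i. q i)) $ i $ j = ((\<chi> i. q i) ** (M ** transpose (\<chi> i. q i))) $ i $ j"
    by (simp add: matrix_mul_assoc)
  also have "\<dots> = q i \<bullet> (M *v q j)"
    by (simp add: matrix_matrix_mult_def matrix_vector_mult_def transpose_def inner_vec_def)
  finally show ?thesis .
qed

lemma eigenframe_trace: "trace M = (\<Sum>i\<in>UNIV. q i \<bullet> (M *v q i))"
proof -
  let ?Q = "\<chi> i. q i"
  have "trace (?Q ** M ** transpose ?Q) = trace (transpose ?Q ** (?Q ** M))"
    by (rule trace_mul_sym)
  also have "\<dots> = trace M"
    using eigenframe_orthogonal by (simp add: matrix_mul_assoc orthogonal_matrix_def)
  finally show ?thesis by (simp only: trace_def eigenframe_conjugate)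
qed

lemma eigenframe_det: "det B = (\<Prod>i\<in>UNIV. b i)"
proof -
  let ?Q = "\<chi> i. q i"
  have "det B = det ?Q * det ?Q * det B"
    using det_orthogonal_matrix[OF eigenframe_orthogonal] by auto
  also have "\<dots> = det (?Q ** B ** transpose ?Q)" by (simp add: det_mul det_transpose)
  also have "\<dots> = (\<Prod>i\<in>UNIV. (?Q ** B ** transpose ?Q) $ i $ i)"
    by (rule det_diagonal) (simp add: eigenframe_conjugate eigenframe_eigen eigenframe_inner)
  also have "\<dots> = (\<Prod>i\<in>UNIV. b i)"
    by (simp add: eigenframe_conjugate eigenframe_eigen eigenframe_inner)
  finally show ?thesis .
qed

lemma eigenframe_shift: "eigenframe (B + s *\<^sub>R mat 1) q (\<lambda>i. b i + s)"
  using frame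
  by (auto simp: eigenframe_def matrix_vector_mult_add_rdistrib scaleR_matrix_vector_assoc[symmetric] algebra_simps)

lemma eigenframe_eq_0:
  assumes "\<And>i. M *v q i = 0"
  shows "M = (0::real^'n^'n)"
proof -
  let ?Q = "\<chi> i. q i"
  have "(M ** transpose ?Q) $ i $ j = (M *v q j) $ i" for i j
    by (simp add: matrix_matrix_mult_def matrix_vector_mult_def transpose_def)
  then have *: "M ** transpose ?Q = 0" using assms by (simp add: vec_eq_iff)
  have "M = M ** (transpose ?Q ** ?Q)"
    using eigenframe_orthogonal by (simp add: orthogonal_matrix_def)
  also have "\<dots> = 0" by (simp add: matrix_mul_assoc *)
  finally show ?thesis .
qed

lemma eigenframe_matrix_inv:
  assumes "\<And>i. b i \<noteq> 0"
  shows "matrix_inv B *v q i = (1 / b i) *\<^sub>R q i"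
proof -
  have "det B \<noteq> 0" using assms by (simp add: eigenframe_det)
  then have "matrix_inv B ** B = mat 1"
    by (intro matrix_inv_works) (simp add: invertible_det_nz)
  then have "q i = matrix_inv B *v (B *v q i)" by (simp add: matrix_vector_mul_assoc)
  also have "\<dots> = b i *\<^sub>R (matrix_inv B *v q i)" by (simp add: eigenframe_eigen matrix_vector_mult_scaleR)
  finally have "(1 / b i) *\<^sub>R q i = (1 / b i) *\<^sub>R (b i *\<^sub>R (matrix_inv B *v q i))" by simp
  then show ?thesis using assms[of i] by simp
qed

end

section \<open>Calculus of 3 by 3 matrices\<close>

lemma norm_transpose: "norm (transpose M) = norm (M :: real^'n^'m)"
proof -
  have "transpose M \<bullet> transpose M = M \<bullet> M"
    unfolding inner_vec_def transpose_def by simp (rule sum.swap)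
  then show ?thesis by (simp add: norm_eq_sqrt_inner)
qed

lemma norm_matrix_vector_mult_le:
  fixes A :: "real^'n^'m"
  shows "norm (A *v x) \<le> norm A * norm x"
proof -
  have "norm (A *v x) \<le> L2_set (\<lambda>i. norm (A $ i) * norm x) UNIV"
    unfolding norm_vec_def[of "A *v x"]
    by (intro L2_set_mono) (auto simp: matrix_vector_mul_component Cauchy_Schwarz_ineq2)
  also have "\<dots> = norm A * norm x"
    by (simp add: L2_set_left_distrib norm_vec_def[of A])
  finally show ?thesis .
qed

lemma bounded_bilinear_matrix_mult:
  "bounded_bilinear ((**) :: real^'n^'m \<Rightarrow> real^'k^'n \<Rightarrow> real^'k^'m)"
proof -
  have "bilinear ((**) :: real^'n^'m \<Rightarrow> real^'k^'n \<Rightarrow> real^'k^'m)"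
    unfolding bilinear_def
    by (auto intro!: linearI simp: vec_eq_iff matrix_matrix_mult_def sum.distrib
        sum_distrib_left algebra_simps)
  then show ?thesis by (simp add: bilinear_conv_bounded_bilinear)
qed

lemma bounded_bilinear_matrix_vector_mult:
  "bounded_bilinear ((*v) :: real^'n^'m \<Rightarrow> real^'n \<Rightarrow> real^'m)"
proof -
  have "bilinear ((*v) :: real^'n^'m \<Rightarrow> real^'n \<Rightarrow> real^'m)"
    unfolding bilinear_def
    by (auto intro!: linearI simp: vec_eq_iff matrix_vector_mult_def sum.distrib
        sum_distrib_left algebra_simps)
  then show ?thesis by (simp add: bilinear_conv_bounded_bilinear)
qed

lemma bounded_linear_trace: "bounded_linear (trace :: real^'n^'n \<Rightarrow> real)"
  unfolding linear_conv_bounded_linear[symmetric]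
  by (rule linearI) (auto simp: trace_def sum_distrib_left sum.distrib)

lemma bounded_linear_transpose: "bounded_linear (transpose :: real^'n^'m \<Rightarrow> real^'m^'n)"
  unfolding linear_conv_bounded_linear[symmetric]
  by (rule linearI) (simp_all add: transpose_def vec_eq_iff)

lemmas continuous_on_matrix_mult [continuous_intros] =
  bounded_bilinear.continuous_on[OF bounded_bilinear_matrix_mult]
lemmas continuous_on_matrix_vector_mult [continuous_intros] =
  bounded_bilinear.continuous_on[OF bounded_bilinear_matrix_vector_mult]
lemmas continuous_on_trace [continuous_intros] =
  bounded_linear.continuous_on[OF bounded_linear_trace]
lemmas continuous_on_transpose [continuous_intros] =
  bounded_linear.continuous_on[OF bounded_linear_transpose]

lemma continuous_on_det3 [continuous_intros]:
  fixes f :: "'a::topological_space \<Rightarrow> real^3^3"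
  assumes "continuous_on S f"
  shows "continuous_on S (\<lambda>x. det (f x))"
  unfolding det_3 by (intro continuous_intros assms)

lemma trace_minus: "trace (- A) = - trace (A :: real^'n^'n)"
  by (simp add: trace_def sum_negf)

lemma trace_scaleR: "trace (c *\<^sub>R A) = c * trace (A :: real^'n^'n)"
  by (simp add: trace_def sum_distrib_left)

text \<open>The adjugate. Arithmetic in the index type \<open>3\<close> is modulo 3, and the cyclic
  shifts by 1 and 2 absorb the alternating signs of the cofactors; \<open>three_arith\<close>
  reduces the indices that result.\<close>

definition adj3 :: "real^3^3 \<Rightarrow> real^3^3" where
  "adj3 X = (\<chi> i j. X $ (j+1) $ (i+1) * X $ (j+2) $ (i+2) - X $ (j+1) $ (i+2) * X $ (j+2) $ (i+1))"

lemma three_arith: "(4::3) = 1" "(5::3) = 2" "(0::3) = 3"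
  by (simp_all add: numeral_eq_Suc)

lemma matrix_mult_adj3: "X ** adj3 X = det X *\<^sub>R mat 1"
  by (simp add: vec_eq_iff forall_3 matrix_matrix_mult_def sum_3 adj3_def det_3 mat_def three_arith)
    (simp add: algebra_simps)

lemma matrix_inv_adj3:
  assumes "det X \<noteq> 0"
  shows "matrix_inv X = (1 / det X) *\<^sub>R adj3 X"
  by (rule matrix_inv_unique)
    (simp add: matrix_scalar_ac matrix_mult_adj3 assms scalar_matrix_assoc[symmetric] bounded_bilinear.scaleR_right[OF bounded_bilinear_matrix_mult])

lemma continuous_on_matrix_inv:
  fixes f :: "'a::topological_space \<Rightarrow> real^3^3"
  assumes f: "continuous_on S f" and nz: "\<And>x. x \<in> S \<Longrightarrow> det (f x) \<noteq> 0"
  shows "continuous_on S (\<lambda>x. matrix_inv (f x))"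
proof -
  have "continuous_on S (\<lambda>x. (1 / det (f x)) *\<^sub>R adj3 (f x))"
    unfolding adj3_def using nz by (intro continuous_intros f) auto
  then show ?thesis
    using nz by (subst continuous_on_cong[OF refl matrix_inv_adj3]) auto
qed

text \<open>Turns a derivative into a plain limit of difference quotients, so that algebraic
  identities for the quotient can be combined with continuity of matrix multiplication.\<close>

lemma has_vector_derivative_iff_quotient:
  "(f has_vector_derivative D) (at x within S) \<longleftrightarrow>
   ((\<lambda>y. (1 / (y - x)) *\<^sub>R (f y - f x)) \<longlongrightarrow> D) (at x within S)"
proof -
  have "norm ((1 / norm (y - x)) *\<^sub>R (f y - (f x + (y - x) *\<^sub>R D))) = norm ((1 / (y - x)) *\<^sub>R (f y - f x) - D)"
    if "y \<noteq> x" for y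
  proof -
    have "(1 / (y - x)) *\<^sub>R (f y - f x) - D = (1 / (y - x)) *\<^sub>R (f y - (f x + (y - x) *\<^sub>R D))"
      using that by (simp add: scaleR_diff_right scaleR_add_right)
    then show ?thesis by simp
  qed
  then have "((\<lambda>y. (1 / norm (y - x)) *\<^sub>R (f y - (f x + (y - x) *\<^sub>R D))) \<longlongrightarrow> 0) (at x within S) \<longleftrightarrow>
    ((\<lambda>y. (1 / (y - x)) *\<^sub>R (f y - f x) - D) \<longlongrightarrow> 0) (at x within S)"
    by (subst (1 2) tendsto_norm_zero_iff[symmetric])
      (intro filterlim_cong refl eventually_at_filter[THEN iffD2] always_eventually, auto)
  then show ?thesis
    by (simp add: has_vector_derivative_def has_derivative_within bounded_linear_scaleR_left LIM_zero_iff)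
qed

text \<open>Resolvent identity: the inverse at \<open>v\<close> minus the inverse at
  \<open>u\<close> is minus \<open>matrix_inv (X v) ** (X v - X u) ** matrix_inv (X u)\<close>.
  After division by \<open>v - u\<close> only continuity of the inverse is left to show, and the
  adjugate formula gives it.\<close>

lemma has_vector_derivative_matrix_inv:
  fixes X :: "real \<Rightarrow> real^3^3"
  assumes X: "(X has_vector_derivative X') (at u within T)" and u: "u \<in> T"
    and nz: "\<And>v. v \<in> T \<Longrightarrow> det (X v) \<noteq> 0"
  shows "((\<lambda>v. matrix_inv (X v)) has_vector_derivative
    - (matrix_inv (X u) ** X' ** matrix_inv (X u))) (at u within T)"
proof -
  interpret mm: bounded_bilinear "(**) :: real^3^3 \<Rightarrow> real^3^3 \<Rightarrow> real^3^3" by (rule bounded_bilinear_matrix_mult)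
  have cX: "(X \<longlongrightarrow> X u) (at u within T)"
    using has_vector_derivative_continuous[OF X] by (simp add: continuous_within)
  have "((\<lambda>v. (1 / det (X v)) *\<^sub>R adj3 (X v)) \<longlongrightarrow> (1 / det (X u)) *\<^sub>R adj3 (X u)) (at u within T)"
    unfolding adj3_def det_3 using nz[OF u] by (intro tendsto_intros cX) (auto simp: det_3)
  then have "((\<lambda>v. matrix_inv (X v)) \<longlongrightarrow> (1 / det (X u)) *\<^sub>R adj3 (X u)) (at u within T)"
    by (rule Lim_transform_eventually) (auto simp: eventually_at_filter matrix_inv_adj3 nz)
  then have cR: "((\<lambda>v. matrix_inv (X v)) \<longlongrightarrow> matrix_inv (X u)) (at u within T)"
    by (simp add: matrix_inv_adj3 nz u)
  have "((\<lambda>v. - (matrix_inv (X v) ** ((1 / (v - u)) *\<^sub>R (X v - X u)) ** matrix_inv (X u))) \<longlongrightarrow>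
      - (matrix_inv (X u) ** X' ** matrix_inv (X u))) (at u within T)"
    using X unfolding has_vector_derivative_iff_quotient
    by (intro tendsto_minus mm.tendsto cR tendsto_const)
  moreover have "- (matrix_inv (X v) ** ((1 / (v - u)) *\<^sub>R (X v - X u)) ** matrix_inv (X u)) =
      (1 / (v - u)) *\<^sub>R (matrix_inv (X v) - matrix_inv (X u))" if v: "v \<in> T" for v
  proof -
    have inv: "invertible (X v)" "invertible (X u)"
      using nz v u by (auto simp: invertible_det_nz)
    have "matrix_inv (X v) ** (X v - X u) ** matrix_inv (X u) =
      (matrix_inv (X v) ** X v) ** matrix_inv (X u) - matrix_inv (X v) ** (X u ** matrix_inv (X u))"
      by (simp add: mm.diff_left mm.diff_right matrix_mul_assoc)
    also have "\<dots> = matrix_inv (X u) - matrix_inv (X v)"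
      by (simp add: matrix_inv_works inv)
    finally show ?thesis
      by (simp only: mm.scaleR_right mm.scaleR_left scaleR_minus_right[symmetric] minus_diff_eq)
  qed
  ultimately show ?thesis
    unfolding has_vector_derivative_iff_quotient
    by (elim Lim_transform_eventually) (auto simp: eventually_at_filter)
qed

lemma has_vector_derivative_matrix_component:
  fixes X :: "real \<Rightarrow> real^'n^'m"
  assumes "(X has_vector_derivative X') F"
  shows "((\<lambda>u. X u $ i $ j) has_real_derivative X' $ i $ j) F"
proof -
  have "bounded_linear (\<lambda>X :: real^'n^'m. X $ i $ j)"
    by (intro bounded_linear_compose[OF bounded_linear_vec_nth] bounded_linear_vec_nth)
  then show ?thesis
    using bounded_linear.has_vector_derivative[OF _ assms] has_real_derivative_iff_has_vector_derivative by blast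
qed

text \<open>Jacobi's formula: the entries of \<open>adj3\<close> are the partial derivatives of the
  determinant. The result is kept as determinant times trace, a logarithmic derivative, because the
  inverse square root and the exponential lower bound both use it in this form.\<close>

lemma has_real_derivative_det3:
  fixes X :: "real \<Rightarrow> real^3^3"
  assumes X: "(X has_vector_derivative X') (at u within T)" and nz: "det (X u) \<noteq> 0"
  shows "((\<lambda>v. det (X v)) has_real_derivative det (X u) * trace (matrix_inv (X u) ** X')) (at u within T)"
proof -
  note [derivative_intros] = has_vector_derivative_matrix_component[OF X]
  have "((\<lambda>v. det (X v)) has_real_derivative trace (adj3 (X u) ** X')) (at u within T)"
    unfolding det_3
    by (auto intro!: derivative_eq_intros simp: trace_def sum_3 matrix_matrix_mult_def adj3_def three_arith algebra_simps)
  also have "trace (adj3 (X u) ** X') = det (X u) * trace (matrix_inv (X u) ** X')"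
    using nz by (simp add: matrix_inv_adj3 bounded_bilinear.scaleR_left[OF bounded_bilinear_matrix_mult] trace_scaleR)
  finally show ?thesis .
qed

section \<open>Dominated integrals on the half line\<close>

text \<open>A multiple of this function is the majorant in every dominated integral below. Its total
  mass 1 also supplies the constant in \<open>eigenvalue_Aop_le\<close>.\<close>

lemma has_integral_inverse_square:
  "((\<lambda>s::real. 1 / (1 + s)\<^sup>2) has_integral 1) {0..}"
proof (rule has_integral_to_inf)
  have F: "((\<lambda>s. 1 / (1 + s)\<^sup>2) has_integral (1 - 1 / (1 + y))) {0..y}" if "0 \<le> y" for y :: real
  proof -
    have "((\<lambda>s. 1 / (1 + s)\<^sup>2) has_integral (- 1 / (1 + y) - (- 1 / (1 + 0)))) {0..y}"
      using that
      by (intro fundamental_theorem_of_calculus)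
        (auto intro!: derivative_eq_intros simp: power2_eq_square
          simp flip: has_real_derivative_iff_has_vector_derivative)
    then show ?thesis by simp
  qed
  show "(\<lambda>s::real. 1 / (1 + s)\<^sup>2) integrable_on {0..y}" for y
    using F[of y] by (cases "0 \<le> y") (auto simp: has_integral_iff)
  have "((\<lambda>y::real. 1 - 1 / (1 + y)) \<longlongrightarrow> 1 - 0) at_top"
    by (intro tendsto_intros tendsto_divide_0[OF tendsto_const] filterlim_at_top_imp_at_infinity
        filterlim_tendsto_add_at_top[OF tendsto_const] filterlim_ident)
  then have "((\<lambda>y::real. 1 - 1 / (1 + y)) \<longlongrightarrow> 1) at_top" by simp
  then show "((\<lambda>y. integral {0..y} (\<lambda>s::real. 1 / (1 + s)\<^sup>2)) \<longlongrightarrow> 1) at_top"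
    by (rule Lim_transform_eventually)
      (auto intro!: eventually_mono[OF eventually_ge_at_top[of 0]] integral_unique[OF F, symmetric])
qed auto

lemma integrable_inverse_square: "(\<lambda>s::real. K / (1 + s)\<^sup>2) integrable_on {0..}"
  using has_integral_mult_right[OF has_integral_inverse_square, of K] by (auto simp: has_integral_iff)

lemma integrable_halfline_dominated:
  fixes f :: "real \<Rightarrow> real"
  assumes f: "continuous_on {0..} f" and le: "\<And>s. s \<ge> 0 \<Longrightarrow> \<bar>f s\<bar> \<le> K / (1 + s)\<^sup>2"
  shows "f integrable_on {0..}"
proof (rule integrable_on_all_intervals_integrable_bound[OF _ _ integrable_inverse_square])
  fix a b :: real
  have "f integrable_on ({0..} \<inter> cbox a b)"
    by (cases "max 0 a \<le> b")
      (auto simp: Int_atLeastAtMost max_def intro!: integrable_continuous_interval continuous_on_subset[OF f])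
  then show "(\<lambda>s. if s \<in> {0..} then f s else 0) integrable_on cbox a b"
    by (subst integrable_restrict_Int)
qed (use le in auto)

text \<open>Strictness comes from the unit interval alone, where a continuous positive function has
  a positive minimum.\<close>

lemma integral_halfline_pos:
  fixes f :: "real \<Rightarrow> real"
  assumes f: "continuous_on {0..} f" and int: "f integrable_on {0..}" and pos: "\<And>s. s \<ge> 0 \<Longrightarrow> f s > 0"
  shows "integral {0..} f > 0"
proof -
  have c: "continuous_on {0..1} f" by (rule continuous_on_subset[OF f]) auto
  obtain m where m: "m \<in> {0..1}" "\<And>s. s \<in> {0..1} \<Longrightarrow> f m \<le> f s"
    using continuous_attains_inf[OF _ _ c] by auto
  have "0 < f m" using m pos by auto
  also have "f m = integral {0..1} (\<lambda>s::real. f m)" by simp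
  also have "\<dots> \<le> integral {0..1} f"
    by (rule integral_le) (use m c in \<open>auto intro: integrable_continuous_interval\<close>)
  also have "\<dots> \<le> integral {0..} f"
    by (rule integral_subset_le) (use c int pos in \<open>auto intro: integrable_continuous_interval less_imp_le\<close>)
  finally show ?thesis .
qed

lemma continuous_on_integral_dominated:
  fixes f :: "'a::metric_space \<Rightarrow> 'n::euclidean_space \<Rightarrow> real"
  assumes cont: "\<And>s. s \<in> S \<Longrightarrow> continuous_on T (\<lambda>u. f u s)"
    and int: "\<And>u. u \<in> T \<Longrightarrow> f u integrable_on S"
    and le: "\<And>u s. u \<in> T \<Longrightarrow> s \<in> S \<Longrightarrow> \<bar>f u s\<bar> \<le> h s" and h: "h integrable_on S"
  shows "continuous_on T (\<lambda>u. integral S (f u))"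
  unfolding continuous_on_sequentially
proof (intro allI ballI impI, elim conjE)
  fix x a assume a: "a \<in> T" and x: "\<forall>n. x n \<in> T" and lim: "x \<longlonglongrightarrow> a"
  have "(\<lambda>n. integral S (f (x n))) \<longlonglongrightarrow> integral S (f a)"
  proof (rule dominated_convergence(2)[OF _ h])
    fix s assume "s \<in> S"
    then show "(\<lambda>n. f (x n) s) \<longlonglongrightarrow> f a s"
      using cont a x lim unfolding continuous_on_sequentially by (auto simp: o_def)
  qed (use x int le in auto)
  then show "((\<lambda>u. integral S (f u)) \<circ> x) \<longlonglongrightarrow> integral S (f a)" by (simp add: o_def)
qed

text \<open>Convexity of \<open>T\<close> lets the mean value inequality bound each difference
  quotient by the majorant of the derivative; dominated convergence along arbitrary sequences does
  the rest. Working within \<open>T\<close> covers one-sided derivatives at end points.\<close>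

lemma has_real_derivative_integral_dominated:
  fixes f :: "real \<Rightarrow> 'n::euclidean_space \<Rightarrow> real"
  assumes T: "convex T" "t \<in> T"
    and int: "\<And>u. u \<in> T \<Longrightarrow> f u integrable_on S"
    and deriv: "\<And>u s. u \<in> T \<Longrightarrow> s \<in> S \<Longrightarrow> ((\<lambda>u. f u s) has_real_derivative f' u s) (at u within T)"
    and le: "\<And>u s. u \<in> T \<Longrightarrow> s \<in> S \<Longrightarrow> \<bar>f' u s\<bar> \<le> h s" and h: "h integrable_on S"
  shows "((\<lambda>u. integral S (f u)) has_real_derivative integral S (f' t)) (at t within T)"
  unfolding has_field_derivative_iff tendsto_at_iff_sequentially
proof (intro allI impI)
  fix x assume xT: "\<forall>n. x n \<in> T - {t}" and lim: "x \<longlonglongrightarrow> t"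
  let ?q = "\<lambda>n s. (f (x n) s - f t s) / (x n - t)"
  have "(\<lambda>n. integral S (?q n)) \<longlonglongrightarrow> integral S (f' t)"
  proof (rule dominated_convergence(2)[OF _ h])
    show "?q n integrable_on S" for n
      using integrable_cmul[OF integrable_diff[OF int int], of "x n" t "1 / (x n - t)"] xT T
      by (simp add: divide_simps)
    fix s assume s: "s \<in> S"
    have "\<bar>f (x n) s - f t s\<bar> \<le> h s * \<bar>x n - t\<bar>" for n
      using field_differentiable_bound[OF T(1) deriv[OF _ s] , of "h s" "x n" t] le s xT T(2) by auto
    then show "norm (?q n s) \<le> h s" for n
      using xT by (auto simp: abs_divide divide_simps)
    show "(\<lambda>n. ?q n s) \<longlonglongrightarrow> f' t s"
      using deriv[OF T(2) s] xT lim
      unfolding has_field_derivative_iff tendsto_at_iff_sequentially by (auto simp: o_def)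
  qed
  moreover have "integral S (?q n) = (integral S (f (x n)) - integral S (f t)) / (x n - t)" for n
  proof -
    have "integral S (?q n) = integral S (\<lambda>s. (f (x n) s - f t s) * (1 / (x n - t)))" by simp
    also have "\<dots> = integral S (\<lambda>s. f (x n) s - f t s) * (1 / (x n - t))"
      by (rule integral_mult_left)
    also have "\<dots> = (integral S (f (x n)) - integral S (f t)) / (x n - t)"
      using int xT T by (simp add: integral_diff)
    finally show ?thesis .
  qed
  ultimately show "((\<lambda>y. (integral S (f y) - integral S (f t)) / (y - t)) \<circ> x) \<longlonglongrightarrow> integral S (f' t)"
    by (simp only: o_def)
qed

section \<open>Resolvents of coercive matrices\<close>

text \<open>Positive definiteness with a quantitative lower bound on the spectrum. A common
  \<open>e\<close> for a family of matrices is what makes the integrands of \<open>Aop\<close> and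
  \<open>Cop\<close> uniformly dominated.\<close>

definition coercive :: "real \<Rightarrow> mat3 \<Rightarrow> bool" where
  "coercive e B \<longleftrightarrow> sym_mat B \<and> (\<forall>x. e * (x \<bullet> x) \<le> x \<bullet> (B *v x))"

lemma coercive_posdef: "coercive e B \<Longrightarrow> e > 0 \<Longrightarrow> posdef B"
  unfolding coercive_def posdef_def
  by (metis inner_gt_zero_iff mult_pos_pos order_less_le_trans)

lemma coercive_mono: "coercive e B \<Longrightarrow> d \<le> e \<Longrightarrow> coercive d B"
  unfolding coercive_def by (meson inner_ge_zero mult_right_mono order_trans)

text \<open>The quadratic form attains its minimum over the compact product of \<open>K\<close> with
  the unit sphere, and this minimum is a common coercivity constant. It is capped at 1 because the
  resolvent estimates assume \<open>e \<le> 1\<close>.\<close>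

lemma coercive_uniform:
  fixes B :: "'a::topological_space \<Rightarrow> mat3"
  assumes K: "compact K" and B: "continuous_on K B" and pd: "\<And>u. u \<in> K \<Longrightarrow> posdef (B u)"
  obtains e where "0 < e" "e \<le> 1" "\<And>u. u \<in> K \<Longrightarrow> coercive e (B u)"
proof (cases "K = {}")
  case True then show ?thesis using that[of 1] by auto
next
  case False
  let ?S = "K \<times> sphere (0::real^3) 1"
  have "continuous_on ?S (\<lambda>p. snd p \<bullet> (B (fst p) *v snd p))"
    by (intro continuous_intros continuous_on_compose2[OF B]) auto
  moreover have "compact ?S" by (intro compact_Times K compact_sphere)
  moreover have "?S \<noteq> {}" using False by auto
  ultimately obtain p where p: "p \<in> ?S"
    and min: "\<And>u x. u \<in> K \<Longrightarrow> norm x = 1 \<Longrightarrow> snd p \<bullet> (B (fst p) *v snd p) \<le> x \<bullet> (B u *v x)"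
    using continuous_attains_inf[of ?S "\<lambda>p. snd p \<bullet> (B (fst p) *v snd p)"] by force
  define e where "e = snd p \<bullet> (B (fst p) *v snd p)"
  have "e > 0"
  proof -
    have "fst p \<in> K" "snd p \<noteq> 0" using p by (cases p, auto)+
    then show ?thesis using pd[of "fst p"] unfolding e_def posdef_def by blast
  qed
  moreover have "coercive e (B u)" if u: "u \<in> K" for u
    unfolding coercive_def
  proof (intro conjI allI)
    show "sym_mat (B u)" using pd[OF u] by (simp add: posdef_def)
    fix x :: "real^3"
    show "e * (x \<bullet> x) \<le> x \<bullet> (B u *v x)"
    proof (cases "x = 0")
      case False
      then have "e \<le> ((1 / norm x) *\<^sub>R x) \<bullet> (B u *v ((1 / norm x) *\<^sub>R x))"
        unfolding e_def by (intro min u) auto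
      also have "\<dots> = (x \<bullet> (B u *v x)) / (x \<bullet> x)"
        by (simp add: matrix_vector_mult_scaleR dot_square_norm power2_eq_square)
      finally show ?thesis using False by (simp add: field_simps)
    qed simp
  qed
  ultimately show ?thesis
    by (intro that[of "min e 1"]) (auto intro: coercive_mono[OF _ min.cobounded1])
qed

lemma posdef_coercive:
  assumes "posdef B"
  obtains e where "0 < e" "e \<le> 1" "coercive e B"
  using coercive_uniform[of "{0::real}" "\<lambda>_. B"] assms by auto

definition resolvent :: "mat3 \<Rightarrow> real \<Rightarrow> mat3" where
  "resolvent B s = matrix_inv (B + s *\<^sub>R mat 1)"

definition weight :: "mat3 \<Rightarrow> real \<Rightarrow> real" where
  "weight B s = 1 / sqrt (det (B + s *\<^sub>R mat 1))"

lemma coercive_shift: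
  assumes "coercive e B"
  shows "coercive (e + s) (B + s *\<^sub>R mat 1)"
proof -
  have "transpose (B + s *\<^sub>R mat 1) = B + s *\<^sub>R mat 1"
    using assms unfolding coercive_def sym_mat_def
    by (simp add: bounded_linear.linear[OF bounded_linear_transpose] linear_add transpose_scalar)
  then show ?thesis
    using assms unfolding coercive_def sym_mat_def
    by (auto simp: matrix_vector_mult_add_rdistrib scaleR_matrix_vector_assoc[symmetric] algebra_simps)
qed

lemma coercive_eigenframe:
  assumes B: "coercive e B"
  obtains q b where "eigenframe B q b" "\<And>i. e \<le> b i"
proof -
  obtain q b where q: "eigenframe B q b"
    using symmetric_eigenframe B unfolding coercive_def sym_mat_def by blast
  have "e * (q i \<bullet> q i) \<le> q i \<bullet> (B *v q i)" for i using B by (simp add: coercive_def)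
  then have "e \<le> b i" for i by (simp add: eigenframe_eigen[OF q] eigenframe_inner[OF q])
  with q that show thesis by blast
qed

lemma coercive_det:
  assumes "coercive e B" "e \<ge> 0"
  shows "e ^ 3 \<le> det B"
proof -
  obtain q b where q: "eigenframe B q b" and b: "\<And>i. e \<le> b i"
    using coercive_eigenframe assms by metis
  have "(\<Prod>i\<in>(UNIV::3 set). e) \<le> (\<Prod>i\<in>UNIV. b i)" by (rule prod_mono) (use b assms in auto)
  then show ?thesis by (simp add: eigenframe_det[OF q])
qed

lemma posdef_det_pos:
  assumes "posdef B"
  shows "0 < det B"
proof -
  obtain e where e: "0 < e" "coercive e B" using posdef_coercive[OF assms] by blast
  then have "e ^ 3 \<le> det B" by (intro coercive_det) auto
  then show ?thesis using zero_less_power[OF e(1), of 3] by linarith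
qed

lemma transpose_matrix_inv:
  fixes A :: "real^'n^'n"
  assumes "transpose A = A" "invertible A"
  shows "transpose (matrix_inv A) = matrix_inv A"
proof -
  have "A ** transpose (matrix_inv A) = transpose (matrix_inv A ** A)"
    by (simp add: matrix_transpose_mul assms)
  also have "\<dots> = mat 1" by (simp add: matrix_inv_works assms)
  finally show ?thesis by (rule matrix_inv_unique[symmetric])
qed

section \<open>Decay of the resolvent and of the weight in the shift parameter\<close>

context
  fixes B :: mat3 and e s :: real
  assumes B: "coercive e B" and e: "0 < e" "e \<le> 1" and s: "0 \<le> s"
begin

text \<open>Here \<open>e \<le> 1\<close> enters: the lower bound \<open>e + s\<close> of the
  shifted spectrum is traded for a multiple of \<open>1 + s\<close>, so that every later estimate
  has a constant depending on \<open>e\<close> times a power of \<open>1 / (1 + s)\<close>.\<close>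

lemma shift_ge: "e * (1 + s) \<le> e + s"
  using e s mult_right_mono[of e 1 s] by (simp add: algebra_simps)

lemma det_shift_ge: "(e + s) ^ 3 \<le> det (B + s *\<^sub>R mat 1)"
  using coercive_det[OF coercive_shift[OF B, of s]] e s by simp

lemma det_shift_pos: "0 < det (B + s *\<^sub>R mat 1)"
  using det_shift_ge e s zero_less_power[of "e + s" 3] by linarith

lemma invertible_shift: "invertible (B + s *\<^sub>R mat 1)"
  using det_shift_pos by (simp add: invertible_det_nz)

lemma weight_pos: "0 < weight B s"
  using det_shift_pos by (simp add: weight_def)

text \<open>The determinant would allow decay with exponent 3/2; exponent 1 avoids fractional powers
  and suffices, because the integrands carry at least one further factor \<open>resolvent\<close>,
  itself of order \<open>1 / (1 + s)\<close>.\<close>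

lemma weight_le: "weight B s \<le> 1 / (e\<^sup>2 * (1 + s))"
proof -
  have "(e\<^sup>2 * (1 + s))\<^sup>2 = e * (1 / (1 + s)) * (e * (1 + s)) ^ 3"
    using s by (simp add: power2_eq_square power3_eq_cube field_simps)
  also have "\<dots> \<le> 1 * (e * (1 + s)) ^ 3"
    using e s mult_mono[of e 1 "1 / (1 + s)" 1] by (intro mult_right_mono) auto
  also have "\<dots> \<le> (e + s) ^ 3" using shift_ge e s by (auto intro!: power_mono)
  also have "\<dots> \<le> det (B + s *\<^sub>R mat 1)" by (rule det_shift_ge)
  finally have "e\<^sup>2 * (1 + s) \<le> sqrt (det (B + s *\<^sub>R mat 1))" by (rule real_le_rsqrt)
  then show ?thesis unfolding weight_def using e s by (intro divide_left_mono) (auto simp: det_shift_pos)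
qed

lemma transpose_resolvent: "transpose (resolvent B s) = resolvent B s"
  unfolding resolvent_def
  using coercive_shift[OF B, of s] invertible_shift
  by (intro transpose_matrix_inv) (auto simp: coercive_def sym_mat_def)

lemma resolvent_right: "(B + s *\<^sub>R mat 1) ** resolvent B s = mat 1"
  unfolding resolvent_def by (rule matrix_inv_works) (rule invertible_shift)

text \<open>The equation for \<open>?y = resolvent B s *v x\<close> is tested with \<open>?y\<close>
  itself: coercivity bounds the form from below, Cauchy-Schwarz from above, and one factor
  \<open>norm ?y\<close> cancels.\<close>

lemma norm_resolvent_le: "norm (resolvent B s *v x) \<le> norm x / (e * (1 + s))"
proof -
  let ?y = "resolvent B s *v x"
  have x: "(B + s *\<^sub>R mat 1) *v ?y = x" by (simp add: matrix_vector_mul_assoc resolvent_right)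
  have "e * (1 + s) * (norm ?y * norm ?y) \<le> (e + s) * (?y \<bullet> ?y)"
    using shift_ge by (auto simp: dot_square_norm power2_eq_square intro!: mult_right_mono)
  also have "\<dots> \<le> ?y \<bullet> ((B + s *\<^sub>R mat 1) *v ?y)"
    using coercive_shift[OF B, of s] by (simp add: coercive_def)
  also have "\<dots> \<le> norm ?y * norm x" unfolding x by (rule norm_cauchy_schwarz)
  finally have "(e * (1 + s) * norm ?y) * norm ?y \<le> norm x * norm ?y" by (simp add: mult_ac)
  then have "e * (1 + s) * norm ?y \<le> norm x"
    by (cases "norm ?y = 0") (auto dest: mult_right_le_imp_le)
  moreover have "0 < e * (1 + s)" using e s by simp
  ultimately show ?thesis by (simp only: pos_le_divide_eq mult.commute)
qed

lemma resolvent_entry: "\<bar>(resolvent B s ** M) $ i $ j\<bar> \<le> norm (M *v axis j 1) / (e * (1 + s))"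
proof -
  have "(resolvent B s ** M) $ i $ j = (resolvent B s *v (M *v axis j 1)) $ i"
    by (subst matrix_vector_mul_assoc) (simp add: matrix_vector_mult_basis column_def)
  also have "\<bar>\<dots>\<bar> \<le> norm (resolvent B s *v (M *v axis j 1))" by (rule component_le_norm_cart)
  also have "\<dots> \<le> norm (M *v axis j 1) / (e * (1 + s))" by (rule norm_resolvent_le)
  finally show ?thesis .
qed

lemma resolvent_entry_le: "\<bar>resolvent B s $ i $ j\<bar> \<le> 1 / (e * (1 + s))"
  using resolvent_entry[of "mat 1" i j] by simp

lemma trace_resolvent_le: "\<bar>trace (resolvent B s ** M)\<bar> \<le> 3 * norm M / (e * (1 + s))"
proof -
  have "\<bar>trace (resolvent B s ** M)\<bar> \<le> (\<Sum>i\<in>(UNIV::3 set). \<bar>(resolvent B s ** M) $ i $ i\<bar>)"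
    unfolding trace_def by (rule sum_abs)
  also have "\<dots> \<le> (\<Sum>i\<in>(UNIV::3 set). norm M / (e * (1 + s)))"
  proof (rule sum_mono)
    fix i :: 3
    have "norm (M *v axis i 1) \<le> norm M" using norm_matrix_vector_mult_le[of M "axis i 1"] by simp
    then show "\<bar>(resolvent B s ** M) $ i $ i\<bar> \<le> norm M / (e * (1 + s))"
      using resolvent_entry[of M i i] e s by (meson divide_right_mono order_trans mult_nonneg_nonneg add_nonneg_nonneg less_imp_le zero_le_one)
  qed
  finally show ?thesis by simp
qed

lemma resolvent_sandwich_le:
  "\<bar>(resolvent B s ** M ** resolvent B s) $ i $ j\<bar> \<le> norm M / (e * (1 + s))\<^sup>2"
proof -
  have "norm ((M ** resolvent B s) *v axis j 1) \<le> norm M * norm (resolvent B s *v axis j 1)"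
    using norm_matrix_vector_mult_le[of M "resolvent B s *v axis j 1"] by (simp add: matrix_vector_mul_assoc)
  also have "\<dots> \<le> norm M * (1 / (e * (1 + s)))"
    using norm_resolvent_le[of "axis j 1"] by (intro mult_left_mono) auto
  finally have "norm ((M ** resolvent B s) *v axis j 1) / (e * (1 + s)) \<le> norm M * (1 / (e * (1 + s))) / (e * (1 + s))"
    using e s by (intro divide_right_mono) auto
  then show ?thesis
    using resolvent_entry[of "M ** resolvent B s" i j] by (simp add: matrix_mul_assoc power2_eq_square)
qed

end

lemma continuous_on_resolvent:
  assumes "coercive e B" "0 < e" "e \<le> 1"
  shows "continuous_on {0..} (resolvent B)"
  unfolding resolvent_def
  by (rule continuous_on_matrix_inv) (use det_shift_pos[OF assms] in \<open>auto intro!: continuous_intros simp: less_le\<close>)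

lemma continuous_on_weight:
  assumes "coercive e B" "0 < e" "e \<le> 1"
  shows "continuous_on {0..} (weight B)"
  unfolding weight_def
  by (intro continuous_intros) (use det_shift_pos[OF assms] in \<open>auto simp: less_le\<close>)

lemma continuous_on_resolvent_param:
  fixes B :: "'a::topological_space \<Rightarrow> mat3"
  assumes B: "continuous_on T B" and co: "\<And>u. u \<in> T \<Longrightarrow> coercive e (B u)" and e: "0 < e" "e \<le> 1" and s: "0 \<le> s"
  shows "continuous_on T (\<lambda>u. resolvent (B u) s)" "continuous_on T (\<lambda>u. weight (B u) s)"
proof -
  have nz: "det (B u + s *\<^sub>R mat 1) > 0" if "u \<in> T" for u by (rule det_shift_pos[OF co[OF that] e s])
  show "continuous_on T (\<lambda>u. resolvent (B u) s)"
    unfolding resolvent_def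
    by (rule continuous_on_matrix_inv) (use nz in \<open>auto intro!: continuous_intros B simp: less_le\<close>)
  show "continuous_on T (\<lambda>u. weight (B u) s)"
    unfolding weight_def
    by (intro continuous_intros B) (use nz in \<open>auto simp: less_le\<close>)
qed

lemma eigenframe_resolvent:
  assumes q: "eigenframe B q b" and b: "\<And>i. 0 < b i" and s: "0 \<le> s"
  shows "resolvent B s *v q i = (1 / (b i + s)) *\<^sub>R q i" "weight B s = 1 / sqrt (\<Prod>i\<in>UNIV. b i + s)"
  unfolding resolvent_def weight_def
  using eigenframe_matrix_inv[OF eigenframe_shift[OF q]] b s eigenframe_det[OF eigenframe_shift[OF q]]
  by (auto simp: add_pos_nonneg less_imp_neq[symmetric])

section \<open>Integral densities and the derivative of the closure map\<close>

text \<open>For symmetric \<open>R\<close> the 24 permutations fall into the three ways of pairing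
  four indices, eight permutations for each; hence the division by 3.\<close>

lemma symmetrize_tprod:
  assumes R: "transpose R = R"
  shows "symmetrize (tprod R R) i j k l = (R $ i $ j * R $ k $ l + R $ i $ k * R $ j $ l + R $ i $ l * R $ j $ k) / 3"
proof -
  have sym: "R $ a $ b = R $ b $ a" for a b
  proof -
    have "transpose R $ a $ b = R $ b $ a" by (simp add: Finite_Cartesian_Product.transpose_def)
    then show ?thesis by (simp add: R)
  qed
  have set4: "{0..<4::nat} = {0, 1, 2, 3}" by auto
  have f1: "finite {1, 2, 3::nat}" "0 \<notin> {1, 2, 3::nat}" by auto
  have f2: "finite {2, 3::nat}" "1 \<notin> {2, 3::nat}" by auto
  have f3: "finite {3::nat}" "2 \<notin> {3::nat}" by auto
  have fact4: "(fact 4 :: real) = 24" by (simp add: fact_numeral)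
  have tr: "Transposition.transpose a b c = (if c = a then b else if c = b then a else c)" for a b c :: nat
    by (simp add: Transposition.transpose_def)
  show ?thesis
    unfolding symmetrize_def tprod_def Let_def set4
      sum_over_permutations_insert[OF f1] sum_over_permutations_insert[OF f2]
      sum_over_permutations_insert[OF f3] permutes_sing fact4
    by (simp add: tr cong: if_cong del: One_nat_def)
      (simp add: sym[of j i] sym[of k i] sym[of l i] sym[of k j] sym[of l j] sym[of l k])
qed

lemma Aop_entry: "Aop B $ i $ j = (1/2) * integral {0..} (\<lambda>s. resolvent B s $ i $ j * weight B s)"
  by (simp add: Aop_def resolvent_def weight_def)

text \<open>The coefficient 1/4 is the 3/4 of \<open>Cop\<close> times the 1/3 of the index
  pairings. Contracted with a symmetric \<open>M\<close>, the pairing that keeps the first two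
  indices together yields the trace term, and each of the other two yields the sandwich of
  \<open>M\<close> between resolvents.\<close>

definition Cdensity :: "mat3 \<Rightarrow> real \<Rightarrow> mat3 \<Rightarrow> mat3" where
  "Cdensity B s M = (weight B s / 4) *\<^sub>R
     (trace (resolvent B s ** M) *\<^sub>R resolvent B s + 2 *\<^sub>R (resolvent B s ** M ** resolvent B s))"

lemma inverse_cube_le:
  assumes "0 \<le> s" "0 \<le> K"
  shows "K / (1 + s) ^ 3 \<le> K / (1 + s :: real)\<^sup>2"
  using assms by (intro divide_left_mono power_increasing) auto

context
  fixes B :: mat3 and e :: real
  assumes B: "coercive e B" and e: "0 < e" "e \<le> 1"
begin

lemma Adensity_le:
  assumes s: "0 \<le> s"
  shows "\<bar>resolvent B s $ i $ j * weight B s\<bar> \<le> (1 / e ^ 3) / (1 + s)\<^sup>2"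
proof -
  have "\<bar>resolvent B s $ i $ j * weight B s\<bar> \<le> (1 / (e * (1 + s))) * (1 / (e\<^sup>2 * (1 + s)))"
    unfolding abs_mult
    using resolvent_entry_le[OF B e s, of i j] weight_le[OF B e s] weight_pos[OF B e s] e s
    by (intro mult_mono) auto
  also have "\<dots> = (1 / e ^ 3) / (1 + s)\<^sup>2" by (simp add: power2_eq_square power3_eq_cube)
  finally show ?thesis .
qed

lemma Adensity_continuous: "continuous_on {0..} (\<lambda>s. resolvent B s $ i $ j * weight B s)"
  by (intro continuous_intros continuous_on_resolvent[OF B e] continuous_on_weight[OF B e])

lemma Adensity_integrable: "(\<lambda>s. resolvent B s $ i $ j * weight B s) integrable_on {0..}"
  by (rule integrable_halfline_dominated[OF Adensity_continuous Adensity_le])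

lemma Adensity_has_integral:
  "((\<lambda>s. (1/2) * (resolvent B s $ i $ j * weight B s)) has_integral Aop B $ i $ j) {0..}"
  unfolding Aop_entry using Adensity_integrable by (intro has_integral_mult_right) (auto simp: has_integral_integral)

lemma two_resolvents_le:
  assumes s: "0 \<le> s"
  shows "\<bar>resolvent B s $ i $ j * resolvent B s $ k $ l * weight B s\<bar> \<le> (1 / e ^ 4) / (1 + s)\<^sup>2"
proof -
  have "\<bar>resolvent B s $ i $ j * resolvent B s $ k $ l * weight B s\<bar>
      \<le> (1 / (e * (1 + s))) * (1 / (e * (1 + s))) * (1 / (e\<^sup>2 * (1 + s)))"
    unfolding abs_mult
    using resolvent_entry_le[OF B e s, of i j] resolvent_entry_le[OF B e s, of k l]
      weight_le[OF B e s] weight_pos[OF B e s] e s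
    by (intro mult_mono) auto
  also have "\<dots> = (1 / e ^ 4) / (1 + s) ^ 3" by (simp add: power2_eq_square power3_eq_cube power4_eq_xxxx)
  also have "\<dots> \<le> (1 / e ^ 4) / (1 + s)\<^sup>2" using e s by (intro inverse_cube_le) auto
  finally show ?thesis .
qed

lemma two_resolvents_continuous:
  "continuous_on {0..} (\<lambda>s. resolvent B s $ i $ j * resolvent B s $ k $ l * weight B s)"
  by (intro continuous_intros continuous_on_resolvent[OF B e] continuous_on_weight[OF B e])

lemma two_resolvents_integrable:
  "(\<lambda>s. resolvent B s $ i $ j * resolvent B s $ k $ l * weight B s) integrable_on {0..}"
  by (rule integrable_halfline_dominated[OF two_resolvents_continuous two_resolvents_le])

lemma Cop_has_integral:
  "((\<lambda>s. (1/4) * (resolvent B s $ i $ j * resolvent B s $ k $ l * weight B s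
      + resolvent B s $ i $ k * resolvent B s $ j $ l * weight B s
      + resolvent B s $ i $ l * resolvent B s $ j $ k * weight B s)) has_integral Cop B i j k l) {0..}"
proof -
  let ?f = "\<lambda>s. resolvent B s $ i $ j * resolvent B s $ k $ l * weight B s
      + resolvent B s $ i $ k * resolvent B s $ j $ l * weight B s
      + resolvent B s $ i $ l * resolvent B s $ j $ k * weight B s"
  have int: "?f integrable_on {0..}"
    by (intro integrable_add two_resolvents_integrable)
  have "integral {0..} (\<lambda>s::real. symmetrize (tprod (matrix_inv (B + s *\<^sub>R mat 1)) (matrix_inv (B + s *\<^sub>R mat 1))) i j k l
                 / sqrt (det (B + s *\<^sub>R mat 1))) = integral {0..} (\<lambda>s. (1/3) * ?f s)"
  proof (rule integral_cong)
    fix s :: real assume "s \<in> {0..}"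
    then have "transpose (resolvent B s) = resolvent B s" using transpose_resolvent[OF B e] by simp
    from symmetrize_tprod[OF this, of i j k l]
    show "symmetrize (tprod (matrix_inv (B + s *\<^sub>R mat 1)) (matrix_inv (B + s *\<^sub>R mat 1))) i j k l
                 / sqrt (det (B + s *\<^sub>R mat 1)) = (1/3) * ?f s"
      by (simp add: resolvent_def[symmetric] weight_def add_divide_distrib)
  qed
  then have "Cop B i j k l = (1/4) * integral {0..} ?f" by (simp add: Cop_def)
  then show ?thesis
    using int by (simp only:) (intro has_integral_mult_right, simp add: has_integral_integral)
qed

lemma Cop_symmetric: "Cop B i j k l = Cop B j i k l"
proof -
  have sym: "resolvent B s $ a $ b = resolvent B s $ b $ a" if "s \<in> {0..}" for s a b
    using transpose_resolvent[OF B e, of s] that by (simp add: transpose_def vec_eq_iff)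
  show ?thesis
    by (rule has_integral_unique[OF has_integral_eq[OF _ Cop_has_integral] Cop_has_integral])
      (simp add: sym[of _ i j] algebra_simps)
qed

lemma Cdensity_has_integral:
  assumes M: "sym_mat M"
  shows "((\<lambda>s. Cdensity B s M $ i $ j) has_integral (Cop B \<ddagger> M) $ i $ j) {0..}"
proof -
  let ?g = "\<lambda>k l s. (1/4) * (resolvent B s $ i $ j * resolvent B s $ k $ l * weight B s
      + resolvent B s $ i $ k * resolvent B s $ j $ l * weight B s
      + resolvent B s $ i $ l * resolvent B s $ j $ k * weight B s)"
  have "((\<lambda>s. \<Sum>k\<in>UNIV. \<Sum>l\<in>UNIV. ?g k l s * M $ k $ l) has_integral (\<Sum>k\<in>UNIV. \<Sum>l\<in>UNIV. Cop B i j k l * M $ k $ l)) {0..}"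
    by (intro has_integral_sum has_integral_mult_left Cop_has_integral) auto
  then have int: "((\<lambda>s. \<Sum>k\<in>UNIV. \<Sum>l\<in>UNIV. ?g k l s * M $ k $ l) has_integral (Cop B \<ddagger> M) $ i $ j) {0..}"
    by (simp add: ddot_def)
  have eq: "(\<Sum>k\<in>UNIV. \<Sum>l\<in>UNIV. ?g k l s * M $ k $ l) = Cdensity B s M $ i $ j" if "s \<in> {0..}" for s
  proof -
    have R: "resolvent B s $ a $ b = resolvent B s $ b $ a" for a b
      using transpose_resolvent[OF B e, of s] that by (simp add: transpose_def vec_eq_iff)
    have M': "M $ a $ b = M $ b $ a" for a b
      using M unfolding sym_mat_def transpose_def vec_eq_iff by simp
    show ?thesis
      unfolding Cdensity_def trace_def
      by (simp add: matrix_matrix_mult_def sum_3 R[of 1 j] R[of 2 j] R[of 3 j] R[of 2 1] R[of 3 1] R[of 3 2]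
          M'[of 2 1] M'[of 3 1] M'[of 3 2]) (simp add: algebra_simps)
  qed
  show ?thesis by (rule has_integral_eq[OF eq int])
qed

lemma Cdensity_le:
  assumes s: "0 \<le> s"
  shows "\<bar>Cdensity B s M $ i $ j\<bar> \<le> (2 * norm M / e ^ 4) / (1 + s)\<^sup>2"
proof -
  let ?w = "1 / (e * (1 + s))"
  have w: "0 \<le> ?w" using e s by simp
  have "\<bar>trace (resolvent B s ** M) * resolvent B s $ i $ j + 2 * (resolvent B s ** M ** resolvent B s) $ i $ j\<bar>
     \<le> \<bar>trace (resolvent B s ** M)\<bar> * \<bar>resolvent B s $ i $ j\<bar> + 2 * \<bar>(resolvent B s ** M ** resolvent B s) $ i $ j\<bar>"
    by (simp add: abs_mult[symmetric])
  also have "\<dots> \<le> (3 * norm M * ?w) * ?w + 2 * (norm M * ?w\<^sup>2)"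
    using trace_resolvent_le[OF B e s, of M] resolvent_entry_le[OF B e s, of i j]
      resolvent_sandwich_le[OF B e s, of M i j] w
    by (intro add_mono mult_mono mult_left_mono) (auto simp: power_one_over)
  also have "\<dots> = 5 * norm M * ?w\<^sup>2" by (simp add: power2_eq_square)
  finally have 1: "\<bar>trace (resolvent B s ** M) * resolvent B s $ i $ j + 2 * (resolvent B s ** M ** resolvent B s) $ i $ j\<bar>
    \<le> 5 * norm M * ?w\<^sup>2" .
  have "\<bar>Cdensity B s M $ i $ j\<bar> \<le> (1 / (e\<^sup>2 * (1 + s))) / 4 * (5 * norm M * ?w\<^sup>2)"
    unfolding Cdensity_def vector_scaleR_component vector_add_component real_scaleR_def abs_mult
    using 1 weight_le[OF B e s] weight_pos[OF B e s] e s by (intro mult_mono) auto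
  also have "\<dots> = (5 / 4 * norm M / e ^ 4) / (1 + s) ^ 3"
    by (simp add: power2_eq_square power3_eq_cube power4_eq_xxxx)
  also have "\<dots> \<le> (2 * norm M / e ^ 4) / (1 + s) ^ 3"
    using e s by (intro divide_right_mono) auto
  also have "\<dots> \<le> (2 * norm M / e ^ 4) / (1 + s)\<^sup>2" using e s by (intro inverse_cube_le) auto
  finally show ?thesis .
qed

end

section \<open>Differentiation of the closure map along a curve of matrices\<close>

lemma has_vector_derivative_matrixI:
  fixes X :: "real \<Rightarrow> real^'n^'m"
  assumes "\<And>i j. ((\<lambda>u. X u $ i $ j) has_real_derivative X' $ i $ j) (at u within T)"
  shows "(X has_vector_derivative X') (at u within T)"
  unfolding has_vector_derivative_iff_quotient
proof (intro vec_tendstoI)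
  fix i j
  show "((\<lambda>v. ((1 / (v - u)) *\<^sub>R (X v - X u)) $ i $ j) \<longlongrightarrow> X' $ i $ j) (at u within T)"
    using assms[of i j] unfolding has_field_derivative_iff by simp
qed

text \<open>The inner derivative is written \<open>f x * c\<close> to match Jacobi's formula, so
  that the logarithmic derivative \<open>c\<close> reappears unchanged in the result.\<close>

lemma has_real_derivative_inverse_sqrt:
  assumes f: "(f has_real_derivative f x * c) (at x within S)" and pos: "f x > 0"
  shows "((\<lambda>x. 1 / sqrt (f x)) has_real_derivative - (1/2) * (1 / sqrt (f x)) * c) (at x within S)"
proof -
  have "(sqrt has_real_derivative inverse (sqrt (f x)) / 2) (at (f x))"
    by (rule DERIV_real_sqrt[OF pos])
  from DERIV_inverse_fun[OF this]
  have "((\<lambda>y. inverse (sqrt y)) has_real_derivative - (inverse (sqrt (f x) ^ Suc (Suc 0)) * (inverse (sqrt (f x)) / 2))) (at (f x))"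
    using pos by (simp add: mult_ac)
  from DERIV_chain2[OF this f] pos show ?thesis
    by (simp add: inverse_eq_divide mult.commute)
qed

text \<open>Differentiation under the integral. With \<open>R\<close> and \<open>W\<close> for
  \<open>resolvent\<close> and \<open>weight\<close>, the product rule gives
  \<open>- R B' R W - (1/2) tr(R B') R W\<close>, which is -2 times \<open>Cdensity\<close>, and the
  factor 1/2 of \<open>Aop\<close> leaves minus \<open>Cop\<close>. The constants \<open>e\<close>
  and \<open>m\<close> make the majorant independent of time.\<close>

theorem has_vector_derivative_Aop:
  fixes B :: "real \<Rightarrow> mat3"
  assumes T: "convex T" "t \<in> T" and e: "0 < e" "e \<le> 1"
    and co: "\<And>u. u \<in> T \<Longrightarrow> coercive e (B u)"
    and B: "\<And>u. u \<in> T \<Longrightarrow> (B has_vector_derivative B' u) (at u within T)"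
    and B': "\<And>u. u \<in> T \<Longrightarrow> norm (B' u) \<le> m" and sym: "sym_mat (B' t)"
  shows "((\<lambda>u. Aop (B u)) has_vector_derivative - (Cop (B t) \<ddagger> B' t)) (at t within T)"
proof (rule has_vector_derivative_matrixI)
  fix i j
  let ?f = "\<lambda>u s. resolvent (B u) s $ i $ j * weight (B u) s"
  let ?f' = "\<lambda>u s. - 2 * Cdensity (B u) s (B' u) $ i $ j"
  have "((\<lambda>u. integral {0..} (?f u)) has_real_derivative integral {0..} (?f' t)) (at t within T)"
  proof (rule has_real_derivative_integral_dominated[OF T])
    fix u assume u: "u \<in> T"
    show "?f u integrable_on {0..}" by (rule Adensity_integrable[OF co[OF u] e])
    fix s :: real assume "s \<in> {0..}"
    then have s: "0 \<le> s" by simp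
    have det: "det (B v + s *\<^sub>R mat 1) > 0" if "v \<in> T" for v by (rule det_shift_pos[OF co[OF that] e s])
    have X: "((\<lambda>v. B v + s *\<^sub>R mat 1) has_vector_derivative B' u) (at u within T)"
      using has_vector_derivative_add[OF B[OF u] has_vector_derivative_const] by simp
    have dR: "((\<lambda>v. resolvent (B v) s $ i $ j) has_real_derivative
        (- (resolvent (B u) s ** B' u ** resolvent (B u) s)) $ i $ j) (at u within T)"
      unfolding resolvent_def
      by (intro has_vector_derivative_matrix_component has_vector_derivative_matrix_inv X u)
        (use det in \<open>auto simp: less_le\<close>)
    have dD: "((\<lambda>v. det (B v + s *\<^sub>R mat 1)) has_real_derivative
        det (B u + s *\<^sub>R mat 1) * trace (resolvent (B u) s ** B' u)) (at u within T)"
      unfolding resolvent_def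
      by (intro has_real_derivative_det3 X) (use det[OF u] in auto)
    have dW: "((\<lambda>v. weight (B v) s) has_real_derivative
       - (1/2) * weight (B u) s * trace (resolvent (B u) s ** B' u)) (at u within T)"
      unfolding weight_def by (rule has_real_derivative_inverse_sqrt[OF dD det[OF u]])
    show "((\<lambda>u. ?f u s) has_real_derivative ?f' u s) (at u within T)"
      by (rule derivative_eq_intros dR dW refl)+ (simp add: Cdensity_def algebra_simps)
    have "\<bar>?f' u s\<bar> = 2 * \<bar>Cdensity (B u) s (B' u) $ i $ j\<bar>" by simp
    also have "\<dots> \<le> 2 * ((2 * norm (B' u) / e ^ 4) / (1 + s)\<^sup>2)"
      by (intro mult_left_mono Cdensity_le[OF co[OF u] e s]) auto
    also have "\<dots> \<le> 2 * ((2 * m / e ^ 4) / (1 + s)\<^sup>2)"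
      using B'[OF u] e s by (intro mult_left_mono divide_right_mono) auto
    finally show "\<bar>?f' u s\<bar> \<le> (4 * m / e ^ 4) / (1 + s)\<^sup>2" by simp
  qed (rule integrable_inverse_square)
  from DERIV_cmult[OF this, of "1/2"]
  have "((\<lambda>u. Aop (B u) $ i $ j) has_real_derivative (1/2) * integral {0..} (?f' t)) (at t within T)"
    by (simp add: Aop_entry)
  moreover have "(1/2) * integral {0..} (?f' t) = (- (Cop (B t) \<ddagger> B' t)) $ i $ j"
    using integral_unique[OF has_integral_mult_right[OF Cdensity_has_integral[OF co[OF T(2)] e sym], of "-2"]] by simp
  ultimately show "((\<lambda>u. Aop (B u) $ i $ j) has_real_derivative (- (Cop (B t) \<ddagger> B' t)) $ i $ j) (at t within T)"
    by simp
qed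

section \<open>Trace identities and eigenvalue estimates\<close>

lemma prod_3: "prod f (UNIV::3 set) = f 1 * f 2 * f 3"
  unfolding UNIV_3 by (simp add: ac_simps)

lemma has_integral_matrix_form:
  fixes F :: "'a::euclidean_space \<Rightarrow> real^'n^'m"
  assumes "\<And>i j. ((\<lambda>s. F s $ i $ j) has_integral L $ i $ j) S"
  shows "((\<lambda>s. x \<bullet> (F s *v y)) has_integral x \<bullet> (L *v y)) S"
  unfolding inner_vec_def matrix_vector_mult_def vec_lambda_beta inner_real_def
  by (intro has_integral_sum has_integral_mult_right has_integral_mult_left assms) auto

lemma has_integral_matrix_inner:
  fixes F :: "'a::euclidean_space \<Rightarrow> real^'n^'m"
  assumes "\<And>i j. ((\<lambda>s. F s $ i $ j) has_integral L $ i $ j) S"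
  shows "((\<lambda>s. M \<bullet> F s) has_integral M \<bullet> L) S"
  unfolding inner_vec_def inner_real_def
  by (intro has_integral_sum has_integral_mult_right assms) auto

lemma has_integral_trace:
  fixes F :: "'a::euclidean_space \<Rightarrow> real^'n^'n"
  assumes "\<And>i j. ((\<lambda>s. F s $ i $ j) has_integral L $ i $ j) S"
  shows "((\<lambda>s. trace (F s)) has_integral trace L) S"
  unfolding trace_def by (intro has_integral_sum assms) auto

context
  fixes B :: mat3 and e :: real
  assumes B: "coercive e B" and e: "0 < e" "e \<le> 1"
begin

lemma Aop_has_integral:
  "((\<lambda>s. ((weight B s / 2) *\<^sub>R resolvent B s) $ i $ j) has_integral Aop B $ i $ j) {0..}"
  using Adensity_has_integral[OF B e, of i j] by (simp add: mult_ac)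

lemma sym_mat_Aop: "sym_mat (Aop B)"
proof -
  have "resolvent B s $ a $ b = resolvent B s $ b $ a" if "s \<in> {0..}" for s a b
    using transpose_resolvent[OF B e, of s] that by (simp add: transpose_def vec_eq_iff)
  then have "Aop B $ i $ j = Aop B $ j $ i" for i j
    unfolding Aop_entry by (intro arg_cong2[where f = "(*)"] refl integral_cong) (metis)
  then show ?thesis by (simp add: sym_mat_def transpose_def vec_eq_iff)
qed

lemma resolvent_form_pos:
  assumes s: "0 \<le> s" and x: "x \<noteq> 0"
  shows "0 < x \<bullet> (resolvent B s *v x)"
proof -
  let ?y = "resolvent B s *v x"
  have y: "(B + s *\<^sub>R mat 1) *v ?y = x" by (simp add: matrix_vector_mul_assoc resolvent_right[OF B e s])
  then have "?y \<noteq> 0" using x by auto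
  moreover have "posdef (B + s *\<^sub>R mat 1)"
    using coercive_posdef[OF coercive_shift[OF B, of s]] e s by simp
  ultimately have "0 < ?y \<bullet> ((B + s *\<^sub>R mat 1) *v ?y)" by (simp add: posdef_def)
  then show ?thesis unfolding y by (simp add: inner_commute)
qed

lemma posdef_Aop: "posdef (Aop B)"
  unfolding posdef_def
proof (intro conjI allI impI sym_mat_Aop)
  fix x :: "real^3" assume x: "x \<noteq> 0"
  have "((\<lambda>s. x \<bullet> (((weight B s / 2) *\<^sub>R resolvent B s) *v x)) has_integral x \<bullet> (Aop B *v x)) {0..}"
    by (rule has_integral_matrix_form[OF Aop_has_integral])
  moreover have "continuous_on {0..} (\<lambda>s. x \<bullet> (((weight B s / 2) *\<^sub>R resolvent B s) *v x))"
    by (intro continuous_intros continuous_on_resolvent[OF B e] continuous_on_weight[OF B e]) auto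
  moreover have "0 < x \<bullet> (((weight B s / 2) *\<^sub>R resolvent B s) *v x)" if "0 \<le> s" for s
    using weight_pos[OF B e that] resolvent_form_pos[OF that x]
    by (simp add: scaleR_matrix_vector_assoc[symmetric])
  ultimately show "0 < x \<bullet> (Aop B *v x)"
    using integral_halfline_pos[of "\<lambda>s. x \<bullet> (((weight B s / 2) *\<^sub>R resolvent B s) *v x)"]
    by (auto simp: has_integral_iff)
qed

text \<open>The trace of the integrand is a total derivative: by Jacobi's formula,
  \<open>- weight B s\<close> has derivative one half of the weight times the trace of the
  resolvent. The integral telescopes to \<open>weight B 0\<close>, since the weight tends to 0 at
  infinity.\<close>

lemma trace_Aop: "trace (Aop B) = 1 / sqrt (det B)"
proof -
  let ?f = "\<lambda>s. trace ((weight B s / 2) *\<^sub>R resolvent B s)"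
  have 1: "(?f has_integral trace (Aop B)) {0..}"
    by (rule has_integral_trace[OF Aop_has_integral])
  have cont: "continuous_on {0..} ?f"
    by (intro continuous_intros continuous_on_resolvent[OF B e] continuous_on_weight[OF B e]) auto
  have deriv: "((\<lambda>s. - weight B s) has_real_derivative ?f s) (at s within {0..})" if s: "0 \<le> s" for s
  proof -
    have "((\<lambda>s. B + s *\<^sub>R mat 1) has_vector_derivative mat 1) (at s within {0..})"
      by (auto intro!: derivative_eq_intros)
    from has_real_derivative_det3[OF this] det_shift_pos[OF B e s]
    have "((\<lambda>s. det (B + s *\<^sub>R mat 1)) has_real_derivative
        det (B + s *\<^sub>R mat 1) * trace (resolvent B s)) (at s within {0..})"
      by (simp add: resolvent_def)
    from has_real_derivative_inverse_sqrt[OF this det_shift_pos[OF B e s]]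
    have "(weight B has_real_derivative - (1 / 2) * weight B s * trace (resolvent B s)) (at s within {0..})"
      by (simp add: weight_def[abs_def])
    from DERIV_minus[OF this] show ?thesis by (simp add: trace_scaleR)
  qed
  have int: "(?f has_integral (weight B 0 - weight B y)) {0..y}" if "0 \<le> y" for y
  proof -
    have "(?f has_integral (- weight B y - - weight B 0)) {0..y}"
      using that
      by (intro fundamental_theorem_of_calculus)
        (auto simp flip: has_real_derivative_iff_has_vector_derivative intro!: has_field_derivative_subset[OF deriv])
    then show ?thesis by simp
  qed
  have "(?f has_integral weight B 0) {0..}"
  proof (rule has_integral_to_inf)
    show "?f integrable_on {0..y}" for y
      by (rule integrable_continuous_interval) (rule continuous_on_subset[OF cont], auto)
    have "((\<lambda>y::real. (1 / e\<^sup>2) * (1 / (1 + y))) \<longlongrightarrow> (1 / e\<^sup>2) * 0) at_top"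
      by (intro tendsto_intros tendsto_divide_0[OF tendsto_const] filterlim_at_top_imp_at_infinity
          filterlim_tendsto_add_at_top[OF tendsto_const] filterlim_ident)
    then have lim: "((\<lambda>y::real. (1 / e\<^sup>2) * (1 / (1 + y))) \<longlongrightarrow> 0) at_top" by simp
    have "(weight B \<longlongrightarrow> 0) at_top"
      by (rule Lim_null_comparison[OF _ lim])
        (use weight_le[OF B e] weight_pos[OF B e] in \<open>auto intro!: eventually_mono[OF eventually_ge_at_top[of 0]] simp: less_imp_le\<close>)
    then have "((\<lambda>y. weight B 0 - weight B y) \<longlongrightarrow> weight B 0 - 0) at_top" by (intro tendsto_intros)
    then have "((\<lambda>y. weight B 0 - weight B y) \<longlongrightarrow> weight B 0) at_top" by simp
    then show "((\<lambda>y. integral {0..y} ?f) \<longlongrightarrow> weight B 0) at_top"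
      by (rule Lim_transform_eventually)
        (auto intro!: eventually_mono[OF eventually_ge_at_top[of 0]] integral_unique[OF int, symmetric])
    fix y :: real assume y: "0 \<le> y"
    have "0 \<le> resolvent B y $ i $ i" for i
      using resolvent_form_pos[OF y, of "axis i 1"]
      by (simp add: matrix_vector_mult_basis column_def inner_axis' axis_eq_0_iff)
    then show "0 \<le> ?f y" using weight_pos[OF B e y]
      by (simp add: trace_scaleR) (simp add: trace_def sum_nonneg)
  qed
  from has_integral_unique[OF 1 this] show ?thesis by (simp add: weight_def)
qed

section \<open>Eigenvalue estimates for A and C in an eigenframe of B\<close>

context
  fixes q :: "3 \<Rightarrow> real^3" and b :: "3 \<Rightarrow> real"
  assumes q: "eigenframe B q b"
begin

lemma eigenframe_ge: "e \<le> b i"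
proof -
  have "e * (q i \<bullet> q i) \<le> q i \<bullet> (B *v q i)" using B by (simp add: coercive_def)
  then show ?thesis by (simp add: eigenframe_eigen[OF q] eigenframe_inner[OF q])
qed

lemma eigenframe_pos: "0 < b i"
  using eigenframe_ge[of i] e by linarith

lemma eigenvalue_Aop_has_integral:
  "((\<lambda>s. weight B s / (2 * (b i + s))) has_integral q i \<bullet> (Aop B *v q i)) {0..}"
  by (rule has_integral_eq[OF _ has_integral_matrix_form[OF Aop_has_integral]])
    (simp add: eigenframe_resolvent(1)[OF q eigenframe_pos] scaleR_matrix_vector_assoc[symmetric] eigenframe_inner[OF q])

text \<open>Every resolvent acts on \<open>q i\<close> as a scalar, hence so does the integral. The
  vector identity is obtained by testing with all \<open>x\<close>, which reduces it to real-valued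
  integrals.\<close>

lemma eigenframe_Aop: "eigenframe (Aop B) q (\<lambda>i. q i \<bullet> (Aop B *v q i))"
  unfolding eigenframe_def
proof (intro conjI allI eigenframe_inner[OF q])
  fix i
  have "x \<bullet> (Aop B *v q i) = x \<bullet> ((q i \<bullet> (Aop B *v q i)) *\<^sub>R q i)" for x
  proof (rule has_integral_unique[OF has_integral_matrix_form[OF Aop_has_integral]])
    have "((\<lambda>s. (x \<bullet> q i) * (weight B s / (2 * (b i + s)))) has_integral (x \<bullet> q i) * (q i \<bullet> (Aop B *v q i))) {0..}"
      by (intro has_integral_mult_right eigenvalue_Aop_has_integral)
    then have *: "((\<lambda>s. (x \<bullet> q i) * (weight B s / (2 * (b i + s)))) has_integral x \<bullet> ((q i \<bullet> (Aop B *v q i)) *\<^sub>R q i)) {0..}"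
      by (simp add: mult.commute)
    show "((\<lambda>s. x \<bullet> ((weight B s / 2) *\<^sub>R resolvent B s *v q i)) has_integral
        x \<bullet> ((q i \<bullet> (Aop B *v q i)) *\<^sub>R q i)) {0..}"
      by (rule has_integral_eq[OF _ *])
        (simp add: eigenframe_resolvent(1)[OF q eigenframe_pos] scaleR_matrix_vector_assoc[symmetric])
  qed
  then show "Aop B *v q i = (q i \<bullet> (Aop B *v q i)) *\<^sub>R q i" by (metis inner_commute vector_eq_rdot)
qed

text \<open>Only the diagonal entries \<open>y j\<close> of \<open>Y\<close> in the frame enter: the
  diagonal of the drift is \<open>2 * b j * y j\<close>, and one resolvent turns \<open>b j\<close>
  into \<open>b j / (b j + s)\<close>, which is at most 1. The trace term is therefore at most
  \<open>6 * norm Y\<close> and the sandwich term adds \<open>4 * norm Y\<close>; 10/4 is 5 times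
  the 1/2 in the integrand of \<open>Aop\<close>. The bound is pointwise in \<open>s\<close> and
  independent of the size of \<open>B\<close>.\<close>

lemma eigenvalue_Cop_le:
  "\<bar>q i \<bullet> ((Cop B \<ddagger> (B ** Y + transpose Y ** B)) *v q i)\<bar> \<le> 5 * norm Y * (q i \<bullet> (Aop B *v q i))"
proof -
  let ?M = "B ** Y + transpose Y ** B"
  have symB: "transpose B = B" using B by (simp add: coercive_def sym_mat_def)
  have M: "sym_mat ?M"
    using symB by (simp add: sym_mat_def matrix_transpose_mul bounded_linear.linear[OF bounded_linear_transpose] linear_add)
  define y where "y = (\<lambda>j. q j \<bullet> (Y *v q j))"
  have y: "\<bar>y j\<bar> \<le> norm Y" for j
  proof -
    have "\<bar>y j\<bar> \<le> norm (q j) * norm (Y *v q j)" unfolding y_def by (rule Cauchy_Schwarz_ineq2)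
    also have "\<dots> \<le> norm Y" using norm_matrix_vector_mult_le[of Y "q j"] by (simp add: eigenframe_norm[OF q])
    finally show ?thesis .
  qed
  have qM: "q j \<bullet> (?M *v q j) = 2 * b j * y j" for j
  proof -
    have "q j \<bullet> ((B ** Y) *v q j) = b j * y j"
      by (simp add: y_def matrix_vector_mul_assoc[symmetric] symmetric_matrix_inner[OF symB] eigenframe_eigen[OF q])
    moreover have "q j \<bullet> ((transpose Y ** B) *v q j) = b j * y j"
    proof -
      have "q j \<bullet> ((transpose Y ** B) *v q j) = b j * (q j \<bullet> (transpose Y *v q j))"
        by (simp add: matrix_vector_mul_assoc[symmetric] eigenframe_eigen[OF q] matrix_vector_mult_scaleR del: transpose_matrix_vector)
      also have "q j \<bullet> (transpose Y *v q j) = y j"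
        by (simp add: y_def inner_commute[of "q j"] dot_lmul_matrix)
      finally show ?thesis .
    qed
    ultimately show ?thesis by (simp add: matrix_vector_mult_add_rdistrib inner_add_right)
  qed
  have density: "\<bar>q i \<bullet> (Cdensity B s ?M *v q i)\<bar> \<le> 5 * norm Y * (weight B s / (2 * (b i + s)))" if s: "0 \<le> s" for s
  proof -
    have symR: "transpose (resolvent B s) = resolvent B s" by (rule transpose_resolvent[OF B e s])
    have bs: "0 < b j + s" for j using eigenframe_pos[of j] s by simp
    note Rq = eigenframe_resolvent(1)[OF q eigenframe_pos s]
    have ratio: "\<bar>b j / (b j + s) * y j\<bar> \<le> norm Y" for j
    proof -
      have "b j / (b j + s) * \<bar>y j\<bar> \<le> 1 * norm Y"
        using y[of j] bs[of j] eigenframe_pos[of j] s by (intro mult_mono) auto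
      then show ?thesis using bs[of j] eigenframe_pos[of j] by (simp add: abs_mult)
    qed
    have "trace (resolvent B s ** ?M) = (\<Sum>j\<in>UNIV. q j \<bullet> ((resolvent B s ** ?M) *v q j))"
      by (rule eigenframe_trace[OF q])
    also have "\<dots> = (\<Sum>j\<in>UNIV. 2 * (b j / (b j + s) * y j))"
      by (intro sum.cong refl)
        (simp add: matrix_vector_mul_assoc[symmetric] symmetric_matrix_inner[OF symR] Rq qM)
    finally have "\<bar>trace (resolvent B s ** ?M)\<bar> \<le> (\<Sum>j\<in>(UNIV::3 set). \<bar>2 * (b j / (b j + s) * y j)\<bar>)"
      by (simp only: sum_abs)
    also have "\<dots> \<le> (\<Sum>j\<in>(UNIV::3 set). 2 * norm Y)"
    proof (rule sum_mono)
      fix j show "\<bar>2 * (b j / (b j + s) * y j)\<bar> \<le> 2 * norm Y" using ratio[of j] by linarith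
    qed
    finally have tr: "\<bar>trace (resolvent B s ** ?M)\<bar> \<le> 6 * norm Y" by simp
    have RMR: "q i \<bullet> ((resolvent B s ** ?M ** resolvent B s) *v q i) = 2 * (b i / (b i + s) * y i) / (b i + s)"
      by (simp add: matrix_vector_mul_assoc[symmetric] symmetric_matrix_inner[OF symR] Rq matrix_vector_mult_scaleR qM)
    have "q i \<bullet> (Cdensity B s ?M *v q i) =
      weight B s / 4 * ((trace (resolvent B s ** ?M) + 4 * (b i / (b i + s) * y i)) / (b i + s))"
      unfolding Cdensity_def
      by (simp add: scaleR_matrix_vector_assoc[symmetric] matrix_vector_mult_add_rdistrib inner_add_right RMR Rq
          eigenframe_inner[OF q] add_divide_distrib)
    also have "\<bar>\<dots>\<bar> \<le> weight B s / 4 * ((6 * norm Y + 4 * norm Y) / (b i + s))"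
    proof -
      have "\<bar>trace (resolvent B s ** ?M) + 4 * (b i / (b i + s) * y i)\<bar> \<le> 6 * norm Y + 4 * norm Y"
        using tr ratio[of i] by linarith
      then show ?thesis
        unfolding abs_mult abs_divide using weight_pos[OF B e s] bs[of i]
        by (intro mult_mono divide_mono) auto
    qed
    finally show ?thesis by (simp add: field_simps)
  qed
  have 1: "((\<lambda>s. q i \<bullet> (Cdensity B s ?M *v q i)) has_integral q i \<bullet> ((Cop B \<ddagger> ?M) *v q i)) {0..}"
    by (rule has_integral_matrix_form[OF Cdensity_has_integral[OF B e M]])
  have 2: "((\<lambda>s. 5 * norm Y * (weight B s / (2 * (b i + s)))) has_integral 5 * norm Y * (q i \<bullet> (Aop B *v q i))) {0..}"
    by (intro has_integral_mult_right eigenvalue_Aop_has_integral)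
  have "q i \<bullet> ((Cop B \<ddagger> ?M) *v q i) \<le> 5 * norm Y * (q i \<bullet> (Aop B *v q i))"
    by (rule has_integral_le[OF 1 2]) (use density in \<open>force simp: abs_le_iff\<close>)
  moreover have "- (5 * norm Y * (q i \<bullet> (Aop B *v q i))) \<le> q i \<bullet> ((Cop B \<ddagger> ?M) *v q i)"
    by (rule has_integral_le[OF has_integral_neg[OF 2] 1]) (use density in \<open>force simp: abs_le_iff\<close>)
  ultimately show ?thesis by linarith
qed

text \<open>The integrand is compared with \<open>1 / (sqrt (b i) * (1 + s)\<^sup>2)\<close>.
  Determinant 1 makes the product of the \<open>b j + s\<close> at least \<open>1 + s ^ 3\<close>,
  hence at least a quarter of \<open>(1 + s) ^ 3\<close>, while \<open>b i \<ge> 1\<close> gives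
  \<open>(b i + s)\<^sup>2 \<ge> b i * (1 + s)\<close>. In the root of the product of these two
  bounds the quarter is offset by the 2 in the integrand.\<close>

lemma eigenvalue_Aop_le:
  assumes det: "det B = 1" and bi: "1 \<le> b i"
  shows "q i \<bullet> (Aop B *v q i) \<le> 1 / sqrt (b i)"
proof -
  have "weight B s / (2 * (b i + s)) \<le> (1 / sqrt (b i)) * (1 / (1 + s)\<^sup>2)" if s: "0 \<le> s" for s
  proof -
    let ?P = "\<Prod>i\<in>UNIV. b i + s"
    have b0: "0 \<le> b j" for j using eigenframe_pos[of j] by simp
    have "b 1 * b 2 * b 3 = 1" using det by (simp add: eigenframe_det[OF q] prod_3)
    moreover have "?P = (b 1 + s) * (b 2 + s) * (b 3 + s)" by (rule prod_3)
    moreover have "\<dots> = b 1 * b 2 * b 3 + s ^ 3 + s * (b 1 * b 2 + b 1 * b 3 + b 2 * b 3) + s\<^sup>2 * (b 1 + b 2 + b 3)"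
      by (simp add: algebra_simps power2_eq_square power3_eq_cube)
    moreover have "0 \<le> s * (b 1 * b 2 + b 1 * b 3 + b 2 * b 3)" "0 \<le> s\<^sup>2 * (b 1 + b 2 + b 3)"
      using b0 s by (auto intro!: mult_nonneg_nonneg add_nonneg_nonneg)
    ultimately have P: "1 + s ^ 3 \<le> ?P" by linarith
    have "4 * (1 + s ^ 3) - (1 + s) ^ 3 = 3 * ((1 - s)\<^sup>2 * (1 + s))"
      by (simp add: algebra_simps power2_eq_square power3_eq_cube)
    also have "\<dots> \<ge> 0" using s by simp
    finally have "(1 + s) ^ 3 \<le> 4 * (1 + s ^ 3)" by (simp only: diff_ge_0_iff_ge)
    also have "\<dots> \<le> 4 * ?P" using P by (rule mult_left_mono) simp
    finally have P2: "(1 + s) ^ 3 \<le> 4 * ?P" .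
    have bs: "b i * (1 + s) \<le> (b i + s)\<^sup>2"
    proof -
      have 1: "b i * 1 \<le> b i * b i" "0 \<le> b i * s" "0 \<le> s\<^sup>2"
        using bi s by (auto intro: mult_left_mono)
      have "b i * (1 + s) = b i * 1 + b i * s" by (simp add: algebra_simps)
      also have "\<dots> \<le> b i * b i + 2 * (b i * s) + s\<^sup>2" using 1 by linarith
      also have "\<dots> = (b i + s)\<^sup>2" by (simp add: power2_eq_square algebra_simps)
      finally show ?thesis .
    qed
    have "b i * (1 + s) ^ 4 = (b i * (1 + s)) * (1 + s) ^ 3" by (simp add: power_numeral_reduce mult_ac)
    also have "\<dots> \<le> (b i + s)\<^sup>2 * (4 * ?P)"
      using bs P2 bi s by (intro mult_mono) auto
    finally have "sqrt (b i * (1 + s) ^ 4) \<le> sqrt ((b i + s)\<^sup>2 * (4 * ?P))" by (rule real_sqrt_le_mono)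
    moreover have "sqrt (b i * (1 + s) ^ 4) = sqrt (b i) * (1 + s)\<^sup>2"
    proof -
      have "(1 + s) ^ 4 = ((1 + s)\<^sup>2)\<^sup>2" by simp
      then show ?thesis by (simp only: real_sqrt_mult real_sqrt_abs) simp
    qed
    moreover have "sqrt ((b i + s)\<^sup>2 * (4 * ?P)) = (2 * (b i + s)) * sqrt ?P"
      using s bi by (simp add: real_sqrt_mult)
    ultimately have "sqrt (b i) * (1 + s)\<^sup>2 \<le> 2 * (b i + s) * sqrt ?P" by simp
    then have "1 / (2 * (b i + s) * sqrt ?P) \<le> 1 / (sqrt (b i) * (1 + s)\<^sup>2)"
      using bi s by (intro frac_le) auto
    then show ?thesis by (simp add: eigenframe_resolvent(2)[OF q eigenframe_pos s] mult_ac)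
  qed
  then have "q i \<bullet> (Aop B *v q i) \<le> (1 / sqrt (b i)) * 1"
    by (intro has_integral_le[OF eigenvalue_Aop_has_integral has_integral_mult_right[OF has_integral_inverse_square]]) auto
  then show ?thesis by simp
qed

end
end

lemma coercive_perturb:
  assumes B: "coercive e B" and M: "sym_mat M"
  shows "coercive (e - norm M) (B + M)"
  unfolding coercive_def
proof (intro conjI allI)
  show "sym_mat (B + M)"
    using assms by (simp add: coercive_def sym_mat_def bounded_linear.linear[OF bounded_linear_transpose] linear_add)
  fix x :: "real^3"
  have "- (x \<bullet> (M *v x)) \<le> norm x * norm (M *v x)"
    using Cauchy_Schwarz_ineq2[of x "M *v x"] by linarith
  also have "\<dots> \<le> norm x * (norm M * norm x)"
    by (intro mult_left_mono norm_matrix_vector_mult_le) auto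
  also have "\<dots> = norm M * (x \<bullet> x)" by (simp add: dot_square_norm power2_eq_square)
  finally have "- (norm M * (x \<bullet> x)) \<le> x \<bullet> (M *v x)" by simp
  moreover have "e * (x \<bullet> x) \<le> x \<bullet> (B *v x)" using B by (simp add: coercive_def)
  ultimately show "(e - norm M) * (x \<bullet> x) \<le> x \<bullet> ((B + M) *v x)"
    by (simp add: matrix_vector_mult_add_rdistrib inner_add_right algebra_simps)
qed

text \<open>Both sides are derivatives, up to sign, of the trace of \<open>Aop\<close> along the line \<open>B + u M\<close>.\<close>
lemma trace_Cop:
  assumes B: "coercive e B" and e: "0 < e" "e \<le> 1" and M: "sym_mat M"
  shows "trace (Cop B \<ddagger> M) = (1/2) * (1 / sqrt (det B)) * trace (matrix_inv B ** M)"
proof -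
  \<comment> \<open>Keeps the segment from \<open>B\<close> in direction \<open>M\<close> coercive
    with constant \<open>e/2\<close>; adding 1 to the norm covers \<open>M = 0\<close>.\<close>
  define r where "r = e / (2 * (norm M + 1))"
  have r: "0 < r" using e by (simp add: r_def add_nonneg_pos)
  let ?T = "{0..r}" and ?X = "\<lambda>u. B + u *\<^sub>R M"
  have co: "coercive (e/2) (?X u)" if "u \<in> ?T" for u
  proof -
    have "coercive (e - norm (u *\<^sub>R M)) (?X u)"
      using M by (intro coercive_perturb B) (simp add: sym_mat_def transpose_scalar)
    moreover have "norm (u *\<^sub>R M) \<le> e / 2"
    proof -
      have "norm (u *\<^sub>R M) \<le> r * (norm M + 1)" using that by (auto intro!: mult_mono)
      also have "\<dots> = e / 2"
        using norm_ge_zero[of M] unfolding r_def by (simp add: field_simps add_nonneg_eq_0_iff)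
      finally show ?thesis .
    qed
    ultimately show ?thesis by (elim coercive_mono) simp
  qed
  have e2: "0 < e/2" "e/2 \<le> 1" using e by auto
  have X: "(?X has_vector_derivative M) (at u within ?T)" for u
    by (auto intro!: derivative_eq_intros)
  have "((\<lambda>u. Aop (?X u)) has_vector_derivative - (Cop (?X 0) \<ddagger> M)) (at 0 within ?T)"
    by (rule has_vector_derivative_Aop[where B' = "\<lambda>_. M" and m = "norm M", OF _ _ e2 co X]) (use r M in auto)
  from bounded_linear.has_vector_derivative[OF bounded_linear_trace this]
  have 1: "((\<lambda>u. trace (Aop (?X u))) has_vector_derivative - trace (Cop B \<ddagger> M)) (at 0 within ?T)"
    by (simp add: trace_minus)
  have det0: "0 < det B" using det_shift_pos[OF B e, of 0] by simp
  have "((\<lambda>u. 1 / sqrt (det (?X u))) has_real_derivative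
      - (1/2) * (1 / sqrt (det (?X 0))) * trace (matrix_inv (?X 0) ** M)) (at 0 within ?T)"
    by (intro has_real_derivative_inverse_sqrt has_real_derivative_det3 X) (use det0 in auto)
  then have "((\<lambda>u. 1 / sqrt (det (?X u))) has_vector_derivative
      - (1/2) * (1 / sqrt (det B)) * trace (matrix_inv B ** M)) (at 0 within ?T)"
    by (simp add: has_real_derivative_iff_has_vector_derivative)
  from has_vector_derivative_transform[OF _ trace_Aop[OF co e2] this] r
  have 2: "((\<lambda>u. trace (Aop (?X u))) has_vector_derivative
      - (1/2) * (1 / sqrt (det B)) * trace (matrix_inv B ** M)) (at 0 within ?T)" by simp
  have "- trace (Cop B \<ddagger> M) = - (1/2) * (1 / sqrt (det B)) * trace (matrix_inv B ** M)"
    by (rule vector_derivative_unique_within_closed_interval[of 0 r 0]) (use r 1 2 in auto)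
  then show ?thesis by simp
qed

text \<open>Under the trace the inverse of \<open>B\<close> cancels in both summands, each leaving
  the trace of \<open>Y\<close>, so the drift enters the equation for the trace of \<open>A\<close>
  through a single scalar.\<close>

lemma trace_Cop_drift:
  assumes B: "coercive e B" and e: "0 < e" "e \<le> 1"
  shows "trace (Cop B \<ddagger> (B ** Y + transpose Y ** B)) = (1 / sqrt (det B)) * trace Y"
proof -
  have symB: "transpose B = B" using B by (simp add: coercive_def sym_mat_def)
  have M: "sym_mat (B ** Y + transpose Y ** B)"
    using symB by (simp add: sym_mat_def matrix_transpose_mul bounded_linear.linear[OF bounded_linear_transpose] linear_add)
  have inv: "invertible B" using invertible_shift[OF B e, of 0] by simp
  have "trace (matrix_inv B ** (transpose Y ** B)) = trace ((transpose Y ** B) ** matrix_inv B)"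
    by (rule trace_mul_sym)
  also have "\<dots> = trace (transpose Y)"
    using matrix_inv_works[OF inv] by (simp add: matrix_mul_assoc[symmetric])
  also have "\<dots> = trace Y" by (simp add: trace_def transpose_def)
  finally have "trace (matrix_inv B ** (transpose Y ** B)) = trace Y" .
  moreover have "trace (matrix_inv B ** (B ** Y)) = trace Y"
    using matrix_inv_works[OF inv] by (simp add: matrix_mul_assoc)
  ultimately have "trace (matrix_inv B ** (B ** Y + transpose Y ** B)) = 2 * trace Y"
    by (simp add: matrix_add_ldistrib trace_add)
  then show ?thesis by (simp add: trace_Cop[OF B e M])
qed

section \<open>Inversion of the rank-4 tensor\<close>

lemma linear_ddot: "linear (\<lambda>M. T \<ddagger> M)"
  by (rule linearI) (simp_all add: ddot_def vec_eq_iff sum.distrib sum_distrib_left algebra_simps)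

lemmas ddot_diff = linear_diff[OF linear_ddot]
  and ddot_minus = linear_neg[OF linear_ddot]
  and ddot_scaleR = linear_cmul[OF linear_ddot]

lemma sym_mat_iff: "sym_mat M \<longleftrightarrow> (\<forall>i j. M $ i $ j = M $ j $ i)"
  unfolding sym_mat_def by (auto simp: vec_eq_iff transpose_def)

lemma sym_mat_ddot: "(\<And>i j k l. T i j k l = T j i k l) \<Longrightarrow> sym_mat (T \<ddagger> M)"
  unfolding sym_mat_iff ddot_def vec_lambda_beta by (intro allI sum.cong refl arg_cong2[where f = "(*)"])

lemma sym_mat_add: "sym_mat M \<Longrightarrow> sym_mat N \<Longrightarrow> sym_mat (M + N)"
  and sym_mat_diff: "sym_mat M \<Longrightarrow> sym_mat N \<Longrightarrow> sym_mat (M - N)"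
  and sym_mat_minus: "sym_mat M \<Longrightarrow> sym_mat (- M)"
  and sym_mat_scaleR: "sym_mat M \<Longrightarrow> sym_mat (c *\<^sub>R M)"
  by (simp_all add: sym_mat_iff)

lemma norm_matrix_le_sum: "norm (X :: real^'n^'m) \<le> (\<Sum>i\<in>UNIV. \<Sum>j\<in>UNIV. \<bar>X $ i $ j\<bar>)"
proof -
  have "norm X \<le> (\<Sum>i\<in>UNIV. norm (X $ i))" unfolding norm_vec_def by (rule L2_set_le_sum) simp
  also have "\<dots> \<le> (\<Sum>i\<in>UNIV. \<Sum>j\<in>UNIV. \<bar>X $ i $ j\<bar>)"
    by (intro sum_mono norm_le_l1_cart)
  finally show ?thesis .
qed

lemma matrix_entry_le_norm: "\<bar>X $ i $ j\<bar> \<le> norm (X :: real^'n^'m)"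
  using component_le_norm_cart[of "X $ i" j] Finite_Cartesian_Product.norm_nth_le[of X i] by linarith

lemma norm_ddot_le: "norm (T \<ddagger> M) \<le> (\<Sum>i\<in>UNIV. \<Sum>j\<in>UNIV. \<Sum>k\<in>UNIV. \<Sum>l\<in>UNIV. \<bar>T i j k l\<bar>) * norm M"
proof -
  have "norm (T \<ddagger> M) \<le> (\<Sum>i\<in>UNIV. \<Sum>j\<in>UNIV. \<bar>(T \<ddagger> M) $ i $ j\<bar>)" by (rule norm_matrix_le_sum)
  also have "\<dots> \<le> (\<Sum>i\<in>UNIV. \<Sum>j\<in>UNIV. \<Sum>k\<in>UNIV. \<Sum>l\<in>UNIV. \<bar>T i j k l\<bar> * norm M)"
  proof (intro sum_mono)
    fix i j :: 3
    have "\<bar>(T \<ddagger> M) $ i $ j\<bar> \<le> (\<Sum>k\<in>UNIV. \<bar>\<Sum>l\<in>UNIV. T i j k l * M $ k $ l\<bar>)"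
      unfolding ddot_def vec_lambda_beta by (rule sum_abs)
    also have "\<dots> \<le> (\<Sum>k\<in>UNIV. \<Sum>l\<in>UNIV. \<bar>T i j k l * M $ k $ l\<bar>)"
      by (intro sum_mono sum_abs)
    also have "\<dots> \<le> (\<Sum>k\<in>UNIV. \<Sum>l\<in>UNIV. \<bar>T i j k l\<bar> * norm M)"
      unfolding abs_mult by (intro sum_mono mult_left_mono matrix_entry_le_norm) auto
    finally show "\<bar>(T \<ddagger> M) $ i $ j\<bar> \<le> (\<Sum>k\<in>UNIV. \<Sum>l\<in>UNIV. \<bar>T i j k l\<bar> * norm M)" .
  qed
  finally show ?thesis by (simp add: sum_distrib_right)
qed

lemma trace_mult_sym_inner:
  fixes M :: "real^'n^'n"
  assumes "transpose M = M"
  shows "M \<bullet> X = trace (M ** X)"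
proof -
  have "M $ i $ j = M $ j $ i" for i j using assms by (auto simp: vec_eq_iff transpose_def)
  then have "M \<bullet> X = (\<Sum>i\<in>UNIV. \<Sum>j\<in>UNIV. M $ j $ i * X $ i $ j)"
    unfolding inner_vec_def inner_real_def by (intro sum.cong refl) simp
  also have "\<dots> = trace (M ** X)"
    unfolding trace_def matrix_matrix_mult_def vec_lambda_beta by (rule sum.swap)
  finally show ?thesis .
qed

text \<open>The density of this quadratic form is a square plus a trace which, expanded in the
  eigenframe, sums the resolvent form at the vectors \<open>M *v q i\<close> with positive weights;
  a nonzero \<open>M\<close> cannot annihilate the whole frame. The positivity serves both the
  existence of \<open>Dop\<close> and its continuity.\<close>

lemma Cop_posdef:
  assumes B: "coercive e B" and e: "0 < e" "e \<le> 1" and M: "sym_mat M" "M \<noteq> 0"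
  shows "0 < M \<bullet> (Cop B \<ddagger> M)"
proof -
  have symM: "transpose M = M" using M by (simp add: sym_mat_def)
  obtain q b where q: "eigenframe B q b" using coercive_eigenframe[OF B] by metis
  note b = eigenframe_pos[OF B e q]
  obtain i0 where i0: "M *v q i0 \<noteq> 0" using eigenframe_eq_0[OF q] M by blast
  have pos: "0 < M \<bullet> Cdensity B s M" if s: "0 \<le> s" for s
  proof -
    let ?R = "resolvent B s"
    have symR: "transpose ?R = ?R" by (rule transpose_resolvent[OF B e s])
    have nonneg: "0 \<le> x \<bullet> (?R *v x)" for x
      using resolvent_form_pos[OF B e s, of x] by (cases "x = 0") auto
    have bs: "0 < 1 / (b i + s)" for i using b[of i] s by simp
    have "trace (M ** (?R ** M ** ?R)) = trace ((M ** ?R ** M) ** ?R)" by (simp add: matrix_mul_assoc)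
    also have "\<dots> = (\<Sum>i\<in>UNIV. q i \<bullet> (((M ** ?R ** M) ** ?R) *v q i))" by (rule eigenframe_trace[OF q])
    also have "\<dots> = (\<Sum>i\<in>UNIV. (1 / (b i + s)) * ((M *v q i) \<bullet> (?R *v (M *v q i))))"
      by (intro sum.cong refl)
        (simp add: matrix_vector_mul_assoc[symmetric] symmetric_matrix_inner[OF symM] eigenframe_resolvent(1)[OF q b s]
          matrix_vector_mult_scaleR)
    also have "\<dots> > 0"
      using bs nonneg resolvent_form_pos[OF B e s i0]
      by (intro sum_pos2[of _ i0] mult_nonneg_nonneg mult_pos_pos less_imp_le[OF bs]) auto
    finally have 1: "0 < trace (M ** (?R ** M ** ?R))" .
    have "M \<bullet> Cdensity B s M = weight B s / 4 * ((trace (?R ** M))\<^sup>2 + 2 * trace (M ** (?R ** M ** ?R)))"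
      unfolding Cdensity_def
      by (simp add: inner_add_right trace_mult_sym_inner[OF symM] trace_mul_sym[of M ?R] power2_eq_square)
    also have "\<dots> > 0" using 1 weight_pos[OF B e s] by (intro mult_pos_pos add_nonneg_pos) auto
    finally show ?thesis .
  qed
  have int: "((\<lambda>s. M \<bullet> Cdensity B s M) has_integral M \<bullet> (Cop B \<ddagger> M)) {0..}"
    by (rule has_integral_matrix_inner[OF Cdensity_has_integral[OF B e M(1)]])
  have "continuous_on {0..} (\<lambda>s. M \<bullet> Cdensity B s M)"
    unfolding Cdensity_def
    by (intro continuous_intros continuous_on_resolvent[OF B e] continuous_on_weight[OF B e]) auto
  from integral_halfline_pos[OF this _ pos] int show ?thesis by (auto simp: has_integral_iff)
qed

text \<open>This projection serves twice: to extend contraction by \<open>Cop\<close> to an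
  invertible map of the whole matrix space, and to define the truncated field at matrices that are
  not symmetric.\<close>

definition sym_part :: "mat3 \<Rightarrow> mat3" where
  "sym_part M = (1/2) *\<^sub>R (M + transpose M)"

lemma linear_sym_part: "linear sym_part"
  unfolding sym_part_def
  by (rule linearI) (simp_all add: vec_eq_iff transpose_def algebra_simps)

lemma sym_mat_sym_part: "sym_mat (sym_part M)"
  by (simp add: sym_mat_iff sym_part_def transpose_def)

lemma sym_part_id: "sym_mat M \<Longrightarrow> sym_part M = M"
  by (simp add: sym_mat_def sym_part_def flip: scaleR_2)

text \<open>An injective endomorphism of a finite-dimensional space is bijective. The tensor is read
  off from the inverse at symmetrised matrix units, which gives the symmetry in the last two
  indices; the inverse preserves symmetric matrices, which gives the symmetry in the first
  two.\<close>

lemma ddot_inverse_exists: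
  assumes C: "\<And>i j k l. C i j k l = C j i k l"
    and inj: "\<And>M. sym_mat M \<Longrightarrow> C \<ddagger> M = 0 \<Longrightarrow> M = 0"
  shows "\<exists>T. (\<forall>i j k l. T i j k l = T j i k l \<and> T i j k l = T i j l k) \<and>
      (\<forall>M. sym_mat M \<longrightarrow> C \<ddagger> (T \<ddagger> M) = M \<and> T \<ddagger> (C \<ddagger> M) = M)"
proof -
  \<comment> \<open>extended by the identity on antisymmetric matrices\<close>
  define L where "L = (\<lambda>M. C \<ddagger> sym_part M + (M - sym_part M))"
  have linL: "linear L"
    unfolding L_def
    by (intro linear_compose_add linear_compose_sub linear_sym_part linear_id[unfolded id_def]
        linear_compose[OF linear_sym_part linear_ddot, unfolded o_def])
  have symC: "sym_mat (C \<ddagger> M)" for M by (rule sym_mat_ddot[OF C])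
  have symL: "sym_mat M" if "sym_mat (L M)" for M
  proof -
    have "sym_mat (L M - C \<ddagger> sym_part M + sym_part M)"
      by (intro sym_mat_add sym_mat_diff that symC sym_mat_sym_part)
    then show ?thesis by (simp add: L_def)
  qed
  have L_sym: "L M = C \<ddagger> M" if "sym_mat M" for M
    using that by (simp add: L_def sym_part_id)
  have injL: "inj L"
    unfolding linear_injective_0[OF linL]
  proof (intro allI impI)
    fix M assume 0: "L M = 0"
    then have "sym_mat M" using symL[of M] by (simp add: sym_mat_iff)
    then show "M = 0" using 0 inj[of M] by (simp add: L_sym)
  qed
  obtain g where g: "linear g" and gL: "\<And>M. g (L M) = M" and Lg: "\<And>M. L (g M) = M"
    using linear_injective_isomorphism[OF linL injL] by blast
  define E where "E = (\<lambda>k l. (\<chi> i j. if i = k \<and> j = l then 1 else 0) :: mat3)"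
  define T where "T = (\<lambda>i j k l. g (sym_part (E k l)) $ i $ j)"
  have symg: "sym_mat (g M)" if "sym_mat M" for M
    using symL[of "g M"] that by (simp add: Lg)
  have expand: "M = (\<Sum>k\<in>UNIV. \<Sum>l\<in>UNIV. M $ k $ l *\<^sub>R E k l)" for M
    by (simp add: vec_eq_iff forall_3 sum_3 E_def)
  have Tg: "T \<ddagger> M = g M" if "sym_mat M" for M
  proof -
    have "g M = g (sym_part (\<Sum>k\<in>UNIV. \<Sum>l\<in>UNIV. M $ k $ l *\<^sub>R E k l))"
      using that expand[of M] by (simp add: sym_part_id)
    also have "\<dots> = (\<Sum>k\<in>UNIV. \<Sum>l\<in>UNIV. M $ k $ l *\<^sub>R g (sym_part (E k l)))"
      by (simp add: linear_sum[OF linear_sym_part] linear_sum[OF g] linear_cmul[OF linear_sym_part] linear_cmul[OF g])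
    also have "\<dots> = T \<ddagger> M"
      by (simp add: vec_eq_iff ddot_def T_def mult.commute)
    finally show ?thesis by simp
  qed
  show ?thesis
  proof (intro exI[of _ T] conjI allI impI)
    fix i j k l
    show "T i j k l = T j i k l"
      using symg[OF sym_mat_sym_part] unfolding T_def sym_mat_iff by blast
    have "transpose (E a b) = E b a" for a b
      unfolding vec_eq_iff E_def transpose_def vec_lambda_beta by (simp add: conj_commute)
    then have "sym_part (E k l) = sym_part (E l k)"
      by (simp add: sym_part_def add.commute)
    then show "T i j k l = T i j l k" by (simp add: T_def)
  next
    fix M :: mat3 assume M: "sym_mat M"
    show "C \<ddagger> (T \<ddagger> M) = M" using M symg[OF M] Lg[of M] by (simp add: Tg L_sym)
    show "T \<ddagger> (C \<ddagger> M) = M" using M gL[of M] by (simp add: Tg symC L_sym)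
  qed
qed

text \<open>\<open>Dop\<close> is defined by choice, so its properties become available once an
  inverse tensor exists; \<open>Cop_posdef\<close> supplies the injectivity for that.\<close>

lemma Dop_spec:
  assumes B: "coercive e B" and e: "0 < e" "e \<le> 1"
  shows "sym_mat (Dop B \<ddagger> N)" "sym_mat M \<Longrightarrow> Cop B \<ddagger> (Dop B \<ddagger> M) = M"
proof -
  have inj: "M = 0" if "sym_mat M" "Cop B \<ddagger> M = 0" for M
    using Cop_posdef[OF B e that(1)] that(2) by fastforce
  from someI_ex[OF ddot_inverse_exists[of "Cop B", OF Cop_symmetric[OF B e] inj], folded Dop_def]
  have *: "\<And>i j k l. Dop B i j k l = Dop B j i k l"
    "\<And>M. sym_mat M \<Longrightarrow> Cop B \<ddagger> (Dop B \<ddagger> M) = M \<and> Dop B \<ddagger> (Cop B \<ddagger> M) = M"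
    by blast+
  show "sym_mat (Dop B \<ddagger> N)" by (rule sym_mat_ddot) (rule *(1))
  show "sym_mat M \<Longrightarrow> Cop B \<ddagger> (Dop B \<ddagger> M) = M" using *(2) by blast
qed

section \<open>Continuity of A, C and D in B\<close>

context
  fixes B :: "'a::metric_space \<Rightarrow> mat3" and T e
  assumes B: "continuous_on T B" and co: "\<And>u. u \<in> T \<Longrightarrow> coercive e (B u)" and e: "0 < e" "e \<le> 1"
begin

lemma continuous_on_Aop: "continuous_on T (\<lambda>u. Aop (B u))"
proof -
  have "continuous_on T (\<lambda>u. integral {0..} (\<lambda>s. resolvent (B u) s $ i $ j * weight (B u) s))" for i j
  proof (rule continuous_on_integral_dominated[OF _ _ _ integrable_inverse_square])
    fix u assume u: "u \<in> T"
    show "(\<lambda>s. resolvent (B u) s $ i $ j * weight (B u) s) integrable_on {0..}"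
      by (rule Adensity_integrable[OF co[OF u] e])
    show "\<bar>resolvent (B u) s $ i $ j * weight (B u) s\<bar> \<le> (1 / e ^ 3) / (1 + s)\<^sup>2" if "s \<in> {0..}" for s
      using that by (intro Adensity_le[OF co[OF u] e]) simp
  qed (auto intro!: continuous_intros continuous_on_resolvent_param[OF B co e])
  then show ?thesis
    by (subst continuous_on_cong[OF refl, of _ _ "\<lambda>u. \<chi> i j. (1/2) * integral {0..} (\<lambda>s. resolvent (B u) s $ i $ j * weight (B u) s)"])
      (auto simp: vec_eq_iff Aop_entry intro!: continuous_intros)
qed

lemma continuous_on_Cop: "continuous_on T (\<lambda>u. Cop (B u) i j k l)"
proof -
  have c: "continuous_on T (\<lambda>u. integral {0..} (\<lambda>s. resolvent (B u) s $ i $ j * resolvent (B u) s $ k $ l * weight (B u) s))" for i j k l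
  proof (rule continuous_on_integral_dominated[OF _ _ _ integrable_inverse_square])
    fix u assume u: "u \<in> T"
    show "(\<lambda>s. resolvent (B u) s $ i $ j * resolvent (B u) s $ k $ l * weight (B u) s) integrable_on {0..}"
      by (rule two_resolvents_integrable[OF co[OF u] e])
    show "\<bar>resolvent (B u) s $ i $ j * resolvent (B u) s $ k $ l * weight (B u) s\<bar> \<le> (1 / e ^ 4) / (1 + s)\<^sup>2"
      if "s \<in> {0..}" for s
      using that by (intro two_resolvents_le[OF co[OF u] e]) simp
  qed (auto intro!: continuous_intros continuous_on_resolvent_param[OF B co e])
  let ?I = "\<lambda>u i j k l. integral {0..} (\<lambda>s. resolvent (B u) s $ i $ j * resolvent (B u) s $ k $ l * weight (B u) s)"
  have eq: "Cop (B u) i j k l = (1/4) * (?I u i j k l + ?I u i k j l + ?I u i l j k)" if "u \<in> T" for u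
  proof (rule has_integral_unique[OF Cop_has_integral[OF co[OF that] e]])
    show "((\<lambda>s. (1/4) * (resolvent (B u) s $ i $ j * resolvent (B u) s $ k $ l * weight (B u) s
      + resolvent (B u) s $ i $ k * resolvent (B u) s $ j $ l * weight (B u) s
      + resolvent (B u) s $ i $ l * resolvent (B u) s $ j $ k * weight (B u) s)) has_integral
      (1/4) * (?I u i j k l + ?I u i k j l + ?I u i l j k)) {0..}"
      by (intro has_integral_mult_right has_integral_add integrable_integral two_resolvents_integrable[OF co[OF that] e])
  qed
  show ?thesis
    by (subst continuous_on_cong[OF refl eq]) (auto intro!: continuous_intros c)
qed

text \<open>A perturbation argument for inverses. At \<open>v\<close>, \<open>Cop\<close> is bounded
  below on symmetric matrices by some \<open>\<kappa> > 0\<close>; where the perturbation has norm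
  below \<open>\<kappa> / 2\<close>, half of the bound survives and controls the difference of the
  solutions \<open>X u\<close> and \<open>X v\<close>.\<close>

lemma continuous_on_Dop_ddot:
  assumes N: "continuous_on T N" and symN: "\<And>u. u \<in> T \<Longrightarrow> sym_mat (N u)"
  shows "continuous_on T (\<lambda>u. Dop (B u) \<ddagger> N u)"
  unfolding continuous_on_def
proof
  fix v assume v: "v \<in> T"
  let ?S = "{M::mat3. sym_mat M} \<inter> sphere 0 1"
  have "closed {M::mat3. sym_mat M}"
    unfolding sym_mat_def by (intro closed_Collect_eq continuous_intros)
  then have "compact ?S" by (intro closed_Int_compact) auto
  moreover have "mat 1 /\<^sub>R norm (mat 1 :: mat3) \<in> ?S"
  proof -
    have "(mat 1 :: mat3) \<noteq> 0" by (simp add: mat_def vec_eq_iff)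
    then show ?thesis by (simp add: sym_mat_def transpose_scalar)
  qed
  moreover have "continuous_on ?S (\<lambda>M. M \<bullet> (Cop (B v) \<ddagger> M))"
    by (intro continuous_intros linear_continuous_on linear_conv_bounded_linear[THEN iffD1] linear_ddot)
  ultimately obtain M0 where M0: "M0 \<in> ?S"
    and min: "\<And>M. M \<in> ?S \<Longrightarrow> M0 \<bullet> (Cop (B v) \<ddagger> M0) \<le> M \<bullet> (Cop (B v) \<ddagger> M)"
    using continuous_attains_inf[of ?S "\<lambda>M. M \<bullet> (Cop (B v) \<ddagger> M)"] by blast
  define \<kappa> where "\<kappa> = M0 \<bullet> (Cop (B v) \<ddagger> M0)"
  have \<kappa>: "0 < \<kappa>" unfolding \<kappa>_def using M0 by (intro Cop_posdef[OF co[OF v] e]) auto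
  have lower: "\<kappa> * (norm M)\<^sup>2 \<le> M \<bullet> (Cop (B v) \<ddagger> M)" if "sym_mat M" for M
  proof (cases "M = 0")
    case False
    have "\<kappa> \<le> (M /\<^sub>R norm M) \<bullet> (Cop (B v) \<ddagger> (M /\<^sub>R norm M))"
      unfolding \<kappa>_def using that False by (intro min) (auto intro: sym_mat_scaleR)
    also have "\<dots> = (M \<bullet> (Cop (B v) \<ddagger> M)) / (norm M)\<^sup>2"
      by (simp add: ddot_scaleR power2_eq_square field_simps)
    finally show ?thesis using False by (simp add: field_simps)
  qed simp
  \<comment> \<open>A crude operator norm of the difference of the two tensors, chosen because it is
    visibly continuous in \<open>u\<close> and 0 at \<open>v\<close>.\<close>
  define \<eta> where "\<eta> = (\<lambda>u. \<Sum>i\<in>UNIV. \<Sum>j\<in>UNIV. \<Sum>k\<in>UNIV. \<Sum>l\<in>UNIV. \<bar>Cop (B u) i j k l - Cop (B v) i j k l\<bar>)"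
  have "continuous_on T \<eta>" unfolding \<eta>_def by (intro continuous_intros continuous_on_Cop)
  then have \<eta>_lim: "(\<eta> \<longlongrightarrow> 0) (at v within T)"
    using v unfolding continuous_on_def by (auto simp: \<eta>_def)
  have \<eta>: "norm (Cop (B u) \<ddagger> M - Cop (B v) \<ddagger> M) \<le> \<eta> u * norm M" for u M
  proof -
    have "Cop (B u) \<ddagger> M - Cop (B v) \<ddagger> M = (\<lambda>i j k l. Cop (B u) i j k l - Cop (B v) i j k l) \<ddagger> M"
      by (simp add: ddot_def vec_eq_iff sum_subtractf left_diff_distrib)
    then show ?thesis unfolding \<eta>_def by (simp only: norm_ddot_le)
  qed
  define X where "X = (\<lambda>u. Dop (B u) \<ddagger> N u)"
  define g where "g = (\<lambda>u. (2 / \<kappa>) * (norm (N u - N v) + \<eta> u * norm (X v)))"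
  have est: "norm (X u - X v) \<le> g u" if u: "u \<in> T" and small: "\<eta> u < \<kappa> / 2" for u
  proof -
    define Z where "Z = X u - X v"
    have symZ: "sym_mat Z"
      unfolding Z_def X_def using Dop_spec(1)[OF co[OF u] e] Dop_spec(1)[OF co[OF v] e] by (intro sym_mat_diff)
    \<comment> \<open>The equations solved by \<open>X u\<close> and \<open>X v\<close> are
      subtracted; what remains on the right tends to 0 with \<open>u\<close> tending to
      \<open>v\<close> and involves only the fixed matrix \<open>X v\<close>.\<close>
    have "Cop (B u) \<ddagger> Z = (N u - N v) - (Cop (B u) \<ddagger> X v - Cop (B v) \<ddagger> X v)"
      unfolding Z_def ddot_diff using Dop_spec(2)[OF co[OF u] e symN[OF u]] Dop_spec(2)[OF co[OF v] e symN[OF v]]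
      by (simp add: X_def)
    then have CZ: "norm (Cop (B u) \<ddagger> Z) \<le> norm (N u - N v) + \<eta> u * norm (X v)"
      using norm_triangle_ineq4[of "N u - N v" "Cop (B u) \<ddagger> X v - Cop (B v) \<ddagger> X v"] \<eta>[of u "X v"] by simp
    have "\<kappa> * (norm Z)\<^sup>2 \<le> Z \<bullet> (Cop (B v) \<ddagger> Z)" by (rule lower[OF symZ])
    also have "\<dots> = Z \<bullet> (Cop (B u) \<ddagger> Z) - Z \<bullet> (Cop (B u) \<ddagger> Z - Cop (B v) \<ddagger> Z)"
      by (simp add: inner_diff_right)
    also have "\<dots> \<le> norm Z * norm (Cop (B u) \<ddagger> Z) + norm Z * norm (Cop (B u) \<ddagger> Z - Cop (B v) \<ddagger> Z)"
      using norm_cauchy_schwarz[of Z "Cop (B u) \<ddagger> Z"]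
        Cauchy_Schwarz_ineq2[of Z "Cop (B u) \<ddagger> Z - Cop (B v) \<ddagger> Z"] by linarith
    also have "\<dots> \<le> norm Z * norm (Cop (B u) \<ddagger> Z) + norm Z * ((\<kappa> / 2) * norm Z)"
      using \<eta>[of u Z] small
      by (intro add_left_mono mult_left_mono order_trans[OF \<eta>] mult_right_mono) auto
    finally have "norm Z * (\<kappa> / 2 * norm Z) \<le> norm Z * norm (Cop (B u) \<ddagger> Z)"
      by (simp add: power2_eq_square algebra_simps)
    then have "\<kappa> / 2 * norm Z \<le> norm (Cop (B u) \<ddagger> Z)"
      by (cases "norm Z = 0") (auto dest: mult_left_le_imp_le)
    then have "\<kappa> / 2 * norm Z \<le> norm (N u - N v) + \<eta> u * norm (X v)" using CZ by linarith
    then show ?thesis using \<kappa> unfolding Z_def g_def by (simp add: field_simps)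
  qed
  have "((\<lambda>u. norm (N u - N v)) \<longlongrightarrow> 0) (at v within T)"
    using N v unfolding continuous_on_def by (intro tendsto_norm_zero) (simp add: LIM_zero_iff)
  then have "(g \<longlongrightarrow> (2 / \<kappa>) * (0 + 0 * norm (X v))) (at v within T)"
    unfolding g_def by (intro tendsto_intros \<eta>_lim)
  then have g: "(g \<longlongrightarrow> 0) (at v within T)" by simp
  have "eventually (\<lambda>u. \<eta> u < \<kappa> / 2) (at v within T)"
    using order_tendstoD(2)[OF \<eta>_lim, of "\<kappa> / 2"] \<kappa> by simp
  then have "eventually (\<lambda>u. norm (X u - X v) \<le> g u) (at v within T)"
    using est by (auto simp: eventually_at_filter elim: eventually_mono)
  from Lim_null_comparison[OF this g]
  show "((\<lambda>u. Dop (B u) \<ddagger> N u) \<longlongrightarrow> Dop (B v) \<ddagger> N v) (at v within T)"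
    by (simp add: X_def LIM_zero_iff)
qed

end

section \<open>The right-hand sides along a solution\<close>

lemma sym_mat_drift:
  assumes "sym_mat B"
  shows "sym_mat (B ** Y + transpose Y ** B)"
  using assms
  by (simp add: sym_mat_def matrix_transpose_mul bounded_linear.linear[OF bounded_linear_transpose] linear_add)

text \<open>One matrix \<open>Y\<close> collects flow and diffusion, since both enter as
  \<open>B ** Y + transpose Y ** B\<close>; antisymmetry of \<open>Om\<close> accounts for its
  change of sign. The estimates then concern a single drift term and a source built from
  \<open>Dr\<close> and \<open>A\<close>.\<close>

definition fec_drift :: "real \<Rightarrow> mat3 \<Rightarrow> mat3 \<Rightarrow> mat3 \<Rightarrow> mat3" where
  "fec_drift lam Om Ga Dr = (1/2) *\<^sub>R (Om + lam *\<^sub>R Ga) - 5 *\<^sub>R Dr"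

lemma trace_posdef_nonneg: "posdef D \<Longrightarrow> 0 \<le> trace D"
proof -
  assume D: "posdef D"
  have "0 \<le> D $ i $ i" for i
  proof -
    have "0 < axis i 1 \<bullet> (D *v axis i 1)" using D by (simp add: posdef_def axis_eq_0_iff)
    then show ?thesis by (simp add: matrix_vector_mult_basis column_def inner_axis')
  qed
  then show ?thesis by (simp add: trace_def sum_nonneg)
qed

context
  fixes lam :: real and Om Ga Dr :: mat3
  assumes Om: "transpose Om = - Om" and Ga: "sym_mat Ga" and Dr: "sym_mat Dr"
begin

lemma fec_drift_split:
  "(1/2) *\<^sub>R (B ** (Om + lam *\<^sub>R Ga) + (- Om + lam *\<^sub>R Ga) ** B) - 5 *\<^sub>R (B ** Dr + Dr ** B) =
   B ** fec_drift lam Om Ga Dr + transpose (fec_drift lam Om Ga Dr) ** B"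
proof -
  interpret mm: bounded_bilinear "(**) :: mat3 \<Rightarrow> mat3 \<Rightarrow> mat3" by (rule bounded_bilinear_matrix_mult)
  interpret tr: bounded_linear "transpose :: mat3 \<Rightarrow> mat3" by (rule bounded_linear_transpose)
  have "transpose (fec_drift lam Om Ga Dr) = (1/2) *\<^sub>R (- Om + lam *\<^sub>R Ga) - 5 *\<^sub>R Dr"
    using Om Ga Dr by (simp add: fec_drift_def tr.diff tr.add tr.scaleR sym_mat_def)
  then show ?thesis
    by (simp only:)
      (simp add: fec_drift_def mm.add_left mm.add_right mm.diff_left mm.diff_right mm.minus_left
        mm.scaleR_left mm.scaleR_right scaleR_add_right scaleR_diff_right)
qed

lemma fec_rhsB_eq:
  "fec_rhsB lam Om Ga Dr A B =
     - (B ** fec_drift lam Om Ga Dr + transpose (fec_drift lam Om Ga Dr) ** B)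
     - Dop B \<ddagger> (2 *\<^sub>R Dr + (3 * trace Dr) *\<^sub>R A)"
  unfolding fec_rhsB_def fec_drift_split[symmetric] by simp

lemma fec_rhsA_eq:
  "fec_rhsA lam Om Ga Dr A B =
     Cop B \<ddagger> (B ** fec_drift lam Om Ga Dr + transpose (fec_drift lam Om Ga Dr) ** B)
     + 2 *\<^sub>R Dr + (3 * trace Dr) *\<^sub>R A"
  unfolding fec_rhsA_def fec_drift_split[symmetric] by (simp add: ddot_diff ddot_scaleR)

context
  fixes B :: mat3 and e :: real
  assumes B: "coercive e B" and e: "0 < e" "e \<le> 1"
begin

lemma sym_mat_source: "sym_mat (2 *\<^sub>R Dr + (3 * trace Dr) *\<^sub>R Aop B)"
  by (intro sym_mat_add sym_mat_scaleR Dr sym_mat_Aop[OF B e])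

lemma sym_mat_fec_rhsB: "sym_mat (fec_rhsB lam Om Ga Dr (Aop B) B)"
  unfolding fec_rhsB_eq using B
  by (intro sym_mat_diff sym_mat_minus sym_mat_drift Dop_spec(1)[OF B e]) (simp add: coercive_def)

lemma Cop_fec_rhsB: "- (Cop B \<ddagger> fec_rhsB lam Om Ga Dr (Aop B) B) = fec_rhsA lam Om Ga Dr (Aop B) B"
  unfolding fec_rhsB_eq fec_rhsA_eq ddot_diff ddot_minus Dop_spec(2)[OF B e sym_mat_source] by simp

text \<open>The drift matrix has trace \<open>- 5 * trace Dr\<close>, as \<open>Om\<close> and
  \<open>Ga\<close> are traceless, and it is multiplied by the inverse square root of the
  determinant, that is, by the trace of \<open>Aop B\<close>. The \<open>3 * trace Dr\<close> of the
  source leaves the coefficient -2.\<close>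

lemma trace_fec_rhsA:
  assumes "trace Ga = 0"
  shows "trace (fec_rhsA lam Om Ga Dr (Aop B) B) = 2 * trace Dr * (1 - trace (Aop B))"
proof -
  have "trace Om = trace (transpose Om)" by (simp add: trace_def transpose_def)
  also have "\<dots> = - trace Om" by (simp add: Om trace_minus)
  finally have "trace Om = 0" by simp
  then have "trace (fec_drift lam Om Ga Dr) = - 5 * trace Dr"
    using assms by (simp add: fec_drift_def trace_sub trace_scaleR trace_add)
  then show ?thesis
    unfolding fec_rhsA_eq
    by (simp add: trace_add trace_scaleR trace_Cop_drift[OF B e] trace_Aop[OF B e, symmetric] algebra_simps)
qed

text \<open>By Jacobi's formula this trace is the logarithmic derivative of the determinant of
  \<open>A\<close> along a solution. In the common eigenframe it is a sum of three quotients; the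
  source terms are positive and only raise them, and the drift costs at most 5 times the norm in
  each, hence 15.\<close>

lemma trace_inv_fec_rhsA_ge:
  assumes pd: "posdef Dr"
  shows "- 15 * norm (fec_drift lam Om Ga Dr) \<le> trace (matrix_inv (Aop B) ** fec_rhsA lam Om Ga Dr (Aop B) B)"
proof -
  let ?Y = "fec_drift lam Om Ga Dr" and ?F = "fec_rhsA lam Om Ga Dr (Aop B) B"
  obtain q b where q: "eigenframe B q b" using coercive_eigenframe[OF B] by metis
  define a where "a = (\<lambda>i. q i \<bullet> (Aop B *v q i))"
  have qA: "eigenframe (Aop B) q a" unfolding a_def by (rule eigenframe_Aop[OF B e q])
  have q0: "q i \<noteq> 0" for i using eigenframe_norm[OF q, of i] by auto
  have a: "0 < a i" for i
    unfolding a_def using posdef_Aop[OF B e] q0[of i] by (simp add: posdef_def)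
  have inv: "invertible (Aop B)"
    using a by (simp add: invertible_det_nz eigenframe_det[OF qA] less_imp_neq[symmetric])
  have symA: "transpose (matrix_inv (Aop B)) = matrix_inv (Aop B)"
    using sym_mat_Aop[OF B e] inv by (intro transpose_matrix_inv) (simp_all add: sym_mat_def)
  have invq: "matrix_inv (Aop B) *v q i = (1 / a i) *\<^sub>R q i" for i
    using a by (intro eigenframe_matrix_inv[OF qA]) (simp add: less_imp_neq[symmetric])
  have F: "- 5 * norm ?Y * a i \<le> q i \<bullet> (?F *v q i)" for i
  proof -
    have "0 < q i \<bullet> (Dr *v q i)" using pd q0[of i] by (simp add: posdef_def)
    moreover have "0 \<le> trace Dr * a i" using trace_posdef_nonneg[OF pd] a[of i] by simp
    moreover have "- (5 * norm ?Y * a i) \<le> q i \<bullet> ((Cop B \<ddagger> (B ** ?Y + transpose ?Y ** B)) *v q i)"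
      using eigenvalue_Cop_le[OF B e q, of i ?Y] by (simp add: a_def abs_le_iff)
    moreover have "q i \<bullet> (Aop B *v q i) = a i" by (simp add: a_def)
    ultimately show ?thesis
      unfolding fec_rhsA_eq
      by (simp add: matrix_vector_mult_add_rdistrib inner_add_right scaleR_matrix_vector_assoc[symmetric])
  qed
  have "trace (matrix_inv (Aop B) ** ?F) = (\<Sum>i\<in>UNIV. q i \<bullet> ((matrix_inv (Aop B) ** ?F) *v q i))"
    by (rule eigenframe_trace[OF q])
  also have "\<dots> = (\<Sum>i\<in>UNIV. (1 / a i) * (q i \<bullet> (?F *v q i)))"
    by (intro sum.cong refl) (simp add: matrix_vector_mul_assoc[symmetric] symmetric_matrix_inner[OF symA] invq)
  also have "\<dots> \<ge> (\<Sum>i\<in>(UNIV::3 set). - 5 * norm ?Y)"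
  proof (rule sum_mono)
    fix i
    have "- 5 * norm ?Y = (1 / a i) * (- 5 * norm ?Y * a i)" using a[of i] by simp
    also have "\<dots> \<le> (1 / a i) * (q i \<bullet> (?F *v q i))"
      using F[of i] a[of i] by (intro mult_left_mono) auto
    finally show "- 5 * norm ?Y \<le> (1 / a i) * (q i \<bullet> (?F *v q i))" .
  qed
  finally show ?thesis by simp
qed

end
end

section \<open>Bounds on B from the determinant of A\<close>

lemma eigenframe_expand:
  fixes x :: "real^'n"
  assumes q: "eigenframe B q b"
  shows "x = (\<Sum>i\<in>UNIV. (q i \<bullet> x) *\<^sub>R q i)"
proof -
  let ?Q = "\<chi> i. q i"
  have "x = transpose ?Q *v (?Q *v x)"
    using eigenframe_orthogonal[OF q] by (simp add: matrix_vector_mul_assoc orthogonal_matrix_def del: transpose_matrix_vector)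
  also have "\<dots> = (\<Sum>i\<in>UNIV. (q i \<bullet> x) *\<^sub>R q i)"
    by (simp add: vec_eq_iff matrix_vector_mult_def transpose_def inner_vec_def mult.commute del: transpose_matrix_vector)
  finally show ?thesis .
qed

lemma eigenframe_coerciveI:
  fixes B :: mat3
  assumes sym: "sym_mat B" and q: "eigenframe B q b" and b: "\<And>i. c \<le> b i"
  shows "coercive c B"
  unfolding coercive_def
proof (intro conjI allI sym)
  fix x :: "real^3"
  have sB: "transpose B = B" using sym by (simp add: sym_mat_def)
  have "c * (x \<bullet> x) = c * (x \<bullet> (\<Sum>i\<in>UNIV. (q i \<bullet> x) *\<^sub>R q i))"
    using eigenframe_expand[OF q, of x] by simp
  also have "\<dots> = (\<Sum>i\<in>UNIV. c * (q i \<bullet> x)\<^sup>2)"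
    by (simp add: inner_sum_right sum_distrib_left power2_eq_square inner_commute)
  also have "\<dots> \<le> (\<Sum>i\<in>UNIV. b i * (q i \<bullet> x)\<^sup>2)"
    by (intro sum_mono mult_right_mono b) auto
  also have "\<dots> = (B *v x) \<bullet> (\<Sum>i\<in>UNIV. (q i \<bullet> x) *\<^sub>R q i)"
  proof -
    have "(B *v x) \<bullet> q i = b i * (q i \<bullet> x)" for i
      using symmetric_matrix_inner[OF sB, of x "q i"] by (simp add: eigenframe_eigen[OF q] inner_commute)
    then show ?thesis by (simp add: inner_sum_right power2_eq_square mult_ac)
  qed
  also have "\<dots> = x \<bullet> (B *v x)"
    using eigenframe_expand[OF q, of x] by (simp add: inner_commute)
  finally show "c * (x \<bullet> x) \<le> x \<bullet> (B *v x)" .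
qed

lemma prod3_lower:
  fixes a :: "3 \<Rightarrow> real"
  assumes "\<And>i. 0 < a i" "\<And>i. a i \<le> c" "d \<le> (\<Prod>i\<in>UNIV. a i)"
  shows "d \<le> a i * c\<^sup>2"
proof -
  have "(\<Prod>j\<in>UNIV. a j) = a i * (\<Prod>j\<in>UNIV - {i}. a j)" by (rule prod.remove) auto
  also have "\<dots> \<le> a i * (\<Prod>j\<in>UNIV - {i}. c)"
    using assms by (intro mult_left_mono prod_mono) (auto simp: less_imp_le)
  also have "\<dots> = a i * c\<^sup>2" by (simp add: card_Diff_singleton)
  finally show ?thesis using assms(3) by linarith
qed

text \<open>Origin of the powers: the eigenvalues \<open>a i\<close> are positive with sum 1, so
  each is at least their product and hence at least \<open>d\<close>. For
  \<open>b i \<ge> 1\<close>, \<open>d \<le> 1 / sqrt (b i)\<close> gives the cap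
  \<open>1 / d\<^sup>2\<close>; with determinant 1 and two factors under this cap, the third is at
  least \<open>d ^ 4\<close>. The squared norm is at most \<open>3 / d ^ 4\<close>, rounded up to a
  square.\<close>

lemma Aop_det_controls:
  assumes B: "coercive e B" and e: "0 < e" "e \<le> 1" and det: "det B = 1"
    and d: "0 < d" "d \<le> det (Aop B)"
  shows "d \<le> 1" "coercive (d ^ 4) B" "norm B \<le> 2 / d\<^sup>2"
proof -
  obtain q b where q: "eigenframe B q b" using coercive_eigenframe[OF B] by metis
  note b0 = eigenframe_pos[OF B e q]
  have symB: "sym_mat B" using B by (simp add: coercive_def)
  define a where "a = (\<lambda>i. q i \<bullet> (Aop B *v q i))"
  have qA: "eigenframe (Aop B) q a" unfolding a_def by (rule eigenframe_Aop[OF B e q])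
  have q0: "q i \<noteq> 0" for i using eigenframe_norm[OF q, of i] by auto
  have a: "0 < a i" for i
    unfolding a_def using posdef_Aop[OF B e] q0[of i] by (simp add: posdef_def)
  have "(\<Sum>i\<in>UNIV. a i) = 1"
    using eigenframe_trace[OF q, of "Aop B"] trace_Aop[OF B e] det by (simp add: a_def)
  moreover have "a i \<le> (\<Sum>i\<in>UNIV. a i)" for i
    using a by (intro member_le_sum) (auto simp: less_imp_le)
  ultimately have a1: "a i \<le> 1" for i by simp
  have da: "d \<le> a i" for i
    using prod3_lower[of a 1 d i] a a1 d by (simp add: eigenframe_det[OF qA])
  show d1: "d \<le> 1" using da[of 1] a1[of 1] by linarith
  have b1: "b i \<le> 1 / d\<^sup>2" for i
  proof (cases "1 \<le> b i")
    case True
    have "d \<le> 1 / sqrt (b i)"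
      using da[of i] eigenvalue_Aop_le[OF B e q det True] by (simp add: a_def)
    then have "d\<^sup>2 \<le> (1 / sqrt (b i))\<^sup>2" using d by (intro power_mono) auto
    also have "\<dots> = 1 / b i" using b0[of i] by (simp add: power_divide)
    finally show ?thesis using b0[of i] d by (simp add: field_simps)
  next
    case False
    have "1 \<le> 1 / d\<^sup>2" using d d1 by (simp add: power_le_one)
    then show ?thesis using False by linarith
  qed
  have "1 \<le> b i * (1 / d\<^sup>2)\<^sup>2" for i
    using prod3_lower[of b "1 / d\<^sup>2" 1 i] b0 b1 det by (simp add: eigenframe_det[OF q])
  moreover have "(1 / d\<^sup>2)\<^sup>2 = 1 / d ^ 4" by (simp add: power_divide)
  ultimately have "d ^ 4 \<le> b i" for i using d by (simp add: field_simps)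
  then show "coercive (d ^ 4) B" by (intro eigenframe_coerciveI[OF symB q])
  have "(norm B)\<^sup>2 = trace (B ** B)"
    using trace_mult_sym_inner[of B B] symB by (simp add: power2_norm_eq_inner sym_mat_def)
  also have "\<dots> = (\<Sum>i\<in>UNIV. (b i)\<^sup>2)"
    by (simp add: eigenframe_trace[OF q] matrix_vector_mul_assoc[symmetric] eigenframe_eigen[OF q]
        matrix_vector_mult_scaleR eigenframe_inner[OF q] power2_eq_square)
  also have "\<dots> \<le> (\<Sum>i\<in>(UNIV::3 set). (1 / d\<^sup>2)\<^sup>2)"
    by (intro sum_mono power_mono b1) (use b0 in \<open>auto simp: less_imp_le\<close>)
  also have "\<dots> \<le> (2 / d\<^sup>2)\<^sup>2" by (simp add: power_divide divide_right_mono)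
  finally show "norm B \<le> 2 / d\<^sup>2" by (rule power2_le_imp_le) simp
qed

section \<open>Solutions on compact intervals\<close>

lemma nondecreasing_within:
  fixes f :: "real \<Rightarrow> real"
  assumes f: "\<And>t. t \<in> {a..b} \<Longrightarrow> (f has_real_derivative f' t) (at t within {a..b})"
    and nonneg: "\<And>t. t \<in> {a..b} \<Longrightarrow> 0 \<le> f' t" and t: "t \<in> {a..b}"
  shows "f a \<le> f t"
proof (rule DERIV_nonneg_imp_increasing_open[of a t f])
  show "a \<le> t" using t by simp
  have "continuous_on {a..b} f" using f by (intro DERIV_continuous_on)
  then show "continuous_on {a..t} f" by (rule continuous_on_subset) (use t in auto)
  fix s assume "a < s" "s < t"
  then have s: "s \<in> {a..b}" and "at s within {a..b} = at s" using t by (auto intro: at_within_Icc_at)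
  then show "\<exists>y. (f has_real_derivative y) (at s) \<and> 0 \<le> y" using f[OF s] nonneg[OF s] by auto
qed

lemma norm_sym_part_le: "norm (sym_part M) \<le> norm M"
  unfolding sym_part_def using norm_triangle_ineq[of M "transpose M"] by (simp add: norm_transpose)

lemma coercive_sym_part_near:
  assumes S: "coercive (2 * e) S" and X: "dist X S \<le> e"
  shows "coercive e (sym_part X)"
proof -
  have "coercive (2 * e - norm (sym_part (X - S))) (S + sym_part (X - S))"
    by (intro coercive_perturb S sym_mat_sym_part)
  moreover have "S + sym_part (X - S) = sym_part X"
    using S by (simp add: linear_diff[OF linear_sym_part] sym_part_id coercive_def)
  moreover have "norm (sym_part (X - S)) \<le> e"
    using norm_sym_part_le[of "X - S"] X by (simp add: dist_norm)
  ultimately show ?thesis using coercive_mono[of "2 * e - norm (sym_part (X - S))" "sym_part X" e] by simp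
qed

lemma closed_coercive: "closed {B. coercive c B}"
  unfolding coercive_def sym_mat_def
  by (intro closed_Collect_conj closed_Collect_all closed_Collect_eq closed_Collect_le continuous_intros)

lemma continuous_on_fec_rhsB:
  fixes B Om Ga Dr :: "'a::metric_space \<Rightarrow> mat3"
  assumes c: "continuous_on T Om" "continuous_on T Ga" "continuous_on T Dr" "continuous_on T B"
    and co: "\<And>u. u \<in> T \<Longrightarrow> coercive e (B u)" and e: "0 < e" "e \<le> 1"
    and Dr: "\<And>u. u \<in> T \<Longrightarrow> sym_mat (Dr u)"
  shows "continuous_on T (\<lambda>u. fec_rhsB lam (Om u) (Ga u) (Dr u) (Aop (B u)) (B u))"
proof -
  have "continuous_on T (\<lambda>u. Dop (B u) \<ddagger> (2 *\<^sub>R Dr u + (3 * trace (Dr u)) *\<^sub>R Aop (B u)))"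
    by (intro continuous_on_Dop_ddot[OF c(4) co e] continuous_intros c continuous_on_Aop[OF c(4) co e]
        sym_mat_add sym_mat_scaleR Dr sym_mat_Aop[OF co e])
  then show ?thesis unfolding fec_rhsB_def by (intro continuous_intros c)
qed

text \<open>The order of the argument is forced: containment in \<open>K\<close> gives coercivity,
  coercivity gives the equation for \<open>A\<close>, its trace gives determinant 1, and with this
  the lower bound on the determinant of \<open>A\<close> places the solution in \<open>S\<close>.
  Each statement is obtained on the entire interval at once.\<close>

theorem fec_solution_interval:
  fixes lam :: real and Om Ga Dr :: "real \<Rightarrow> mat3" and B0 :: mat3
  assumes ab: "a \<le> b"
    and Om: "\<And>t. t \<in> {a..b} \<Longrightarrow> transpose (Om t) = - Om t" "continuous_on {a..b} Om"
    and Ga: "\<And>t. t \<in> {a..b} \<Longrightarrow> sym_mat (Ga t)" "\<And>t. t \<in> {a..b} \<Longrightarrow> trace (Ga t) = 0" "continuous_on {a..b} Ga"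
    and Dr: "\<And>t. t \<in> {a..b} \<Longrightarrow> posdef (Dr t)" "continuous_on {a..b} Dr"
    and B0: "posdef B0" "det B0 = 1"
  obtains B where "B a = B0"
    "\<And>t. t \<in> {a..b} \<Longrightarrow>
       (B has_vector_derivative fec_rhsB lam (Om t) (Ga t) (Dr t) (Aop (B t)) (B t)) (at t within {a..b})"
    "\<And>t. t \<in> {a..b} \<Longrightarrow> posdef (B t)" "\<And>t. t \<in> {a..b} \<Longrightarrow> det (B t) = 1"
proof -
  have symDr: "sym_mat (Dr t)" if "t \<in> {a..b}" for t using Dr(1)[OF that] by (simp add: posdef_def)
  define Y where "Y = (\<lambda>t. fec_drift lam (Om t) (Ga t) (Dr t))"
  have "continuous_on {a..b} Y" unfolding Y_def fec_drift_def by (intro continuous_intros Om Ga Dr)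
  then have "bounded (Y ` {a..b})" by (intro compact_imp_bounded compact_continuous_image) auto
  then obtain m where m: "\<And>t. t \<in> {a..b} \<Longrightarrow> norm (Y t) \<le> m"
    unfolding bounded_iff by blast
  have m0: "0 \<le> m" using order_trans[OF norm_ge_zero m[of a]] ab by simp
  \<comment> \<open>The 15 is that of \<open>trace_inv_fec_rhsA_ge\<close>, so \<open>c\<close>
    bounds the decay rate of the determinant of \<open>A\<close> on the interval.\<close>
  define c where "c = 15 * m"
  have c0: "0 \<le> c" using m0 by (simp add: c_def)
  obtain e0 where e0: "0 < e0" "e0 \<le> 1" and co0: "coercive e0 B0"
    using posdef_coercive[OF B0(1)] by blast
  define d0 where "d0 = det (Aop B0)"
  have d0: "0 < d0"
    unfolding d0_def by (rule posdef_det_pos[OF posdef_Aop[OF co0 e0]])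
  \<comment> \<open>The exponential lower bound at the right end, hence valid on the whole interval;
    it fixes all constants before the solution exists.\<close>
  define d where "d = d0 * exp (- (c * (b - a)))"
  have d: "0 < d" using d0 by (simp add: d_def)
  have d_le: "d \<le> d0 * exp (- (c * (t - a)))" if "t \<in> {a..b}" for t
    unfolding d_def using that d0 c0 by (intro mult_left_mono) (auto intro!: mult_left_mono)
  have "d \<le> d0" using d_le[of a] ab by simp
  note B0_controls = Aop_det_controls[OF co0 e0 B0(2) d, folded d0_def, OF this]
  \<comment> \<open>\<open>S\<close> provides coercivity \<open>d ^ 4\<close>; half of it is spent
    on the radius of the neighbourhood \<open>K\<close>, and symmetric parts of points of
    \<open>K\<close> keep the other half.\<close>
  define e where "e = d ^ 4 / 2"
  have e: "0 < e" "e \<le> 1"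
    using d power_le_one[of d 4] B0_controls(1) by (simp_all add: e_def)
  define S where "S = {X. coercive (2 * e) X \<and> norm X \<le> 2 / d\<^sup>2}"
  have S_I: "X \<in> S" if "coercive e' X" "0 < e'" "e' \<le> 1" "det X = 1" "d \<le> det (Aop X)" for X e'
    using Aop_det_controls[OF that(1-4) d that(5)] by (simp add: S_def e_def)
  have B0S: "B0 \<in> S" using B0_controls by (simp add: S_def e_def)
  have closedS: "closed S"
    unfolding S_def by (intro closed_Collect_conj closed_coercive closed_Collect_le continuous_intros)
  define K where "K = {X. infdist X S \<le> e}"
  have near: "\<exists>Z\<in>S. dist X Z \<le> e" if "X \<in> K" for X
  proof -
    have "S \<noteq> {}" using B0S by blast
    then obtain Z where "Z \<in> S" "infdist X S = dist X Z" using infdist_attains_inf[OF closedS] by metis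
    then show ?thesis using that by (auto simp: K_def)
  qed
  have coK: "coercive e (sym_part X)" if "X \<in> K" for X
    using near[OF that] coercive_sym_part_near[of e] by (auto simp: S_def)
  have closedK: "closed K" unfolding K_def by (intro closed_Collect_le continuous_intros)
  have "bounded K"
    unfolding bounded_iff
  proof (intro exI ballI)
    fix X assume "X \<in> K"
    then obtain Z where "Z \<in> S" "dist X Z \<le> e" using near by blast
    then show "norm X \<le> 2 / d\<^sup>2 + e"
      using norm_triangle_ineq2[of X Z] by (simp add: S_def dist_norm)
  qed
  then have compactK: "compact K" using closedK by (simp add: compact_eq_bounded_closed)
  define cut where "cut = (\<lambda>X. max 0 (1 - infdist X S / e))"
  have cut01: "0 \<le> cut X" "cut X \<le> 1" for X using e infdist_nonneg[of X S] by (auto simp: cut_def)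
  have cut_S: "cut X = 1" if "X \<in> S" for X using that by (simp add: cut_def)
  have cut_0: "cut X = 0" if "e \<le> infdist X S" for X using that e by (simp add: cut_def)
  define G where "G = (\<lambda>t X. fec_rhsB lam (Om t) (Ga t) (Dr t) (Aop X) X)"
  \<comment> \<open>Evaluation at the symmetric part makes the field meaningful on all of
    \<open>K\<close>, with symmetric values; the symmetry of the solution is recovered from this
    afterwards.\<close>
  define F where "F = (\<lambda>t X. cut X *\<^sub>R G t (sym_part X))"
  have contG: "continuous_on ({a..b} \<times> K) (\<lambda>p. G (fst p) (sym_part (snd p)))"
    unfolding G_def
  proof (rule continuous_on_fec_rhsB[where e = e])
    show "continuous_on ({a..b} \<times> K) (\<lambda>p. Om (fst p))" "continuous_on ({a..b} \<times> K) (\<lambda>p. Ga (fst p))"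
      "continuous_on ({a..b} \<times> K) (\<lambda>p. Dr (fst p))"
      by (auto intro!: continuous_on_compose2[OF Om(2)] continuous_on_compose2[OF Ga(3)]
          continuous_on_compose2[OF Dr(2)] continuous_intros)
    show "continuous_on ({a..b} \<times> K) (\<lambda>p. sym_part (snd p))"
      unfolding sym_part_def by (intro continuous_intros)
  qed (use e coK symDr in auto)
  have contcut: "continuous_on T (\<lambda>p. cut (snd p))" for T :: "(real \<times> mat3) set"
    unfolding cut_def using e by (intro continuous_intros) auto
  have contF: "continuous_on ({a..b} \<times> UNIV) (\<lambda>(t, X). F t X)"
  proof -
    \<comment> \<open>\<open>K\<close> and \<open>?L\<close> are closed, cover the space and meet
      where the distance is \<open>e\<close> and the cut-off is 0, so pasting reduces continuity to
      the behaviour on \<open>K\<close>.\<close>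
    let ?L = "{X. e \<le> infdist X S}"
    have "continuous_on ({a..b} \<times> K) (\<lambda>(t, X). F t X)"
      unfolding F_def case_prod_unfold by (intro continuous_intros contcut contG)
    moreover have "continuous_on ({a..b} \<times> ?L) (\<lambda>(t, X). F t X)"
      by (rule continuous_on_eq[OF continuous_on_const[of _ 0]]) (auto simp: F_def cut_0)
    moreover have "closed ?L" by (intro closed_Collect_le continuous_intros)
    ultimately have "continuous_on ({a..b} \<times> K \<union> {a..b} \<times> ?L) (\<lambda>(t, X). F t X)"
      by (intro continuous_on_closed_Un closed_Times closedK) auto
    moreover have "{a..b} \<times> K \<union> {a..b} \<times> ?L = {a..b} \<times> UNIV" by (auto simp: K_def)
    ultimately show ?thesis by simp
  qed
  have "bounded ((\<lambda>p. G (fst p) (sym_part (snd p))) ` ({a..b} \<times> K))"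
    by (intro compact_imp_bounded compact_continuous_image contG compact_Times compactK) auto
  then obtain N where N: "\<And>t X. t \<in> {a..b} \<Longrightarrow> X \<in> K \<Longrightarrow> norm (G t (sym_part X)) \<le> N"
    unfolding bounded_iff by (metis (no_types, lifting) SigmaI fst_conv imageI snd_conv)
  have boundF: "norm (F t X) \<le> max 0 N" if t: "t \<in> {a..b}" for t X
  proof (cases "X \<in> K")
    case True
    have "norm (F t X) = cut X * norm (G t (sym_part X))" using cut01[of X] by (simp add: F_def)
    also have "\<dots> \<le> 1 * norm (G t (sym_part X))" using cut01[of X] by (intro mult_right_mono) auto
    also have "\<dots> \<le> max 0 N" using N[OF t True] by simp
    finally show ?thesis .
  next
    case False
    then show ?thesis by (simp add: F_def cut_0 K_def)
  qed
  obtain B where Ba: "B a = B0"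
    and B': "\<And>t. t \<in> {a..b} \<Longrightarrow> (B has_vector_derivative F t (B t)) (at t within {a..b})"
    using peano_bounded[OF contF ab boundF, of B0] by blast
  have contB: "continuous_on {a..b} B"
    using B' by (rule has_vector_derivative_imp_continuous_on)
  \<comment> \<open>Outside \<open>K\<close> the truncated field vanishes, so the solution cannot move away from \<open>K\<close>.\<close>
  have inK: "B t \<in> K" if t: "t \<in> {a..b}" for t
  proof (rule ccontr)
    assume nK: "B t \<notin> K"
    let ?Z = "{a..t} \<inter> B -` K"
    have "continuous_on {a..t} B" by (rule continuous_on_subset[OF contB]) (use t in auto)
    then have "closed ?Z" by (intro continuous_closed_preimage closedK) auto
    then have "compact ({a..t} \<inter> ?Z)" by (intro compact_Int_closed) auto
    then have "compact ?Z" by (simp add: Int_assoc[symmetric])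
    moreover have "a \<in> ?Z" using t B0S e by (auto simp: Ba K_def)
    ultimately obtain r where r: "r \<in> ?Z" and max: "\<And>s. s \<in> ?Z \<Longrightarrow> s \<le> r"
      using compact_attains_sup[of ?Z] by blast
    have "B t = B r"
    proof (rule has_derivative_zero_unique_strong_convex[of "{r..t}" "{r}" B r])
      show "continuous_on {r..t} B" by (rule continuous_on_subset[OF contB]) (use t r in auto)
      fix s assume s: "s \<in> {r..t} - {r}"
      then have sab: "s \<in> {a..b}" using r t by auto
      have "B s \<notin> K" using max[of s] s r by auto
      then have "F s (B s) = 0" by (simp add: F_def cut_0 K_def)
      then have "(B has_derivative (\<lambda>h. 0)) (at s within {a..b})"
        using B'[OF sab] by (simp add: has_vector_derivative_def)
      then show "(B has_derivative (\<lambda>h. 0)) (at s within {r..t})"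
        by (rule has_derivative_subset) (use r t in auto)
    qed (use r t in auto)
    then show False using nK r by simp
  qed
  have symF: "sym_mat (F t (B t))" if t: "t \<in> {a..b}" for t
    unfolding F_def G_def
    by (intro sym_mat_scaleR sym_mat_fec_rhsB[OF _ _ _ coK e] Om Ga symDr inK t)
  have symB: "sym_mat (B t)" if t: "t \<in> {a..b}" for t
  proof -
    have "((\<lambda>t. B t - transpose (B t)) has_vector_derivative 0) (at s within {a..b})" if s: "s \<in> {a..b}" for s
      using has_vector_derivative_diff[OF B'[OF s] bounded_linear.has_vector_derivative[OF bounded_linear_transpose B'[OF s]]]
        symF[OF s] by (simp add: sym_mat_def)
    then have "\<exists>k. \<forall>s\<in>{a..b}. B s - transpose (B s) = k"
      by (intro has_derivative_zero_constant) (auto simp: has_vector_derivative_def)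
    moreover have "B a - transpose (B a) = 0" using B0(1) by (simp add: Ba posdef_def sym_mat_def)
    ultimately have "B t - transpose (B t) = 0" using t ab by (metis atLeastAtMost_iff order_refl)
    then show ?thesis by (simp add: sym_mat_def)
  qed
  have coB: "coercive e (B t)" if t: "t \<in> {a..b}" for t
    using coK[OF inK[OF t]] by (simp add: sym_part_id symB[OF t])
  have FB: "F t (B t) = cut (B t) *\<^sub>R G t (B t)" if t: "t \<in> {a..b}" for t
    by (simp add: F_def sym_part_id symB[OF t])
  define A where "A = (\<lambda>t. Aop (B t))"
  define R where "R = (\<lambda>t. fec_rhsA lam (Om t) (Ga t) (Dr t) (A t) (B t))"
  have A': "(A has_vector_derivative cut (B t) *\<^sub>R R t) (at t within {a..b})" if t: "t \<in> {a..b}" for t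
  proof -
    have "(A has_vector_derivative - (Cop (B t) \<ddagger> F t (B t))) (at t within {a..b})"
      unfolding A_def
      by (rule has_vector_derivative_Aop[where B' = "\<lambda>t. F t (B t)" and m = "max 0 N", OF _ t e coB B' boundF symF[OF t]]) auto
    moreover have "- (Cop (B t) \<ddagger> G t (B t)) = R t"
      unfolding G_def R_def A_def by (rule Cop_fec_rhsB[OF _ _ _ coB e]) (use Om Ga symDr t in auto)
    ultimately show ?thesis by (simp add: FB[OF t] ddot_scaleR flip: scaleR_minus_right)
  qed
  have trA: "trace (A t) = 1" if t: "t \<in> {a..b}" for t
  proof -
    \<comment> \<open>Nondecreasing, at most 0, and 0 at \<open>a\<close>, so it stays 0;
      monotonicity takes the place of solving the linear equation for the trace.\<close>
    let ?z = "\<lambda>t. - (1 - trace (A t))\<^sup>2"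
    have "?z a \<le> ?z t"
    proof (rule nondecreasing_within[OF _ _ t])
      fix s assume s: "s \<in> {a..b}"
      have "trace (R s) = 2 * trace (Dr s) * (1 - trace (A s))"
        unfolding R_def A_def by (rule trace_fec_rhsA[OF _ _ _ coB e]) (use Om Ga symDr s in auto)
      then have tr: "((\<lambda>t. trace (A t)) has_real_derivative cut (B s) * (2 * trace (Dr s) * (1 - trace (A s)))) (at s within {a..b})"
        using bounded_linear.has_vector_derivative[OF bounded_linear_trace A'[OF s]]
        by (simp add: has_real_derivative_iff_has_vector_derivative trace_scaleR)
      show "(?z has_real_derivative 4 * cut (B s) * trace (Dr s) * (1 - trace (A s))\<^sup>2) (at s within {a..b})"
        by (rule derivative_eq_intros tr refl)+ (simp add: power2_eq_square)
      show "0 \<le> 4 * cut (B s) * trace (Dr s) * (1 - trace (A s))\<^sup>2"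
        using cut01(1)[of "B s"] trace_posdef_nonneg[OF Dr(1)[OF s]] by simp
    qed
    moreover have "trace (A a) = 1" using trace_Aop[OF co0 e0] B0(2) by (simp add: A_def Ba)
    ultimately show ?thesis by simp
  qed
  have detB: "det (B t) = 1" if t: "t \<in> {a..b}" for t
  proof -
    have "1 / sqrt (det (B t)) = 1" using trA[OF t] trace_Aop[OF coB[OF t] e] by (simp add: A_def)
    then show ?thesis by (simp add: divide_eq_eq split: if_splits)
  qed
  have detA: "d \<le> det (A t)" if t: "t \<in> {a..b}" for t
  proof -
    \<comment> \<open>The integrating factor turns the lower bound on the logarithmic derivative
      into monotonicity.\<close>
    let ?w = "\<lambda>t. det (A t) * exp (c * (t - a))"
    have detA0: "0 < det (A s)" if "s \<in> {a..b}" for s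
      unfolding A_def by (rule posdef_det_pos[OF posdef_Aop[OF coB[OF that] e]])
    have "?w a \<le> ?w t"
    proof (rule nondecreasing_within[OF _ _ t])
      fix s assume s: "s \<in> {a..b}"
      let ?k = "cut (B s) * trace (matrix_inv (A s) ** R s)"
      have D: "((\<lambda>t. det (A t)) has_real_derivative det (A s) * ?k) (at s within {a..b})"
        using has_real_derivative_det3[OF A'[OF s]] detA0[OF s]
        by (simp add: bounded_bilinear.scaleR_right[OF bounded_bilinear_matrix_mult] trace_scaleR)
      show "(?w has_real_derivative det (A s) * exp (c * (s - a)) * (?k + c)) (at s within {a..b})"
        by (rule derivative_eq_intros D refl)+ (simp add: algebra_simps)
      have "- 15 * norm (Y s) \<le> trace (matrix_inv (A s) ** R s)"
        unfolding R_def A_def Y_def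
        by (rule trace_inv_fec_rhsA_ge[OF _ _ _ coB e]) (use Om Ga symDr Dr s in auto)
      then have "- c \<le> trace (matrix_inv (A s) ** R s)" using m[OF s] by (simp add: c_def)
      \<comment> \<open>A factor in [0, 1] only slows the possible decay, so the rate
        \<open>c\<close> remains valid for the truncated equation.\<close>
      then have "cut (B s) * (- c) \<le> ?k" using cut01(1) by (intro mult_left_mono)
      moreover have "cut (B s) * c \<le> 1 * c" using cut01(2) c0 by (intro mult_right_mono)
      ultimately have "0 \<le> ?k + c" by simp
      then show "0 \<le> det (A s) * exp (c * (s - a)) * (?k + c)" using detA0[OF s] by simp
    qed
    then have "d0 \<le> det (A t) * exp (c * (t - a))" by (simp add: A_def Ba d0_def)
    from mult_right_mono[OF this, of "exp (- (c * (t - a)))"]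
    have "d0 * exp (- (c * (t - a))) \<le> det (A t)" by (simp add: mult.assoc exp_minus_inverse del: mult_minus_right)
    then show ?thesis using d_le[OF t] by linarith
  qed
  show thesis
  proof (rule that[of B, OF Ba])
    fix t assume t: "t \<in> {a..b}"
    show "posdef (B t)" by (rule coercive_posdef[OF coB[OF t] e(1)])
    show "det (B t) = 1" by (rule detB[OF t])
    have "B t \<in> S" by (rule S_I[OF coB[OF t] e detB[OF t]]) (use detA[OF t] in \<open>simp add: A_def\<close>)
    then have "F t (B t) = G t (B t)" by (simp add: FB[OF t] cut_S)
    then show "(B has_vector_derivative fec_rhsB lam (Om t) (Ga t) (Dr t) (Aop (B t)) (B t)) (at t within {a..b})"
      using B'[OF t] by (simp add: G_def)
  qed
qed

section \<open>Global solutions\<close>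

text \<open>Dependent choice extends a solution on \<open>{0..real n}\<close> by one that starts
  from its value at \<open>real n\<close>, which the invariant \<open>P\<close> makes possible. Each
  choice extends the previous one, so they define a single function; at a junction both one-sided
  derivatives equal the field at the common value.\<close>

lemma glue_unit_interval_solutions:
  fixes f :: "real \<Rightarrow> 'a::real_normed_vector \<Rightarrow> 'a"
  assumes step: "\<And>n x. P x \<Longrightarrow> \<exists>C. C (real n) = x \<and> (\<forall>t\<in>{real n..real (Suc n)}.
      (C has_vector_derivative f t (C t)) (at t within {real n..real (Suc n)}) \<and> P (C t))"
    and x0: "P x0"
  obtains B where "B 0 = x0" "\<And>t. 0 \<le> t \<Longrightarrow> (B has_vector_derivative f t (B t)) (at t within {0..})"
    "\<And>t. 0 \<le> t \<Longrightarrow> P (B t)"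
proof -
  define Sol where "Sol = (\<lambda>n B. B 0 = x0 \<and> (\<forall>t\<in>{0..real n}.
      (B has_vector_derivative f t (B t)) (at t within {0..real n}) \<and> P (B t)))"
  have "\<exists>Y. \<forall>n. Sol n (Y n) \<and> (\<forall>t\<in>{0..real n}. Y (Suc n) t = Y n t)"
  proof (rule dependent_nat_choice)
    show "\<exists>B. Sol 0 B"
      \<comment> \<open>For \<open>n = 0\<close> the interval is a single point, at which any vector
        is a derivative.\<close>
      using x0 by (intro exI[of _ "\<lambda>_. x0"]) (simp add: Sol_def has_vector_derivative_def has_derivative_within_singleton_iff bounded_linear_scaleR_left)
  next
    fix B n assume B: "Sol n B"
    then have "P (B (real n))" by (simp add: Sol_def)
    from step[OF this, of n] obtain C where C: "C (real n) = B (real n)"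
      and C': "\<And>t. t \<in> {real n..real (Suc n)} \<Longrightarrow> (C has_vector_derivative f t (C t)) (at t within {real n..real (Suc n)})"
      and PC: "\<And>t. t \<in> {real n..real (Suc n)} \<Longrightarrow> P (C t)" by blast
    let ?S = "{0..real n}" and ?T = "{real n..real (Suc n)}"
    let ?B = "\<lambda>t. if t \<in> ?S then B t else C t"
    have un: "{0..real (Suc n)} = ?S \<union> ?T" by auto
    have int: "closure ?S \<inter> closure ?T = {real n}" by auto
    have "(?B has_vector_derivative f t (?B t)) (at t within {0..real (Suc n)})" if t: "t \<in> {0..real (Suc n)}" for t
    proof -
      have "(?B has_vector_derivative (if t \<in> ?S then f t (B t) else f t (C t))) (at t within {0..real (Suc n)})"
      proof (rule has_vector_derivative_If_within_closures[OF _ un])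
        show "t \<in> ?S \<union> ?T" using t un by blast
        have S: "?S \<union> (closure ?S \<inter> closure ?T) = ?S" and T: "?T \<union> (closure ?S \<inter> closure ?T) = ?T"
          unfolding int by auto
        show "(B has_vector_derivative f t (B t)) (at t within ?S \<union> (closure ?S \<inter> closure ?T))"
          if "t \<in> ?S \<union> (closure ?S \<inter> closure ?T)"
          using that B unfolding S by (simp add: Sol_def)
        show "(C has_vector_derivative f t (C t)) (at t within ?T \<union> (closure ?S \<inter> closure ?T))"
          if "t \<in> ?T \<union> (closure ?S \<inter> closure ?T)"
          using that C' unfolding T by blast
        have "B t = C t" if "t \<in> closure ?S" "t \<in> closure ?T"
        proof -
          have "t = real n" using that int by blast
          then show ?thesis using C by simp
        qed
        then show "t \<in> closure ?S \<Longrightarrow> t \<in> closure ?T \<Longrightarrow> B t = C t"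
          "t \<in> closure ?S \<Longrightarrow> t \<in> closure ?T \<Longrightarrow> f t (B t) = f t (C t)" by simp_all
      qed
      moreover have "(if t \<in> ?S then f t (B t) else f t (C t)) = f t (?B t)" by (rule if_distrib[symmetric])
      ultimately show ?thesis by (simp only:)
    qed
    then have "Sol (Suc n) ?B" using B PC by (auto simp: Sol_def)
    then show "\<exists>B'. Sol (Suc n) B' \<and> (\<forall>t\<in>?S. B' t = B t)" by (intro exI[of _ ?B]) auto
  qed
  then obtain Y where Sol: "\<And>n. Sol n (Y n)" and ext: "\<And>n. \<forall>t\<in>{0..real n}. Y (Suc n) t = Y n t"
    by blast
  have agree: "Y (n + k) t = Y n t" if "t \<in> {0..real n}" for n k t
    using that
  proof (induction k)
    case (Suc k)
    then have "Y (Suc (n + k)) t = Y (n + k) t" using ext[of "n + k"] by auto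
    then show ?case using Suc by simp
  qed simp
  \<comment> \<open>For \<open>t \<ge> 0\<close> this is the solution with the least index whose
    interval contains \<open>t\<close>; all later ones agree with it there.\<close>
  define B where "B = (\<lambda>t. Y (nat \<lceil>t\<rceil>) t)"
  have BY: "B t = Y n t" if "t \<in> {0..real n}" for t n
  proof -
    have "nat \<lceil>t\<rceil> \<le> n" "t \<in> {0..real (nat \<lceil>t\<rceil>)}" using that by (auto simp: ceiling_le_iff le_of_int_ceiling)
    then show ?thesis using agree[of t "nat \<lceil>t\<rceil>" "n - nat \<lceil>t\<rceil>"] by (simp add: B_def)
  qed
  show thesis
  proof (rule that[of B])
    show "B 0 = x0" using BY[of 0 0] Sol[of 0] by (simp add: Sol_def)
    fix t :: real assume t: "0 \<le> t"
    \<comment> \<open>The strict inequality keeps \<open>t\<close> away from the right end point, so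
      that derivatives within \<open>{0..real n}\<close> and within \<open>{0..}\<close>
      coincide.\<close>
    obtain n where n: "t < real n" using reals_Archimedean2 by blast
    have tn: "t \<in> {0..real n}" using t n by simp
    show "P (B t)" using Sol[of n] tn by (simp add: Sol_def BY[OF tn])
    have "(Y n has_vector_derivative f t (B t)) (at t within {0..real n})"
      using Sol[of n] tn by (simp add: Sol_def BY[OF tn])
    from has_vector_derivative_transform[OF tn BY this]
    have "(B has_vector_derivative f t (B t)) (at t within {0..real n})" .
    moreover have "at t within {0..real n} = at t within {0..}"
      by (rule at_within_nhd[of _ "{..<real n}"]) (use n in auto)
    ultimately show "(B has_vector_derivative f t (B t)) (at t within {0..})" by simp
  qed
qed

text \<open>Coercivity constants and bounds on \<open>B'\<close> are obtained by compactness, hence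
  on bounded intervals only. The margin 1 in \<open>{0..t + 1}\<close> makes the derivative at
  \<open>t\<close> the same as on the half line.\<close>

lemma has_vector_derivative_Aop_halfline:
  fixes B :: "real \<Rightarrow> mat3"
  assumes B: "\<And>u. 0 \<le> u \<Longrightarrow> (B has_vector_derivative B' u) (at u within {0..})"
    and B': "continuous_on {0..} B'" and pd: "\<And>u. 0 \<le> u \<Longrightarrow> posdef (B u)" and sym: "sym_mat (B' t)"
    and t: "0 \<le> t"
  shows "((\<lambda>u. Aop (B u)) has_vector_derivative - (Cop (B t) \<ddagger> B' t)) (at t within {0..})"
proof -
  let ?T = "{0..t + 1}"
  have dB: "(B has_vector_derivative B' u) (at u within ?T)" if "u \<in> ?T" for u
    by (rule has_vector_derivative_within_subset[OF B]) (use that in auto)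
  then have "continuous_on ?T B" by (rule has_vector_derivative_imp_continuous_on)
  then obtain e where e: "0 < e" "e \<le> 1" and co: "\<And>u. u \<in> ?T \<Longrightarrow> coercive e (B u)"
    using coercive_uniform[of ?T B] pd by auto
  have "bounded (B' ` ?T)"
    by (intro compact_imp_bounded compact_continuous_image continuous_on_subset[OF B']) auto
  then obtain m where m: "\<And>u. u \<in> ?T \<Longrightarrow> norm (B' u) \<le> m" unfolding bounded_iff by blast
  have tT: "t \<in> ?T" using t by simp
  have "((\<lambda>u. Aop (B u)) has_vector_derivative - (Cop (B t) \<ddagger> B' t)) (at t within ?T)"
    by (rule has_vector_derivative_Aop[where T = ?T, OF _ tT e co dB m sym]) auto
  moreover have "at t within ?T = at t within {0..}"
    by (rule at_within_nhd[of _ "{..<t + 1}"]) auto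
  ultimately show ?thesis by simp
qed

theorem theorem2:
  fixes lam :: real and Om Ga Dr Dr' :: "real \<Rightarrow> real^3^3" and B0 :: "real^3^3"
  assumes Om_anti: "\<forall>t\<ge>0. transpose (Om t) = - Om t"
    and Om_cont: "continuous_on {0..} Om" and Om_bdd: "bounded (Om ` {0..})"
    and Ga_sym: "\<forall>t\<ge>0. sym_mat (Ga t)" and Ga_tr: "\<forall>t\<ge>0. trace (Ga t) = 0"
    and Ga_cont: "continuous_on {0..} Ga" and Ga_bdd: "bounded (Ga ` {0..})"
    and Dr_pd: "\<forall>t\<ge>0. posdef (Dr t)"
    and Dr_deriv: "\<forall>t\<ge>0. (Dr has_vector_derivative Dr' t) (at t within {0..})"
    and Dr'_cont: "continuous_on {0..} Dr'"
    and Dr_bdd: "bounded (Dr ` {0..})" and Dr'_bdd: "bounded (Dr' ` {0..})"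
    and Dr_inv_bdd: "bounded ((\<lambda>t. matrix_inv (Dr t)) ` {0..})"
    and B0_pd: "posdef B0" and B0_det: "det B0 = 1"
  shows "\<exists>A B :: real \<Rightarrow> real^3^3.
     A 0 = Aop B0 \<and> B 0 = B0 \<and>
     (\<forall>t\<ge>0. (A has_vector_derivative fec_rhsA lam (Om t) (Ga t) (Dr t) (A t) (B t)) (at t within {0..})
            \<and> (B has_vector_derivative fec_rhsB lam (Om t) (Ga t) (Dr t) (A t) (B t)) (at t within {0..})) \<and>
     (\<forall>t\<ge>0. posdef (B t) \<and> det (B t) = 1 \<and> A t = Aop (B t) \<and> posdef (A t) \<and> trace (A t) = 1)"
proof -
  have Dr_cont: "continuous_on {0..} Dr"
    by (rule has_vector_derivative_imp_continuous_on) (use Dr_deriv in auto)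
  define f where "f = (\<lambda>t X. fec_rhsB lam (Om t) (Ga t) (Dr t) (Aop X) X)"
  have step: "\<exists>C. C (real n) = X \<and> (\<forall>t\<in>{real n..real (Suc n)}.
      (C has_vector_derivative f t (C t)) (at t within {real n..real (Suc n)}) \<and> posdef (C t) \<and> det (C t) = 1)"
    if X: "posdef X \<and> det X = 1" for n X
  proof -
    let ?I = "{real n..real (Suc n)}"
    have sub: "?I \<subseteq> {0..}" by auto
    obtain C where "C (real n) = X"
      "\<And>t. t \<in> ?I \<Longrightarrow> (C has_vector_derivative fec_rhsB lam (Om t) (Ga t) (Dr t) (Aop (C t)) (C t)) (at t within ?I)"
      "\<And>t. t \<in> ?I \<Longrightarrow> posdef (C t)" "\<And>t. t \<in> ?I \<Longrightarrow> det (C t) = 1"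
      by (rule fec_solution_interval[of "real n" "real (Suc n)" Om Ga Dr X lam])
        (use X sub Om_anti Ga_sym Ga_tr Dr_pd in
          \<open>auto intro: continuous_on_subset[OF Om_cont] continuous_on_subset[OF Ga_cont] continuous_on_subset[OF Dr_cont]\<close>)
    then show ?thesis unfolding f_def by blast
  qed
  obtain B where B_0: "B 0 = B0"
    and B': "\<And>t. 0 \<le> t \<Longrightarrow> (B has_vector_derivative f t (B t)) (at t within {0..})"
    and PB: "\<And>t. 0 \<le> t \<Longrightarrow> posdef (B t) \<and> det (B t) = 1"
    using glue_unit_interval_solutions[where P = "\<lambda>X. posdef X \<and> det X = 1", OF step] B0_pd B0_det by metis
  have coB: "\<exists>e. 0 < e \<and> e \<le> 1 \<and> coercive e (B t)" if "0 \<le> t" for t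
    using posdef_coercive PB[OF that] by metis
  have symDr: "sym_mat (Dr t)" if "0 \<le> t" for t using Dr_pd that by (simp add: posdef_def)
  have contB: "continuous_on {0..} B"
    by (rule has_vector_derivative_imp_continuous_on) (use B' in auto)
  \<comment> \<open>Continuity of the field along the solution supplies the local bound on the
    derivative of \<open>B\<close> under which \<open>Aop\<close> can be differentiated; it is
    checked on compact intervals, where one coercivity constant serves.\<close>
  have contf: "continuous_on {0..} (\<lambda>t. f t (B t))"
    unfolding continuous_on_eq_continuous_within
  proof
    fix t :: real assume t: "t \<in> {0..}"
    let ?T = "{0..t + 1}"
    have cB: "continuous_on ?T B" by (rule continuous_on_subset[OF contB]) auto
    obtain e where e: "0 < e" "e \<le> 1" and co: "\<And>u. u \<in> ?T \<Longrightarrow> coercive e (B u)"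
      using coercive_uniform[OF _ cB] PB by auto
    have "continuous_on ?T (\<lambda>t. f t (B t))"
      unfolding f_def
      by (rule continuous_on_fec_rhsB[OF _ _ _ cB co e])
        (auto intro: continuous_on_subset[OF Om_cont] continuous_on_subset[OF Ga_cont] continuous_on_subset[OF Dr_cont] symDr)
    then have "continuous (at t within ?T) (\<lambda>t. f t (B t))"
      using t by (simp add: continuous_on_eq_continuous_within)
    moreover have "at t within ?T = at t within {0..}"
      by (rule at_within_nhd[of _ "{..<t + 1}"]) auto
    ultimately show "continuous (at t within {0..}) (\<lambda>t. f t (B t))" by simp
  qed
  show ?thesis
  proof (rule exI[of _ "\<lambda>t. Aop (B t)"], rule exI[of _ B], intro conjI allI impI)
    fix t :: real assume t: "0 \<le> t"
    obtain e where e: "0 < e" "e \<le> 1" and co: "coercive e (B t)" using coB[OF t] by blast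
    have data: "transpose (Om t) = - Om t" "sym_mat (Ga t)" "sym_mat (Dr t)"
      using Om_anti Ga_sym symDr t by auto
    have "((\<lambda>u. Aop (B u)) has_vector_derivative - (Cop (B t) \<ddagger> f t (B t))) (at t within {0..})"
      by (rule has_vector_derivative_Aop_halfline[OF B' contf])
        (use PB t sym_mat_fec_rhsB[OF data co e] in \<open>auto simp: f_def\<close>)
    then show "((\<lambda>t. Aop (B t)) has_vector_derivative fec_rhsA lam (Om t) (Ga t) (Dr t) (Aop (B t)) (B t)) (at t within {0..})"
      unfolding f_def Cop_fec_rhsB[OF data co e] .
    show "(B has_vector_derivative fec_rhsB lam (Om t) (Ga t) (Dr t) (Aop (B t)) (B t)) (at t within {0..})"
      using B'[OF t] by (simp add: f_def)
    show "posdef (B t)" "det (B t) = 1" using PB[OF t] by auto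
    show "posdef (Aop (B t))" by (rule posdef_Aop[OF co e])
    show "trace (Aop (B t)) = 1" using PB[OF t] by (simp add: trace_Aop[OF co e])
  qed (simp_all add: B_0)
qed

end
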